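(* Let $\eta>0$, and let $g$, $m$ and the integer $b\ge 0$ be numbers, with $\eta,g,m,b$ all independent of $h$. Suppose that for all $s\in\mathbb{C}$ with $\mathrm{Re}(s)=\eta>0$ and for every $r=1,\dots,N_y$, the solution $\hat\epsilon^{(r)}$ of the scalar difference equation $$(\tilde s^2+h^2\lambda^{(r)})\,\hat\epsilon^{(r)}=Q_x\hat\epsilon^{(r)}+h^{p+2}\hat\tau^{(r)},\qquad \tilde s=sh,$$ is bounded as $$\|\hat\epsilon^{(r)}\|_{1D,x}^2\leq \frac{Kh^{2g}}{\eta^m}\sum_{i=0}^{k}\left(|\hat\tau_i^{(r)}|^2+\left|\widehat{\frac{\partial^b\tau_i^{(r)}}{\partial t^b}}\right|^2\right),$$ with $K$ independent of $h$. Then the solution $\zeta$ of the two-dimensional error equation $$\zeta_{tt}=\frac1{h^2}(Q_x\otimes I_y)\zeta+\frac1{h^2}(I_x\otimes Q_y)\zeta+h^pT$$ satisfies $$\int_0^{t_f}\|\zeta\|_{2D}^2\,dt\leq\frac{K e^{2\eta t_f}h^{2g}}{\eta^m}\int_0^{t_f}\chi^2(\Phi)\sum_{i=0}^{k}\left(\|T_i\|_{1D,y}^2+\left\|\frac{\partial^bT_i}{\partial t^b}\right\|_{1D,y}^2\right)dt,$$ where $\chi(\Phi)=\|\Phi\|\,\|\Phi^{-1}\|$ is the condition number of $\Phi$ in the spectral norm, and $K$ denotes a constant independent of $h$ (not necessarily the same as in the hypothesis).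
   Context: Setting. The wave equation $U_{tt}=U_{xx}+U_{yy}+F$ on $0\le x<\infty$, $0\le y\le1$, $0\le t\le t_f$, with well-posed initial and boundary conditions, is discretized in space on the grid $x_i=(i-1)h$, $i=1,2,\dots$, $y_j=(j-1)h$, $j=1,\dots,N_y$, $h=1/(N_y-1)$, by $$u_{tt}=\frac1{h^2}(Q_x\otimes I_y)u+\frac1{h^2}(I_x\otimes Q_y)u+F_h .$$ Grid functions are ordered column-wise (the first $N_y$ components lie on $x=0$). $Q_x/h^2$ and $Q_y/h^2$ are finite difference operators approximating the second derivative in $x$ (half-line) and $y$ (interval), including the implementation of the boundary conditions; $I_x,I_y$ are identities. The semi-discretization is assumed to be stable. The true solution is assumed sufficiently smooth and in $L_2$ at any time, and the data are assumed compatible: spatial derivatives of the initial data on the boundary and temporal derivatives of the boundary data at $t=0$ vanish up to sufficiently high order (so that $T$ and its time derivatives up to the required order vanish at $t=0$, and $\widehat{\partial_t^bT}=s^b\hat T$). Assumption on $Q_y$. There is a symmetric positive definite matrix $P$ (of size $N_y\times N_y$) such that $PQ_y$ is symmetric negative semi-definite, and the spectral norms of $P^{1/2}$ and $P^{-1/2}$ are uniformly bounded in $N_y$. Consequently $Q_y/h^2=-\Phi\Lambda\Phi^{-1}$, where $\Lambda=\mathrm{diag}(\lambda^{(1)},\dots,\lambda^{(N_y)})$ has real entries $\lambda^{(r)}\ge0$ in ascending order, and the eigenvector matrix $\Phi$ is normalized so that $\|\Phi\|=\|P^{-1/2}\|$, $\|\Phi^{-1}\|=\|P^{1/2}\|$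 ($\|\cdot\|$ is the spectral norm for matrices). Error and truncation error. $\zeta(t)$ is the pointwise error due to the boundary truncation error $h^pT$ at $x=0$, with zero initial data. $T=[T_0;T_1;\cdots;T_k;\mathbf 0;\mathbf 0;\cdots]$, where $k$ is independent of $h$, $T_i=T_i(t)$ is a grid function in $y$ (a vector of length $N_y$) located at $x=ih$, and $\mathbf 0$ is the zero vector of length $N_y$. $T$ does not scale with $h$. Transformed quantities. $\hat{\ }$ denotes the Laplace transform in time with dual variable $s$. Set $\epsilon=(I_x\otimes\Phi^{-1})\zeta$ and $\tau_i=\Phi^{-1}T_i$. For each $r$, $\epsilon^{(r)}$ is the grid function in $x$ formed by the $r$-th components (in the $y$-direction) of $\epsilon$, $\tau_i^{(r)}$ is the $r$-th entry of $\tau_i$, and $\tau^{(r)}=[\tau^{(r)}_0,\dots,\tau^{(r)}_k,0,0,\dots]^T$. Applying these transformations to the error equation gives the scalar difference equations in the claim. The hypothesized bound is an estimate for these difference equations, i.e. its constant $K$ does not depend on the data $\tau^{(r)}$, on $r$ or on $s$ with $\mathrm{Re}(s)=\eta$. Norms. $\|w\|_{2D}^2=h^2\sum|w|^2$ over all grid points; $\|v\|_{1D,x}^2=h\sum|v|^2$ over the grid points of a line in the $x$-direction; $\|v\|_{1D,y}^2=h\sum|v|^2$ over the $N_y$ grid points of a line in the $y$-direction. *)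

theory Defs
  imports "HOL-Analysis.Analysis" "Jordan_Normal_Form.Gauss_Jordan_Elimination"
begin

text \<open>
  Grid indices start at 0: the index \<open>i\<close> stands for \<open>x = i h\<close> and \<open>j < N\<close> for \<open>y = j h\<close>, where \<open>N\<close>
  is the number of grid points in \<open>y\<close>. A grid function on the two-dimensional grid is a function
  \<open>u i j\<close>, a time-dependent one is \<open>u t i j\<close>; values at \<open>j \<ge> N\<close> are never inspected.
\<close>

definition mesh :: "nat \<Rightarrow> real" where
  "mesh N = 1 / (real N - 1)"

definition norm2D :: "nat \<Rightarrow> (nat \<Rightarrow> nat \<Rightarrow> real) \<Rightarrow> real" where
  "norm2D N u = sqrt ((mesh N)\<^sup>2 * (\<Sum>i. \<Sum>j<N. \<bar>u i j\<bar>\<^sup>2))"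

definition norm1Dx :: "nat \<Rightarrow> (nat \<Rightarrow> complex) \<Rightarrow> real" where
  "norm1Dx N v = sqrt (mesh N * (\<Sum>i. (cmod (v i))\<^sup>2))"

definition norm1Dy :: "nat \<Rightarrow> (nat \<Rightarrow> real) \<Rightarrow> real" where
  "norm1Dy N w = sqrt (mesh N * (\<Sum>j<N. \<bar>w j\<bar>\<^sup>2))"

definition l2_bounded_on :: "nat \<Rightarrow> real set \<Rightarrow> (real \<Rightarrow> nat \<Rightarrow> nat \<Rightarrow> real) \<Rightarrow> bool" where
  "l2_bounded_on N S u \<longleftrightarrow>
     (\<forall>t\<in>S. summable (\<lambda>i. \<Sum>j<N. \<bar>u t i j\<bar>\<^sup>2)) \<and> (\<exists>B. \<forall>t\<in>S. norm2D N (u t) \<le> B)"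

text \<open>Derivatives in time are relative to a closed interval \<open>S\<close>, hence one-sided at its end points.\<close>

definition nderiv :: "real set \<Rightarrow> nat \<Rightarrow> (real \<Rightarrow> real) \<Rightarrow> real \<Rightarrow> real" where
  "nderiv S n f = ((\<lambda>g t. vector_derivative g (at t within S)) ^^ n) f"

definition C_on :: "nat \<Rightarrow> real set \<Rightarrow> (real \<Rightarrow> real) \<Rightarrow> bool" where
  "C_on n S f \<longleftrightarrow> (\<forall>l<n. nderiv S l f differentiable_on S) \<and> continuous_on S (nderiv S n f)"

definition time_deriv ::
    "real set \<Rightarrow> nat \<Rightarrow> (real \<Rightarrow> nat \<Rightarrow> nat \<Rightarrow> real) \<Rightarrow> real \<Rightarrow> nat \<Rightarrow> nat \<Rightarrow> real" where
  "time_deriv S n u t i j = nderiv S n (\<lambda>\<tau>. u \<tau> i j) t"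

definition laplace :: "(real \<Rightarrow> real) \<Rightarrow> complex \<Rightarrow> complex" where
  "laplace f s = integral {0..} (\<lambda>t. exp (- s * of_real t) * of_real (f t))"

text \<open>Data whose derivatives up to order \<open>b\<close> have a Laplace transform at \<open>s\<close> and which are compatible at
  \<open>t = 0\<close>, so that the transform of the \<open>b\<close>-th derivative is \<open>s ^ b\<close> times the transform.\<close>

definition laplace_data :: "nat \<Rightarrow> complex \<Rightarrow> (real \<Rightarrow> real) \<Rightarrow> bool" where
  "laplace_data b s f \<longleftrightarrow>
     C_on b {0..} f \<and> (\<forall>l<b. nderiv {0..} l f 0 = 0) \<and>
     (\<forall>l\<le>b. (\<lambda>t. exp (- s * of_real t) * of_real (nderiv {0..} l f t))
               absolutely_integrable_on {0..})"

text \<open>An operator on the half-line grid is given by its infinite matrix of coefficients. Boundary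
  closures may alter finitely many rows; in all rows the stencil has bounded width and coefficients.\<close>

definition finite_difference_operator :: "(nat \<Rightarrow> nat \<Rightarrow> real) \<Rightarrow> bool" where
  "finite_difference_operator A \<longleftrightarrow>
     (\<exists>w B. \<forall>i l. \<bar>A i l\<bar> \<le> B \<and> (A i l \<noteq> 0 \<longrightarrow> i \<le> l + w \<and> l \<le> i + w))"

definition apply_x :: "(nat \<Rightarrow> nat \<Rightarrow> real) \<Rightarrow> (nat \<Rightarrow> complex) \<Rightarrow> nat \<Rightarrow> complex" where
  "apply_x A v i = (\<Sum>l | A i l \<noteq> 0. of_real (A i l) * v l)"

definition id_x :: "nat \<Rightarrow> nat \<Rightarrow> real" where
  "id_x i l = (if i = l then 1 else 0)"

text \<open>The action of the Kronecker product of \<open>A\<close> (in \<open>x\<close>) and \<open>B\<close> (in \<open>y\<close>) on a grid function; with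
  column-wise ordering, \<open>u i j\<close> is the \<open>j\<close>-th entry of the \<open>i\<close>-th block of length \<open>N\<close>.\<close>

definition kron_apply ::
    "nat \<Rightarrow> (nat \<Rightarrow> nat \<Rightarrow> real) \<Rightarrow> real mat \<Rightarrow> (nat \<Rightarrow> nat \<Rightarrow> real) \<Rightarrow> nat \<Rightarrow> nat \<Rightarrow> real" where
  "kron_apply N A B u i j = (\<Sum>l | A i l \<noteq> 0. \<Sum>q<N. A i l * B $$ (j, q) * u l q)"

definition column_forcing :: "nat \<Rightarrow> (nat \<Rightarrow> 'a::zero) \<Rightarrow> nat \<Rightarrow> 'a" where
  "column_forcing k c i = (if i \<le> k then c i else 0)"

text \<open>Solutions on the time interval from \<open>0\<close> to \<open>te\<close> of the semi-discrete wave equation with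
  forcing \<open>F\<close>, in the space of square-summable grid functions.\<close>

definition semidiscrete_solution ::
    "nat \<Rightarrow> (nat \<Rightarrow> nat \<Rightarrow> real) \<Rightarrow> real mat \<Rightarrow> real \<Rightarrow>
     (real \<Rightarrow> nat \<Rightarrow> nat \<Rightarrow> real) \<Rightarrow> (real \<Rightarrow> nat \<Rightarrow> nat \<Rightarrow> real) \<Rightarrow> bool" where
  "semidiscrete_solution N A B te F u \<longleftrightarrow>
     (\<forall>i. \<forall>j<N. C_on 2 {0..te} (\<lambda>t. u t i j)) \<and>
     l2_bounded_on N {0..te} u \<and> l2_bounded_on N {0..te} (time_deriv {0..te} 1 u) \<and>
     (\<forall>t\<in>{0..te}. \<forall>i. \<forall>j<N.
        time_deriv {0..te} 2 u t i j =
          1 / (mesh N)\<^sup>2 * kron_apply N A (1\<^sub>m N) (u t) i j +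
          1 / (mesh N)\<^sup>2 * kron_apply N id_x B (u t) i j + F t i j)"

text \<open>Stability in the usual sense (estimate in terms of the initial data for vanishing forcing, with
  constants \<open>C\<close>, \<open>\<alpha>\<close> that do not depend on the mesh or on the length of the time interval).\<close>

definition stable_with_growth ::
    "real \<Rightarrow> nat \<Rightarrow> (nat \<Rightarrow> nat \<Rightarrow> nat \<Rightarrow> real) \<Rightarrow> (nat \<Rightarrow> real mat) \<Rightarrow> bool" where
  "stable_with_growth \<alpha> N0 Qx Qy \<longleftrightarrow>
     (\<exists>C. \<forall>N\<ge>N0. \<forall>te>0. \<forall>u. semidiscrete_solution N (Qx N) (Qy N) te (\<lambda>t i j. 0) u \<longrightarrow>
        (\<forall>t\<in>{0..te}. norm2D N (u t) \<le>
           C * exp (\<alpha> * t) * (norm2D N (u 0) + norm2D N (time_deriv {0..te} 1 u 0))))"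

definition symmetric_matrix :: "nat \<Rightarrow> real mat \<Rightarrow> bool" where
  "symmetric_matrix n A \<longleftrightarrow> A \<in> carrier_mat n n \<and> transpose_mat A = A"

definition pos_definite :: "nat \<Rightarrow> real mat \<Rightarrow> bool" where
  "pos_definite n A \<longleftrightarrow> symmetric_matrix n A \<and>
     (\<forall>v\<in>carrier_vec n. v \<noteq> 0\<^sub>v n \<longrightarrow> scalar_prod v (A *\<^sub>v v) > 0)"

definition neg_semidefinite :: "nat \<Rightarrow> real mat \<Rightarrow> bool" where
  "neg_semidefinite n A \<longleftrightarrow> symmetric_matrix n A \<and>
     (\<forall>v\<in>carrier_vec n. scalar_prod v (A *\<^sub>v v) \<le> 0)"

definition mat_inv :: "real mat \<Rightarrow> real mat" where
  "mat_inv A = the (mat_inverse A)"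

text \<open>The unique symmetric positive definite square root of a symmetric positive definite matrix.\<close>

definition mat_sqrt :: "real mat \<Rightarrow> real mat" where
  "mat_sqrt A = (THE R. pos_definite (dim_row A) R \<and> R * R = A)"

definition eucl_norm :: "real vec \<Rightarrow> real" where
  "eucl_norm v = sqrt (scalar_prod v v)"

definition spectral_norm :: "real mat \<Rightarrow> real" where
  "spectral_norm A =
     (SUP v\<in>{v \<in> carrier_vec (dim_col A). eucl_norm v \<le> 1}. eucl_norm (A *\<^sub>v v))"

definition cond_number :: "real mat \<Rightarrow> real" where
  "cond_number A = spectral_norm A * spectral_norm (mat_inv A)"

text \<open>Normalized eigendecomposition of the scaled operator in \<open>y\<close>; \<open>lam r\<close> for \<open>r < N\<close> are the
  diagonal entries of \<open>\<Lambda>\<close>.\<close>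

definition normalized_diagonalization ::
    "nat \<Rightarrow> real mat \<Rightarrow> real mat \<Rightarrow> real mat \<Rightarrow> (nat \<Rightarrow> real) \<Rightarrow> bool" where
  "normalized_diagonalization N P Qy \<Phi> lam \<longleftrightarrow>
     \<Phi> \<in> carrier_mat N N \<and> invertible_mat \<Phi> \<and>
     (1 / (mesh N)\<^sup>2) \<cdot>\<^sub>m Qy = - (\<Phi> * mat_diag N lam * mat_inv \<Phi>) \<and>
     (\<forall>r<N. 0 \<le> lam r) \<and> (\<forall>r q. r \<le> q \<longrightarrow> q < N \<longrightarrow> lam r \<le> lam q) \<and>
     spectral_norm \<Phi> = spectral_norm (mat_inv (mat_sqrt P)) \<and>
     spectral_norm (mat_inv \<Phi>) = spectral_norm (mat_sqrt P)"

text \<open>The estimate for one scalar difference equation at a fixed mesh, with given constant \<open>K\<close>: it holds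
  for all data \<open>\<tau>\<close> and every square-summable solution \<open>e\<close>.\<close>

definition scalar_estimate ::
    "real \<Rightarrow> real \<Rightarrow> real \<Rightarrow> real \<Rightarrow> real \<Rightarrow> nat \<Rightarrow> nat \<Rightarrow> nat \<Rightarrow> (nat \<Rightarrow> nat \<Rightarrow> real) \<Rightarrow> real \<Rightarrow> complex \<Rightarrow> bool"
  where
  "scalar_estimate K \<eta> g m p b k N Qx lam s \<longleftrightarrow>
     (\<forall>\<tau> e. (\<forall>i\<le>k. laplace_data b s (\<tau> i)) \<longrightarrow>
        summable (\<lambda>i. (cmod (e i))\<^sup>2) \<longrightarrow>
        (\<forall>i. ((s * of_real (mesh N))\<^sup>2 + of_real ((mesh N)\<^sup>2 * lam)) * e i =
               apply_x Qx e i +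
               of_real (mesh N powr (p + 2)) * column_forcing k (\<lambda>l. laplace (\<tau> l) s) i) \<longrightarrow>
        (norm1Dx N e)\<^sup>2 \<le> K * mesh N powr (2 * g) / \<eta> powr m *
          (\<Sum>i\<le>k. (cmod (laplace (\<tau> i) s))\<^sup>2 + (cmod (laplace (nderiv {0..} b (\<tau> i)) s))\<^sup>2))"

end

theory Submission
  imports Defs "HOL-Probability.Characteristic_Functions"
begin

text \<open>
  Prolong the data from \<open>[0, tf]\<close> to \<open>[0, \<infinity>)\<close> and solve the semi-discrete problem with the prolonged
  forcing by Duhamel's formula. Stability makes this solution coincide with the error \<open>\<zeta>\<close> on \<open>[0, tf]\<close> and
  bounds its growth by an exponential of rate below \<open>\<eta>\<close>, so that its Laplace transform exists on the
  line \<open>Re s = \<eta>\<close>. Multiplication by \<open>\<Phi>\<^sup>-\<^sup>1\<close> in the \<open>y\<close>-direction decouples the transformed equation into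
  the scalar difference equations, where the hypothesis applies for every \<open>s\<close>. Plancherel's theorem turns
  the bounds into bounds of exponentially weighted time integrals, and returning from \<open>\<Phi>\<^sup>-\<^sup>1\<zeta>\<close> to \<open>\<zeta>\<close> and from
  \<open>\<tau>\<close> to \<open>T\<close> costs the condition number of \<open>\<Phi>\<close>. On the line, the transform of the data is \<open>s\<^sup>-\<^sup>b\<close> times that
  of their \<open>b\<close>-th derivative, so only the \<open>b\<close>-th derivative has to remain small beyond \<open>tf\<close>, and there it
  can be cut off within an arbitrarily short time.
\<close>

section \<open>The energy of a Fourier transform\<close>

text \<open>The hypothesis concerns data on the whole half-line and all s on a vertical line; the
  conclusion must not see anything beyond \<open>tf\<close>, and its constant must not depend on the
  mesh. Stability therefore acts qualitatively, through uniqueness and the existence of the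
  transforms: neither its constant nor the stencil bounds, which involve
  \<open>1 / (mesh N)\<^sup>2\<close>, enter the final estimate. The new constant is the old one
  times \<open>1 + (1 / \<eta>) ^ (2 * b)\<close>: on the line |s| is at least \<eta>, so both data
  terms of the hypothesis can be charged to the b-th derivative alone. The exponential factor is the
  price of removing the weight exp(-2 \<eta> t) on [0, tf]. Sums over the half-line grid are handled
  through partial sums over i < n with constants independent of n. This keeps Plancherel's theorem
  and the interchanges of sum and integral finite; n tends to infinity only at the end, where
  geometric decay in x makes the tail small uniformly in time.\<close>

definition fourier :: "(real \<Rightarrow> real) \<Rightarrow> real \<Rightarrow> complex" where
  "fourier g \<xi> = (\<integral>t. cis (- \<xi> * t) * of_real (g t) \<partial>lborel)"

definition autocorr :: "(real \<Rightarrow> real) \<Rightarrow> real \<Rightarrow> real" where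
  "autocorr g a = (\<integral>t. g t * g (t + a) \<partial>lborel)"

lemma integrable_mult_bounded:
  fixes f g :: "real \<Rightarrow> real"
  assumes "integrable lborel f" "g \<in> borel_measurable borel" "\<And>t. \<bar>g t\<bar> \<le> M"
  shows "integrable lborel (\<lambda>t. f t * g t)"
proof (rule Bochner_Integration.integrable_bound)
  show "integrable lborel (\<lambda>t. M * f t)" using assms(1) by simp
  show "(\<lambda>t. f t * g t) \<in> borel_measurable lborel"
    using assms(1,2) by (auto intro!: borel_measurable_times dest: borel_measurable_integrable)
  have "\<bar>f t\<bar> * \<bar>g t\<bar> \<le> \<bar>M\<bar> * \<bar>f t\<bar>" for t
    using assms(3)[of t] mult_right_mono[of "\<bar>g t\<bar>" "\<bar>M\<bar>" "\<bar>f t\<bar>"] by (simp add: mult.commute)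
  then show "AE x in lborel. norm (f x * g x) \<le> norm (M * f x)"
    by (auto simp: abs_mult)
qed

text \<open>Apply |x y| <= (x^2 + y^2) / 2 under the integral; by translation invariance both
  squares integrate to \<open>autocorr g 0\<close>, the energy of g. Boundedness of g makes the
  square integrable.\<close>

lemma autocorr_bound:
  assumes g: "integrable lborel g" and M: "\<And>t. \<bar>g t\<bar> \<le> M"
  shows "\<bar>autocorr g a\<bar> \<le> autocorr g 0" "integrable lborel (\<lambda>t. g t * g (t + a))"
proof -
  have m: "g \<in> borel_measurable borel" using g by (auto dest: borel_measurable_integrable)
  have i2: "integrable lborel (\<lambda>t. g t * g t)" by (rule integrable_mult_bounded[OF g m M])
  have s: "integrable lborel (\<lambda>t. g (t + a) * g (t + a))"
    using lborel_integrable_real_affine[OF i2, of 1 a] by (simp add: add.commute)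
  have se: "(\<integral>t. g (t + a) * g (t + a) \<partial>lborel) = (\<integral>t. g t * g t \<partial>lborel)"
    using lborel_integral_real_affine[of 1 "\<lambda>t. g t * g t" a] by (simp add: add.commute)
  show i3: "integrable lborel (\<lambda>t. g t * g (t + a))"
    by (rule integrable_mult_bounded[OF g _ M]) (use m in measurable)
  have "\<bar>autocorr g a\<bar> \<le> (\<integral>t. \<bar>g t * g (t + a)\<bar> \<partial>lborel)"
    unfolding autocorr_def by (rule integral_abs_bound)
  also have "\<dots> \<le> (\<integral>t. (g t * g t + g (t + a) * g (t + a)) / 2 \<partial>lborel)"
  proof (rule integral_mono)
    fix t show "\<bar>g t * g (t + a)\<bar> \<le> (g t * g t + g (t + a) * g (t + a)) / 2"
      using sum_squares_bound[of "\<bar>g t\<bar>" "\<bar>g (t + a)\<bar>"]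
      by (auto simp: abs_mult power2_eq_square field_simps)
  qed (use i2 s i3 in auto)
  also have "\<dots> = autocorr g 0"
    using i2 s se by (simp add: autocorr_def)
  finally show "\<bar>autocorr g a\<bar> \<le> autocorr g 0" .
qed

text \<open>Pointwise convergence comes from continuity of g, domination from
  \<open>M * \<bar>g t\<bar>\<close>. It is here that the functions whose energy is bounded from
  above must be continuous.\<close>

lemma autocorr_tendsto:
  assumes g: "integrable lborel g" and M: "\<And>t. \<bar>g t\<bar> \<le> M"
    and c: "\<And>t. isCont g t" and a: "a \<longlonglongrightarrow> 0"
  shows "(\<lambda>n. autocorr g (a n)) \<longlonglongrightarrow> autocorr g 0"
  unfolding autocorr_def
proof (rule integral_dominated_convergence[where w="\<lambda>t. M * \<bar>g t\<bar>"])
  have m [measurable]: "g \<in> borel_measurable borel" using g by (auto dest: borel_measurable_integrable)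
  show "(\<lambda>t. g t * g (t + 0)) \<in> borel_measurable lborel" by measurable
  show "(\<lambda>t. g t * g (t + a n)) \<in> borel_measurable lborel" for n by measurable
  show "integrable lborel (\<lambda>t. M * \<bar>g t\<bar>)" using g by auto
  show "AE t in lborel. (\<lambda>n. g t * g (t + a n)) \<longlonglongrightarrow> g t * g (t + 0)"
  proof (rule AE_I2, intro tendsto_mult tendsto_const)
    fix t show "(\<lambda>n. g (t + a n)) \<longlonglongrightarrow> g (t + 0)"
      by (rule isCont_tendsto_compose[OF c]) (intro tendsto_intros a)
  qed
  show "AE t in lborel. norm (g t * g (t + a n)) \<le> M * \<bar>g t\<bar>" for n
    using M by (auto simp: abs_mult mult.commute[of M] intro!: mult_left_mono)
qed

lemma integrable_pair_mult:
  fixes f g :: "real \<Rightarrow> 'a::{real_normed_field, banach, second_countable_topology}"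
  assumes f: "integrable lborel f" and g: "integrable lborel g"
  shows "integrable (lborel \<Otimes>\<^sub>M lborel) (\<lambda>(t, u). f t * g u)"
proof (rule lborel_pair.Fubini_integrable)
  have [measurable]: "f \<in> borel_measurable borel" "g \<in> borel_measurable borel"
    using f g by (auto dest: borel_measurable_integrable)
  show "(\<lambda>(t, u). f t * g u) \<in> borel_measurable (lborel \<Otimes>\<^sub>M lborel)" by measurable
  show "integrable lborel (\<lambda>x. \<integral>y. norm (case (x, y) of (t, u) \<Rightarrow> f t * g u) \<partial>lborel)"
    using f by (simp add: norm_mult)
  show "AE x in lborel. integrable lborel (\<lambda>y. case (x, y) of (t, u) \<Rightarrow> f t * g u)"
    using g by simp
qed

text \<open>A Gaussian weight makes Fubini's theorem applicable for absolutely integrable functions.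
  Plancherel's theorem is the limit \<open>\<sigma> \<rightarrow> 0\<close>, and the upper bound by the energy holds for every \<open>\<sigma>\<close>.\<close>

lemma gauss_parseval:
  assumes g: "integrable lborel g" and M: "\<And>t. \<bar>g t\<bar> \<le> M" and \<sigma>: "\<sigma> > 0"
  shows "integrable std_normal_distribution (\<lambda>x. (cmod (fourier g (x / \<sigma>)))\<^sup>2)"
    and "(\<integral>x. (cmod (fourier g (x / \<sigma>)))\<^sup>2 \<partial>std_normal_distribution) =
      \<sigma> * sqrt (2 * pi) * (\<integral>v. std_normal_density v * autocorr g (\<sigma> * v) \<partial>lborel)"
proof -
  let ?N = std_normal_distribution
  let ?L2 = "lborel \<Otimes>\<^sub>M lborel :: (real \<times> real) measure"
  have [measurable]: "g \<in> borel_measurable borel" using g by (auto dest: borel_measurable_integrable)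
  interpret N: real_distribution ?N by (rule real_dist_normal_dist)
  interpret L2: sigma_finite_measure ?L2 by (rule sigma_finite_pair_measure) unfold_locales
  interpret NL: pair_sigma_finite ?N ?L2 ..
  \<comment> \<open>\<open>H\<close> is the integrand of |fourier g (x / \<sigma>)|^2 written as a
    double integral over (t, u). Its modulus is |g t g u| for every x, hence integrable together
    with the Gaussian probability measure.\<close>
  define H where "H = (\<lambda>x (t, u). cis (x * ((u - t) / \<sigma>)) * (complex_of_real (g t) * complex_of_real (g u)))"
  have gc: "integrable lborel (\<lambda>t. complex_of_real (g t))" using g by simp
  have ii: "integrable ?L2 (\<lambda>(t, u). complex_of_real (g t) * complex_of_real (g u))"
    by (rule integrable_pair_mult[OF gc gc])
  have Hm: "(\<lambda>(x, p). H x p) \<in> borel_measurable (?N \<Otimes>\<^sub>M ?L2)"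
    unfolding H_def cis_conv_exp by measurable
  have Hi: "integrable ?L2 (H x)" for x
  proof (rule Bochner_Integration.integrable_bound[OF ii])
    show "H x \<in> borel_measurable ?L2" unfolding H_def cis_conv_exp by measurable
  qed (auto simp: H_def norm_mult)
  have HI: "integrable (?N \<Otimes>\<^sub>M ?L2) (\<lambda>(x, p). H x p)"
  proof (rule NL.Fubini_integrable[OF Hm])
    have "(\<lambda>x. \<integral>p. norm (case (x, p) of (x, p) \<Rightarrow> H x p) \<partial>?L2) =
        (\<lambda>x. \<integral>p. norm (case p of (t, u) \<Rightarrow> complex_of_real (g t) * complex_of_real (g u)) \<partial>?L2)"
      by (intro ext Bochner_Integration.integral_cong) (auto simp: H_def norm_mult)
    then show "integrable ?N (\<lambda>x. \<integral>p. norm (case (x, p) of (x, p) \<Rightarrow> H x p) \<partial>?L2)"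
      by simp
  qed (use Hi in auto)
  have gi: "integrable lborel (\<lambda>t. cis (a * t) * complex_of_real (g t))" for a
    by (rule Bochner_Integration.integrable_bound[OF gc]) (auto simp: norm_mult cis_conv_exp)
  have sq: "of_real ((cmod (fourier g (x / \<sigma>)))\<^sup>2) = (\<integral>p. H x p \<partial>?L2)" for x
  proof -
    have "cnj (fourier g (x / \<sigma>)) = (\<integral>u. cis ((x / \<sigma>) * u) * of_real (g u) \<partial>lborel)"
      unfolding fourier_def by (subst Bochner_Integration.integral_cnj[symmetric]) (simp add: cis_cnj del: Bochner_Integration.integral_cnj)
    then have "of_real ((cmod (fourier g (x / \<sigma>)))\<^sup>2) =
        fourier g (x / \<sigma>) * (\<integral>u. cis ((x / \<sigma>) * u) * of_real (g u) \<partial>lborel)"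
      by (metis complex_norm_square of_real_power)
    also have "\<dots> = (\<integral>t. (\<integral>u. H x (t, u) \<partial>lborel) \<partial>lborel)"
    proof -
      have "H x (t, u) = (cis (- (x / \<sigma>) * t) * of_real (g t)) * (cis ((x / \<sigma>) * u) * of_real (g u))" for t u
      proof -
        have "cis (x * ((u - t) / \<sigma>)) = cis (- (x / \<sigma>) * t) * cis ((x / \<sigma>) * u)"
          by (simp add: cis_mult algebra_simps diff_divide_distrib)
        then show ?thesis by (simp add: H_def)
      qed
      then show ?thesis by (simp add: fourier_def)
    qed
    also have "\<dots> = (\<integral>p. H x p \<partial>?L2)"
      using lborel_pair.integral_fst[of "\<lambda>t u. H x (t, u)"] Hi[of x] by simp
    finally show ?thesis .
  qed
  have "integrable ?N (\<lambda>x. \<integral>p. H x p \<partial>?L2)" by (rule NL.integrable_fst[OF HI])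
  then show "integrable ?N (\<lambda>x. (cmod (fourier g (x / \<sigma>)))\<^sup>2)"
    unfolding sq[symmetric] complex_of_real_integrable_eq .
  \<comment> \<open>Integrating the phase against the Gaussian gives its characteristic function, so
    only the difference u - t on the scale \<sigma> is left.\<close>
  define E where "E = (\<lambda>(t, u). exp (- ((u - t) / \<sigma>)\<^sup>2 / 2) * (g t * g u))"
  have inner: "(\<integral>x. H x p \<partial>?N) = complex_of_real (E p)" for p
  proof (cases p)
    case (Pair t u)
    have "(\<integral>x. cis (x * ((u - t) / \<sigma>)) \<partial>?N) = char ?N ((u - t) / \<sigma>)"
      by (simp add: char_def cis_conv_exp mult.commute mult.left_commute)
    also have "\<dots> = of_real (exp (- ((u - t) / \<sigma>)\<^sup>2 / 2))"
      by (simp add: char_std_normal_distribution)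
    finally have *: "(\<integral>x. cis (x * ((u - t) / \<sigma>)) \<partial>?N) = of_real (exp (- ((u - t) / \<sigma>)\<^sup>2 / 2))" .
    show ?thesis unfolding Pair H_def E_def by (simp add: * del: times_divide_eq_right)
  qed
  have "of_real (\<integral>x. (cmod (fourier g (x / \<sigma>)))\<^sup>2 \<partial>?N) = (\<integral>x. (\<integral>p. H x p \<partial>?L2) \<partial>?N)"
    unfolding sq[symmetric] integral_complex_of_real ..
  also have "\<dots> = (\<integral>p. (\<integral>x. H x p \<partial>?N) \<partial>?L2)"
    using NL.Fubini_integral[OF HI] by simp
  also have "\<dots> = of_real (\<integral>p. E p \<partial>?L2)"
    unfolding inner integral_complex_of_real ..
  finally have e1: "(\<integral>x. (cmod (fourier g (x / \<sigma>)))\<^sup>2 \<partial>?N) = (\<integral>p. E p \<partial>?L2)"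
    using of_real_eq_iff by blast
  have Ei: "integrable ?L2 (\<lambda>(t, u). E (t, u))"
  proof (rule Bochner_Integration.integrable_bound[OF integrable_pair_mult[OF g g]])
    show "(\<lambda>(t, u). E (t, u)) \<in> borel_measurable ?L2" unfolding E_def by measurable
    show "AE x in ?L2. norm (case x of (t, u) \<Rightarrow> E (t, u)) \<le> norm (case x of (t, u) \<Rightarrow> g t * g u)"
      by (intro AE_I2) (auto simp: E_def abs_mult split: prod.split intro!: mult_left_le_one_le)
  qed
  \<comment> \<open>Substituting u = t + \<sigma> v turns the Gaussian factor into
    \<open>std_normal_density\<close> and leaves \<sigma> times the normalization sqrt(2 pi) in
    front.\<close>
  define D where "D = (\<lambda>t v. std_normal_density v * (g t * g (t + \<sigma> * v)))"
  have sub: "(\<integral>u. E (t, u) \<partial>lborel) = \<sigma> * sqrt (2 * pi) * (\<integral>v. D t v \<partial>lborel)" for t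
  proof -
    have "E (t, t + \<sigma> * v) = sqrt (2 * pi) * D t v" for v
      using \<sigma> by (simp add: E_def D_def std_normal_density_def)
    then show ?thesis
      using \<sigma> by (subst lborel_integral_real_affine[of \<sigma> _ t]) simp_all
  qed
  have Di: "integrable (lborel \<Otimes>\<^sub>M lborel) (\<lambda>(t, v). D t v)"
  proof (rule Bochner_Integration.integrable_bound)
    show "integrable (lborel \<Otimes>\<^sub>M lborel) (\<lambda>(t, v). (M * g t) * std_normal_density v)"
      by (rule integrable_pair_mult) (use g in auto)
    show "(\<lambda>(t, v). D t v) \<in> borel_measurable ?L2" unfolding D_def by measurable
    have "std_normal_density v * (\<bar>g t\<bar> * \<bar>g (t + \<sigma> * v)\<bar>) \<le> (\<bar>M\<bar> * \<bar>g t\<bar>) * std_normal_density v" for t v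
    proof -
      have "\<bar>g t\<bar> * \<bar>g (t + \<sigma> * v)\<bar> \<le> \<bar>g t\<bar> * \<bar>M\<bar>"
        using M[of "t + \<sigma> * v"] by (intro mult_left_mono) auto
      then have "std_normal_density v * (\<bar>g t\<bar> * \<bar>g (t + \<sigma> * v)\<bar>) \<le> std_normal_density v * (\<bar>g t\<bar> * \<bar>M\<bar>)"
        by (rule mult_left_mono) auto
      then show ?thesis by (simp only: mult_ac)
    qed
    then show "AE x in ?L2. norm (case x of (t, v) \<Rightarrow> D t v) \<le> norm (case x of (t, v) \<Rightarrow> (M * g t) * std_normal_density v)"
      by (intro AE_I2) (auto simp: D_def abs_mult split: prod.split)
  qed
  have "(\<integral>p. E p \<partial>?L2) = (\<integral>t. (\<integral>u. E (t, u) \<partial>lborel) \<partial>lborel)"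
    using lborel_pair.integral_fst[OF Ei] by simp
  also have "\<dots> = \<sigma> * sqrt (2 * pi) * (\<integral>t. (\<integral>v. D t v \<partial>lborel) \<partial>lborel)"
    by (simp add: sub)
  also have "(\<integral>t. (\<integral>v. D t v \<partial>lborel) \<partial>lborel) = (\<integral>v. (\<integral>t. D t v \<partial>lborel) \<partial>lborel)"
    using lborel_pair.Fubini_integral[OF Di] by simp
  also have "\<dots> = (\<integral>v. std_normal_density v * autocorr g (\<sigma> * v) \<partial>lborel)"
    by (simp add: D_def autocorr_def)
  finally show "(\<integral>x. (cmod (fourier g (x / \<sigma>)))\<^sup>2 \<partial>?N) =
      \<sigma> * sqrt (2 * pi) * (\<integral>v. std_normal_density v * autocorr g (\<sigma> * v) \<partial>lborel)"
    using e1 by simp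
qed

lemma borel_measurable_autocorr:
  assumes g: "integrable lborel g"
  shows "autocorr g \<in> borel_measurable borel"
proof -
  have [measurable]: "g \<in> borel_measurable borel" using g by (auto dest: borel_measurable_integrable)
  have "(\<lambda>a. \<integral>t. g t * g (t + a) \<partial>lborel) \<in> borel_measurable borel"
    by (intro lborel.borel_measurable_lebesgue_integral) measurable
  then show ?thesis by (simp add: autocorr_def[abs_def])
qed

text \<open>Both sides are integrated against the same Gaussian, so the common factor \<sigma>
  sqrt(2 pi) cancels. On the right the regularized energy never exceeds the energy, on the left it
  tends to it as \<sigma> tends to 0; this is why continuity is asked of the family
  \<open>g\<close>.\<close>

lemma fourier_energy_le:
  fixes g :: "'a \<Rightarrow> real \<Rightarrow> real" and f :: "'b \<Rightarrow> real \<Rightarrow> real"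
  assumes A: "finite A" and B: "finite B" and c: "c \<ge> 0"
    and g: "\<And>a. a \<in> A \<Longrightarrow> integrable lborel (g a)" "\<And>a t. a \<in> A \<Longrightarrow> \<bar>g a t\<bar> \<le> M a"
    and gc: "\<And>a t. a \<in> A \<Longrightarrow> isCont (g a) t"
    and f: "\<And>b. b \<in> B \<Longrightarrow> integrable lborel (f b)" "\<And>b t. b \<in> B \<Longrightarrow> \<bar>f b t\<bar> \<le> M' b"
    and le: "\<And>\<xi>. (\<Sum>a\<in>A. (cmod (fourier (g a) \<xi>))\<^sup>2) \<le> c * (\<Sum>b\<in>B. (cmod (fourier (f b) \<xi>))\<^sup>2)"
  shows "(\<Sum>a\<in>A. \<integral>t. (g a t)\<^sup>2 \<partial>lborel) \<le> c * (\<Sum>b\<in>B. \<integral>t. (f b t)\<^sup>2 \<partial>lborel)"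
proof -
  let ?N = std_normal_distribution
  let ?J = "\<lambda>g \<sigma>. (\<integral>v. std_normal_density v * autocorr g (\<sigma> * v) \<partial>lborel)"
  have a0: "autocorr g 0 = (\<integral>t. (g t)\<^sup>2 \<partial>lborel)" for g
    by (simp add: autocorr_def power2_eq_square)
  have Jle: "(\<Sum>a\<in>A. ?J (g a) \<sigma>) \<le> c * (\<Sum>b\<in>B. ?J (f b) \<sigma>)" if \<sigma>: "\<sigma> > 0" for \<sigma>
  proof -
    have "(\<Sum>a\<in>A. \<integral>x. (cmod (fourier (g a) (x / \<sigma>)))\<^sup>2 \<partial>?N) = (\<integral>x. (\<Sum>a\<in>A. (cmod (fourier (g a) (x / \<sigma>)))\<^sup>2) \<partial>?N)"
      by (rule Bochner_Integration.integral_sum[symmetric]) (rule gauss_parseval(1)[OF g \<sigma>])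
    also have "\<dots> \<le> (\<integral>x. c * (\<Sum>b\<in>B. (cmod (fourier (f b) (x / \<sigma>)))\<^sup>2) \<partial>?N)"
      by (intro integral_mono le Bochner_Integration.integrable_sum integrable_mult_right gauss_parseval(1)[OF g \<sigma>]
            gauss_parseval(1)[OF f \<sigma>])
    also have "\<dots> = c * (\<Sum>b\<in>B. \<integral>x. (cmod (fourier (f b) (x / \<sigma>)))\<^sup>2 \<partial>?N)"
      using gauss_parseval(1)[OF f \<sigma>] by (simp add: Bochner_Integration.integral_sum)
    finally have "\<sigma> * sqrt (2 * pi) * (\<Sum>a\<in>A. ?J (g a) \<sigma>) \<le> c * (\<sigma> * sqrt (2 * pi) * (\<Sum>b\<in>B. ?J (f b) \<sigma>))"
      by (simp add: gauss_parseval(2)[OF g \<sigma>] gauss_parseval(2)[OF f \<sigma>] sum_distrib_left cong: sum.cong)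
    then have "(\<sigma> * sqrt (2 * pi)) * (\<Sum>a\<in>A. ?J (g a) \<sigma>) \<le> (\<sigma> * sqrt (2 * pi)) * (c * (\<Sum>b\<in>B. ?J (f b) \<sigma>))"
      by (simp add: mult_ac)
    then show ?thesis using \<sigma> by (subst (asm) mult_le_cancel_left_pos) auto
  qed
  have up: "?J h \<sigma> \<le> autocorr h 0"
    if h: "integrable lborel h" "\<And>t. \<bar>h t\<bar> \<le> C" for h \<sigma> C
  proof -
    have "?J h \<sigma> \<le> (\<integral>v. std_normal_density v * autocorr h 0 \<partial>lborel)"
    proof (rule integral_mono)
      have [measurable]: "autocorr h \<in> borel_measurable borel" by (rule borel_measurable_autocorr[OF h(1)])
      show "integrable lborel (\<lambda>v. std_normal_density v * autocorr h (\<sigma> * v))"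
        by (rule integrable_mult_bounded[where M="autocorr h 0"]) (use autocorr_bound(1)[OF h] in auto)
      show "std_normal_density v * autocorr h (\<sigma> * v) \<le> std_normal_density v * autocorr h 0" for v
        using autocorr_bound(1)[OF h, of "\<sigma> * v"] by (intro mult_left_mono) auto
    qed auto
    also have "\<dots> = autocorr h 0" by simp
    finally show ?thesis .
  qed
  have lim: "(\<lambda>n. ?J (g a) (1 / real (Suc n))) \<longlonglongrightarrow> autocorr (g a) 0" if a: "a \<in> A" for a
  proof -
    have "(\<lambda>n. ?J (g a) (1 / real (Suc n))) \<longlonglongrightarrow> (\<integral>v. std_normal_density v * autocorr (g a) 0 \<partial>lborel)"
    proof (rule integral_dominated_convergence[where w="\<lambda>v. std_normal_density v * autocorr (g a) 0"])
      have [measurable]: "autocorr (g a) \<in> borel_measurable borel" by (rule borel_measurable_autocorr[OF g(1)[OF a]])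
      show "(\<lambda>v. std_normal_density v * autocorr (g a) (1 / real (Suc i) * v)) \<in> borel_measurable lborel" for i
        by measurable
      show "AE v in lborel. (\<lambda>n. std_normal_density v * autocorr (g a) (1 / real (Suc n) * v)) \<longlonglongrightarrow> std_normal_density v * autocorr (g a) 0"
      proof (rule AE_I2, intro tendsto_mult tendsto_const autocorr_tendsto[OF g[OF a] gc[OF a]])
        fix v show "(\<lambda>n. 1 / real (Suc n) * v) \<longlonglongrightarrow> 0"
          using LIMSEQ_inverse_real_of_nat by (intro tendsto_mult_left_zero) (simp add: inverse_eq_divide)
      qed
      show "AE v in lborel. norm (std_normal_density v * autocorr (g a) (1 / real (Suc n) * v)) \<le> std_normal_density v * autocorr (g a) 0" for n
        using autocorr_bound(1)[OF g[OF a]] by (auto simp: abs_mult intro!: mult_left_mono)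
    qed auto
    then show ?thesis by simp
  qed
  have "(\<Sum>a\<in>A. autocorr (g a) 0) \<le> c * (\<Sum>b\<in>B. autocorr (f b) 0)"
  proof (rule LIMSEQ_le_const2)
    show "(\<lambda>n. \<Sum>a\<in>A. ?J (g a) (1 / real (Suc n))) \<longlonglongrightarrow> (\<Sum>a\<in>A. autocorr (g a) 0)"
      by (intro tendsto_sum lim)
    have "(\<Sum>a\<in>A. ?J (g a) (1 / real (Suc n))) \<le> c * (\<Sum>b\<in>B. autocorr (f b) 0)" for n
      using Jle[of "1 / real (Suc n)"] up[OF f, of _ "1 / real (Suc n)"]
      by (smt (verit) c divide_pos_pos mult_left_mono of_nat_0_less_iff sum_mono zero_less_Suc)
    then show "\<exists>N. \<forall>n\<ge>N. (\<Sum>a\<in>A. ?J (g a) (1 / real (Suc n))) \<le> c * (\<Sum>b\<in>B. autocorr (f b) 0)"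
      by blast
  qed
  then show ?thesis by (simp add: a0)
qed

section \<open>Laplace transforms of functions of exponential order\<close>

definition exp_order :: "real \<Rightarrow> (real \<Rightarrow> real) \<Rightarrow> bool" where
  "exp_order \<beta> f \<longleftrightarrow> continuous_on {0..} f \<and> (\<exists>C. \<forall>t\<ge>0. \<bar>f t\<bar> \<le> C * exp (\<beta> * t))"

lemma exp_orderI:
  "continuous_on {0..} f \<Longrightarrow> (\<And>t. t \<ge> 0 \<Longrightarrow> \<bar>f t\<bar> \<le> C * exp (\<beta> * t)) \<Longrightarrow> exp_order \<beta> f"
  unfolding exp_order_def by blast

lemma exp_orderE:
  assumes "exp_order \<beta> f"
  obtains C where "C \<ge> 0" "\<And>t. t \<ge> 0 \<Longrightarrow> \<bar>f t\<bar> \<le> C * exp (\<beta> * t)"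
proof -
  obtain C where C: "\<forall>t\<ge>0. \<bar>f t\<bar> \<le> C * exp (\<beta> * t)" using assms unfolding exp_order_def by blast
  have "C \<ge> 0" using C[rule_format, of 0] by simp
  with C that show ?thesis by blast
qed

lemma exp_order_continuous: "exp_order \<beta> f \<Longrightarrow> continuous_on {0..} f"
  by (simp add: exp_order_def)

lemma exp_order_mono:
  assumes "exp_order \<beta> f" "\<beta> \<le> \<gamma>"
  shows "exp_order \<gamma> f"
proof -
  obtain C where C: "C \<ge> 0" "\<And>t. t \<ge> 0 \<Longrightarrow> \<bar>f t\<bar> \<le> C * exp (\<beta> * t)" using assms(1) by (rule exp_orderE) blast
  show ?thesis
  proof (rule exp_orderI[OF exp_order_continuous[OF assms(1)]])
    fix t :: real assume t: "t \<ge> 0"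
    have "C * exp (\<beta> * t) \<le> C * exp (\<gamma> * t)" using C(1) t assms(2) by (intro mult_left_mono) (auto intro: mult_right_mono)
    with C(2)[OF t] show "\<bar>f t\<bar> \<le> C * exp (\<gamma> * t)" by linarith
  qed
qed

lemma exp_order_mult:
  assumes "exp_order \<beta> f" shows "exp_order \<beta> (\<lambda>t. c * f t)"
proof -
  obtain C where C: "C \<ge> 0" "\<And>t. t \<ge> 0 \<Longrightarrow> \<bar>f t\<bar> \<le> C * exp (\<beta> * t)" using assms(1) by (rule exp_orderE) blast
  show ?thesis
  proof (rule exp_orderI[where C="\<bar>c\<bar> * C"])
    show "continuous_on {0..} (\<lambda>t. c * f t)" by (intro continuous_intros exp_order_continuous[OF assms])
  qed (use C in \<open>auto simp: abs_mult mult.assoc intro!: mult_left_mono\<close>)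
qed

lemma exp_order_add:
  assumes "exp_order \<beta> f" "exp_order \<beta> g" shows "exp_order \<beta> (\<lambda>t. f t + g t)"
proof -
  obtain C where C: "C \<ge> 0" "\<And>t. t \<ge> 0 \<Longrightarrow> \<bar>f t\<bar> \<le> C * exp (\<beta> * t)" using assms(1) by (rule exp_orderE) blast
  obtain D where D: "D \<ge> 0" "\<And>t. t \<ge> 0 \<Longrightarrow> \<bar>g t\<bar> \<le> D * exp (\<beta> * t)" using assms(2) by (rule exp_orderE) blast
  show ?thesis
  proof (rule exp_orderI[where C="C + D"])
    show "continuous_on {0..} (\<lambda>t. f t + g t)" by (intro continuous_intros exp_order_continuous[OF assms(1)] exp_order_continuous[OF assms(2)])
    show "\<bar>f t + g t\<bar> \<le> (C + D) * exp (\<beta> * t)" if "t \<ge> 0" for t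
      using C(2)[OF that] D(2)[OF that] by (simp add: distrib_right)
  qed
qed

lemma exp_order_0: "exp_order \<beta> (\<lambda>t. 0)"
  by (rule exp_orderI[where C=0]) auto

lemma exp_order_sum:
  "(\<And>a. a \<in> A \<Longrightarrow> exp_order \<beta> (f a)) \<Longrightarrow> exp_order \<beta> (\<lambda>t. \<Sum>a\<in>A. f a t)"
  by (induction A rule: infinite_finite_induct) (auto intro: exp_order_0 exp_order_add)

lemma integral_exp_le:
  fixes a :: real
  assumes "a > 0" "t \<ge> 0"
  shows "integral {0..t} (\<lambda>s. exp (a * s)) \<le> exp (a * t) / a"
proof -
  have "((\<lambda>s. exp (a * s)) has_integral exp (a * t) / a - exp (a * 0) / a) {0..t}"
    using assms by (intro fundamental_theorem_of_calculus)
      (auto intro!: derivative_eq_intros simp flip: has_real_derivative_iff_has_vector_derivative)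
  then show ?thesis using assms by (simp add: integral_unique)
qed

text \<open>Integration does not raise the rate because \<beta> > 0: the integral of exp(\<beta> s)
  over [0, t] is at most exp(\<beta> t) / \<beta>. Repeated primitives in the continuation of the
  data thus keep one and the same rate.\<close>

lemma exp_order_integral:
  assumes f: "exp_order \<beta> f" and \<beta>: "\<beta> > 0"
  shows "exp_order \<beta> (\<lambda>t. integral {0..t} f)"
proof -
  obtain C where C: "C \<ge> 0" "\<And>t. t \<ge> 0 \<Longrightarrow> \<bar>f t\<bar> \<le> C * exp (\<beta> * t)" using f by (rule exp_orderE) blast
  have int: "f integrable_on {0..t}" for t
    by (intro integrable_continuous_real continuous_on_subset[OF exp_order_continuous[OF f]]) auto
  show ?thesis
  proof (rule exp_orderI[where C="C / \<beta>"])
    have "continuous_on {0..} (\<lambda>t. integral {0..t} f)"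
    proof (clarsimp simp: continuous_on_eq_continuous_within)
      fix t :: real assume "t \<ge> 0"
      have "continuous_on {0..t+1} (\<lambda>t. integral {0..t} f)" by (rule indefinite_integral_continuous_1[OF int])
      then have "continuous (at t within {0..t+1}) (\<lambda>t. integral {0..t} f)"
        using \<open>t \<ge> 0\<close> by (auto simp: continuous_on_eq_continuous_within)
      moreover have "at t within {0..t+1} = at t within {0..}"
        by (rule at_within_nhd[of _ "{..<t+1}"]) auto
      ultimately show "continuous (at t within {0..}) (\<lambda>t. integral {0..t} f)" by simp
    qed
    then show "continuous_on {0..} (\<lambda>t. integral {0..t} f)" .
    fix t :: real assume t: "t \<ge> 0"
    have "norm (integral {0..t} f) \<le> integral {0..t} (\<lambda>s. C * exp (\<beta> * s))"
      by (rule integral_norm_bound_integral[OF int]) (use C in \<open>auto intro!: integrable_continuous_real continuous_intros\<close>)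
    also have "\<dots> = C * integral {0..t} (\<lambda>s. exp (\<beta> * s))" by simp
    also have "\<dots> \<le> C * (exp (\<beta> * t) / \<beta>)" by (intro mult_left_mono integral_exp_le \<beta> t C)
    finally show "\<bar>integral {0..t} f\<bar> \<le> C / \<beta> * exp (\<beta> * t)" by simp
  qed
qed

lemma set_integrable_exp_minus:
  fixes a :: real
  assumes "a > 0" shows "set_integrable lborel {0..} (\<lambda>t. exp (- a * t))"
proof -
  have "(\<lambda>t. exp (- a * t)) absolutely_integrable_on {0..}"
    using integrable_on_exp_minus_to_infinity[OF assms, of 0]
    by (intro nonnegative_absolutely_integrable_1) auto
  then have "integrable lebesgue (\<lambda>x. indicator {0..} x *\<^sub>R exp (- a * x))"
    by (simp add: set_integrable_def)
  then show ?thesis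
    unfolding set_integrable_def by (subst (asm) integrable_completion) auto
qed

text \<open>Integrability is proved for \<open>lborel\<close>, where dominated convergence and
  Fubini's theorem are applied, and is then transferred to the gauge integral of
  \<open>laplace\<close> and to the completed measure in which \<open>laplace_data\<close> is
  phrased.\<close>

lemma laplace_integrable_lborel:
  assumes f: "exp_order \<beta> f" and s: "\<beta> < Re s"
  shows "set_integrable lborel {0..} (\<lambda>t. exp (- s * of_real t) * of_real (f t))"
proof -
  obtain C where C: "C \<ge> 0" "\<And>t. t \<ge> 0 \<Longrightarrow> \<bar>f t\<bar> \<le> C * exp (\<beta> * t)" using f by (rule exp_orderE) blast
  show ?thesis
  proof (rule set_integrable_bound)
    show "set_integrable lborel {0..} (\<lambda>t. C * exp (- (Re s - \<beta>) * t))"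
      using set_integrable_exp_minus[of "Re s - \<beta>"] s by (intro set_integrable_mult_right) auto
    have "continuous_on {0..} (\<lambda>t. exp (- s * of_real t) * of_real (f t))"
      by (intro continuous_intros exp_order_continuous[OF f])
    then show "set_borel_measurable lborel {0..} (\<lambda>t. exp (- s * of_real t) * of_real (f t))"
      unfolding set_borel_measurable_def
      using borel_measurable_continuous_on_indicator[of "{0..}" "\<lambda>t. exp (- s * complex_of_real t) * of_real (f t)"] by auto
    have "norm (exp (- s * of_real t) * complex_of_real (f t)) \<le> norm (C * exp (- (Re s - \<beta>) * t))" if "t \<ge> 0" for t
    proof -
      have "norm (exp (- s * of_real t) * complex_of_real (f t)) = exp (- Re s * t) * \<bar>f t\<bar>"
        by (simp add: norm_mult)
      also have "\<dots> \<le> exp (- Re s * t) * (C * exp (\<beta> * t))" using C(2)[OF that] by (intro mult_left_mono) auto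
      also have "\<dots> = C * exp (- (Re s - \<beta>) * t)" by (simp add: mult_exp_exp algebra_simps)
      finally show ?thesis using C(1) by simp
    qed
    then show "AE x in lborel. x \<in> {0..} \<longrightarrow> norm (exp (- s * of_real x) * complex_of_real (f x)) \<le> norm (C * exp (- (Re s - \<beta>) * x))"
      by auto
  qed
qed

lemma laplace_absolutely_integrable:
  assumes "exp_order \<beta> f" "\<beta> < Re s"
  shows "(\<lambda>t. exp (- s * of_real t) * of_real (f t)) absolutely_integrable_on {0..}"
proof -
  have "integrable lborel (\<lambda>t. indicator {0..} t *\<^sub>R (exp (- s * of_real t) * complex_of_real (f t)))"
    using laplace_integrable_lborel[OF assms] by (simp add: set_integrable_def)
  then show ?thesis
    unfolding set_integrable_def using integrable_completion[OF borel_measurable_integrable] by blast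
qed

lemma laplace_integrable:
  "exp_order \<beta> f \<Longrightarrow> \<beta> < Re s \<Longrightarrow> (\<lambda>t. exp (- s * of_real t) * of_real (f t)) integrable_on {0..}"
  using laplace_absolutely_integrable set_lebesgue_integral_eq_integral(1) by blast

lemma laplace_cong: "(\<And>t. t \<ge> 0 \<Longrightarrow> f t = g t) \<Longrightarrow> laplace f s = laplace g s"
  unfolding laplace_def by (intro integral_cong) auto

lemma laplace_add:
  assumes "exp_order \<beta> f" "exp_order \<beta> g" "\<beta> < Re s"
  shows "laplace (\<lambda>t. f t + g t) s = laplace f s + laplace g s"
  unfolding laplace_def using laplace_integrable[OF assms(1,3)] laplace_integrable[OF assms(2,3)]
  by (simp add: distrib_left Henstock_Kurzweil_Integration.integral_add)

lemma laplace_mult: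
  "laplace (\<lambda>t. c * f t) s = of_real c * laplace f s"
proof -
  have "(\<lambda>t. exp (- s * of_real t) * complex_of_real (c * f t)) = (\<lambda>t. of_real c * (exp (- s * of_real t) * of_real (f t)))"
    by auto
  then show ?thesis unfolding laplace_def by simp
qed

lemma laplace_0: "laplace (\<lambda>t. 0) s = 0"
  by (simp add: laplace_def)

lemma laplace_sum:
  assumes "\<And>a. a \<in> A \<Longrightarrow> exp_order \<beta> (f a)" "\<beta> < Re s"
  shows "laplace (\<lambda>t. \<Sum>a\<in>A. f a t) s = (\<Sum>a\<in>A. laplace (f a) s)"
  using assms(1)
proof (induction A rule: infinite_finite_induct)
  case (insert a A)
  then show ?case using laplace_add[OF _ exp_order_sum[of A \<beta> f] assms(2), of "f a"] by simp
qed (auto simp: laplace_0)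

text \<open>The derivative of exp(-s t) f(t) is integrable on the half-line, and its integral is the
  difference of the boundary terms. These vanish at 0 by \<open>f 0 = 0\<close> and at infinity
  because f grows at a rate below Re s.\<close>

lemma laplace_deriv:
  assumes f: "exp_order \<beta> f" and f': "exp_order \<beta> f'" and s: "\<beta> < Re s"
    and d: "\<And>t. t \<ge> 0 \<Longrightarrow> (f has_vector_derivative f' t) (at t within {0..})" and f0: "f 0 = 0"
  shows "laplace f' s = s * laplace f s"
proof -
  define h where "h = (\<lambda>t. exp (- s * of_real t) * complex_of_real (f' t) + - s * (exp (- s * of_real t) * of_real (f t)))"
  have hi: "set_integrable lborel {0..} h"
    unfolding h_def by (intro set_integral_add set_integrable_mult_right laplace_integrable_lborel[OF f s] laplace_integrable_lborel[OF f' s])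
  have hn: "set_lebesgue_integral lborel {0..b} h = exp (- s * of_real b) * of_real (f b)" if b: "b \<ge> 0" for b
  proof -
    have "(h has_integral exp (- s * of_real b) * of_real (f b) - exp (- s * of_real 0) * of_real (f 0)) {0..b}"
    proof (rule fundamental_theorem_of_calculus[OF b])
      fix t assume t: "t \<in> {0..b}"
      have 1: "(f has_vector_derivative f' t) (at t within {0..b})"
        by (rule has_vector_derivative_within_subset[OF d]) (use t in auto)
      have 2: "((\<lambda>t. complex_of_real (f t)) has_vector_derivative of_real (f' t)) (at t within {0..b})"
        by (rule has_vector_derivative_of_real) (use 1 in \<open>simp add: has_real_derivative_iff_has_vector_derivative\<close>)
      have 3: "((\<lambda>t. exp (- s * of_real t)) has_vector_derivative - s * exp (- s * of_real t)) (at t within {0..b})"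
        by (auto intro!: derivative_eq_intros has_vector_derivative_real_field)
      show "((\<lambda>t. exp (- s * of_real t) * complex_of_real (f t)) has_vector_derivative h t) (at t within {0..b})"
        by (rule has_vector_derivative_eq_rhs[OF has_vector_derivative_mult[OF 3 2]]) (simp add: h_def)
    qed
    moreover have "set_integrable lborel {0..b} h" by (rule set_integrable_subset[OF hi]) auto
    ultimately show ?thesis using f0 by (simp add: set_borel_integral_eq_integral integral_unique)
  qed
  have "((\<lambda>b. set_lebesgue_integral lborel {0..b} h) \<longlongrightarrow> set_lebesgue_integral lborel {0..} h) at_top"
    by (rule tendsto_set_lebesgue_integral_at_top[OF _ hi]) auto
  then have l1: "((\<lambda>b. exp (- s * of_real b) * of_real (f b)) \<longlongrightarrow> set_lebesgue_integral lborel {0..} h) at_top"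
    by (rule Lim_transform_eventually) (use hn in \<open>auto intro!: eventually_at_top_linorderI[of 0]\<close>)
  obtain C where C: "C \<ge> 0" "\<And>t. t \<ge> 0 \<Longrightarrow> \<bar>f t\<bar> \<le> C * exp (\<beta> * t)" using f by (rule exp_orderE) blast
  have l2: "((\<lambda>b. exp (- s * of_real b) * complex_of_real (f b)) \<longlongrightarrow> 0) at_top"
  proof (rule Lim_null_comparison)
    show "\<forall>\<^sub>F b in at_top. norm (exp (- s * of_real b) * complex_of_real (f b)) \<le> C * exp (- ((Re s - \<beta>) * b))"
    proof (rule eventually_at_top_linorderI[of 0])
      fix t :: real assume "0 \<le> t"
      have "norm (exp (- s * of_real t) * complex_of_real (f t)) = exp (- Re s * t) * \<bar>f t\<bar>"
        by (simp add: norm_mult)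
      also have "\<dots> \<le> exp (- Re s * t) * (C * exp (\<beta> * t))" using C(2)[OF \<open>0 \<le> t\<close>] by (intro mult_left_mono) auto
      also have "\<dots> = C * exp (- ((Re s - \<beta>) * t))" by (simp add: mult_exp_exp algebra_simps)
      finally show "norm (exp (- s * of_real t) * complex_of_real (f t)) \<le> C * exp (- ((Re s - \<beta>) * t))" .
    qed
    have "filterlim (\<lambda>b. (Re s - \<beta>) * b) at_top at_top"
      using s by (intro filterlim_tendsto_pos_mult_at_top[OF tendsto_const]) (auto simp: filterlim_ident)
    then have "((\<lambda>b. exp (- ((Re s - \<beta>) * b))) \<longlongrightarrow> 0) at_top"
      by (intro filterlim_compose[OF exp_at_bot]) (simp add: filterlim_uminus_at_top)
    then show "((\<lambda>b. C * exp (- ((Re s - \<beta>) * b))) \<longlongrightarrow> 0) at_top"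
      by (rule tendsto_mult_right_zero)
  qed
  have "set_lebesgue_integral lborel {0..} h = 0" by (rule tendsto_unique[OF _ l1 l2]) simp
  then have "integral {0..} h = 0" using set_borel_integral_eq_integral(2)[OF hi] by simp
  moreover have "integral {0..} h = laplace f' s + - s * laplace f s"
    unfolding h_def laplace_def
    by (intro integral_unique has_integral_add has_integral_mult_right integrable_integral
        laplace_integrable[OF f s] laplace_integrable[OF f' s])
  ultimately show ?thesis by simp
qed

section \<open>The Laplace transform on a vertical line as a Fourier transform\<close>

definition damped :: "real \<Rightarrow> (real \<Rightarrow> real) \<Rightarrow> real \<Rightarrow> real" where
  "damped \<eta> f t = indicator {0..} t * (exp (- \<eta> * t) * f t)"

lemma damped_bounded:
  assumes "exp_order \<beta> f" "\<beta> \<le> \<eta>"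
  obtains M where "\<And>t. \<bar>damped \<eta> f t\<bar> \<le> M"
proof -
  obtain C where C: "C \<ge> 0" "\<And>t. t \<ge> 0 \<Longrightarrow> \<bar>f t\<bar> \<le> C * exp (\<eta> * t)"
    using exp_order_mono[OF assms] by (rule exp_orderE) blast
  have "\<bar>damped \<eta> f t\<bar> \<le> C" for t
  proof (cases "t \<ge> 0")
    case True
    have "exp (- \<eta> * t) * \<bar>f t\<bar> \<le> exp (- \<eta> * t) * (C * exp (\<eta> * t))" by (intro mult_left_mono C True) auto
    also have "\<dots> = C" by (simp add: exp_minus)
    finally show ?thesis using True by (simp add: damped_def abs_mult)
  qed (use C in \<open>auto simp: damped_def\<close>)
  then show ?thesis by (rule that)
qed

lemma damped_integrable:
  assumes "exp_order \<beta> f" "\<beta> < \<eta>"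
  shows "integrable lborel (damped \<eta> f)"
proof -
  have "integrable lborel (\<lambda>t. indicator {0..} t *\<^sub>R (exp (- complex_of_real \<eta> * of_real t) * of_real (f t)))"
    using laplace_integrable_lborel[OF assms(1), of "of_real \<eta>"] assms(2) by (simp add: set_integrable_def)
  also have "(\<lambda>t. indicator {0..} t *\<^sub>R (exp (- complex_of_real \<eta> * of_real t) * complex_of_real (f t))) = (\<lambda>t. complex_of_real (damped \<eta> f t))"
    by (auto simp: damped_def indicator_def fun_eq_iff exp_of_real simp flip: of_real_mult of_real_minus)
  finally show ?thesis by (simp add: complex_of_real_integrable_eq)
qed

lemma laplace_eq_fourier:
  assumes "exp_order \<beta> f" "\<beta> < \<eta>"
  shows "laplace f (Complex \<eta> \<xi>) = fourier (damped \<eta> f) \<xi>"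
proof -
  let ?s = "Complex \<eta> \<xi>"
  have "laplace f ?s = (LINT t:{0..}|lborel. exp (- ?s * of_real t) * of_real (f t))"
    unfolding laplace_def
    by (rule set_borel_integral_eq_integral(2)[symmetric], rule laplace_integrable_lborel[OF assms(1)]) (simp add: assms)
  also have "\<dots> = fourier (damped \<eta> f) \<xi>"
    unfolding set_lebesgue_integral_def fourier_def
  proof (intro Bochner_Integration.integral_cong refl)
    fix t
    have "exp (- ?s * of_real t) = cis (- \<xi> * t) * of_real (exp (- \<eta> * t))"
      by (subst exp_eq_polar) (simp add: mult.commute)
    then show "indicator {0..} t *\<^sub>R (exp (- ?s * of_real t) * of_real (f t)) = cis (- \<xi> * t) * of_real (damped \<eta> f t)"
      by (simp add: damped_def indicator_def)
  qed
  finally show ?thesis .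
qed

text \<open>Extension by zero to negative times is continuous because f starts at 0; in the error
  estimate this is where the zero initial data of the error enter Plancherel's theorem.\<close>

lemma damped_isCont:
  assumes f: "continuous_on {0..} f" and f0: "f 0 = 0"
  shows "isCont (damped \<eta> f) t"
proof -
  have "damped \<eta> f = (\<lambda>t. exp (- \<eta> * max 0 t) * f (max 0 t))"
    using f0 by (auto simp: damped_def fun_eq_iff max_def indicator_def)
  moreover have "continuous_on UNIV (\<lambda>t. exp (- \<eta> * max 0 t) * f (max 0 t))"
    by (intro continuous_intros continuous_on_compose2[OF f]) auto
  ultimately show ?thesis by (simp add: continuous_on_eq_continuous_at)
qed

lemma damped_energy:
  assumes "exp_order \<beta> f" "\<beta> < \<eta>"
  shows "(\<integral>t. (damped \<eta> f t)\<^sup>2 \<partial>lborel) = integral {0..} (\<lambda>t. exp (- 2 * \<eta> * t) * (f t)\<^sup>2)"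
    and "(\<lambda>t. exp (- 2 * \<eta> * t) * (f t)\<^sup>2) integrable_on {0..}"
proof -
  obtain M where M: "\<And>t. \<bar>damped \<eta> f t\<bar> \<le> M" using damped_bounded[OF assms(1), of \<eta>] assms(2) by auto
  have i: "integrable lborel (damped \<eta> f)" by (rule damped_integrable[OF assms])
  have "integrable lborel (\<lambda>t. (damped \<eta> f t)\<^sup>2)"
    unfolding power2_eq_square by (rule integrable_mult_bounded[OF i _ M]) (use i in \<open>auto dest: borel_measurable_integrable\<close>)
  moreover have eq: "(\<lambda>t. (damped \<eta> f t)\<^sup>2) = (\<lambda>t. indicator {0..} t *\<^sub>R (exp (- 2 * \<eta> * t) * (f t)\<^sup>2))"
    by (auto simp: damped_def fun_eq_iff indicator_def power_mult_distrib exp_double[symmetric])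
  ultimately have "set_integrable lborel {0..} (\<lambda>t. exp (- 2 * \<eta> * t) * (f t)\<^sup>2)"
    by (simp add: set_integrable_def)
  from set_borel_integral_eq_integral[OF this] eq
  show "(\<integral>t. (damped \<eta> f t)\<^sup>2 \<partial>lborel) = integral {0..} (\<lambda>t. exp (- 2 * \<eta> * t) * (f t)\<^sup>2)"
    and "(\<lambda>t. exp (- 2 * \<eta> * t) * (f t)\<^sup>2) integrable_on {0..}"
    by (simp_all add: set_lebesgue_integral_def)
qed

text \<open>Plancherel's theorem on the line Re s = \<eta>, as a comparison of two energies. Only
  \<open>g\<close> is required to start at 0: \<open>f\<close> will be the b-th derivative of the
  data, whose initial value the compatibility conditions leave free.\<close>

lemma laplace_energy_le:
  fixes g :: "'a \<Rightarrow> real \<Rightarrow> real" and f :: "'b \<Rightarrow> real \<Rightarrow> real"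
  assumes A: "finite A" and B: "finite B" and c: "c \<ge> 0" and \<beta>: "\<beta> < \<eta>"
    and g: "\<And>a. a \<in> A \<Longrightarrow> exp_order \<beta> (g a)" and g0: "\<And>a. a \<in> A \<Longrightarrow> g a 0 = 0"
    and f: "\<And>b. b \<in> B \<Longrightarrow> exp_order \<beta> (f b)"
    and le: "\<And>s. Re s = \<eta> \<Longrightarrow> (\<Sum>a\<in>A. (cmod (laplace (g a) s))\<^sup>2) \<le> c * (\<Sum>b\<in>B. (cmod (laplace (f b) s))\<^sup>2)"
  shows "(\<Sum>a\<in>A. integral {0..} (\<lambda>t. exp (- 2 * \<eta> * t) * (g a t)\<^sup>2))
      \<le> c * (\<Sum>b\<in>B. integral {0..} (\<lambda>t. exp (- 2 * \<eta> * t) * (f b t)\<^sup>2))"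
proof -
  have "\<exists>M. \<forall>a\<in>A. \<forall>t. \<bar>damped \<eta> (g a) t\<bar> \<le> M a"
    by (rule bchoice) (metis g \<beta> damped_bounded less_imp_le)
  then obtain M where M: "\<And>a t. a \<in> A \<Longrightarrow> \<bar>damped \<eta> (g a) t\<bar> \<le> M a" by blast
  have "\<exists>M. \<forall>a\<in>B. \<forall>t. \<bar>damped \<eta> (f a) t\<bar> \<le> M a"
    by (rule bchoice) (metis f \<beta> damped_bounded less_imp_le)
  then obtain M' where M': "\<And>a t. a \<in> B \<Longrightarrow> \<bar>damped \<eta> (f a) t\<bar> \<le> M' a" by blast
  have "(\<Sum>a\<in>A. \<integral>t. (damped \<eta> (g a) t)\<^sup>2 \<partial>lborel) \<le> c * (\<Sum>b\<in>B. \<integral>t. (damped \<eta> (f b) t)\<^sup>2 \<partial>lborel)"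
  proof (rule fourier_energy_le[OF A B c _ M _ _ M'])
    show "isCont (damped \<eta> (g a)) t" if "a \<in> A" for a t
      by (rule damped_isCont[OF exp_order_continuous[OF g[OF that]] g0[OF that]])
    show "(\<Sum>a\<in>A. (cmod (fourier (damped \<eta> (g a)) \<xi>))\<^sup>2) \<le> c * (\<Sum>b\<in>B. (cmod (fourier (damped \<eta> (f b)) \<xi>))\<^sup>2)" for \<xi>
      using le[of "Complex \<eta> \<xi>"] by (simp add: laplace_eq_fourier[OF g \<beta>] laplace_eq_fourier[OF f \<beta>] cong: sum.cong)
  qed (auto intro: damped_integrable g f \<beta>)
  then show ?thesis by (simp add: damped_energy(1)[OF g \<beta>] damped_energy(1)[OF f \<beta>] cong: sum.cong)
qed

section \<open>Iterated derivatives and prolongation of data\<close>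

lemma nderiv_0: "nderiv S 0 f = f"
  by (simp add: nderiv_def)

lemma nderiv_Suc: "nderiv S (Suc n) f t = vector_derivative (nderiv S n f) (at t within S)"
  by (simp add: nderiv_def)

text \<open>\<open>vector_derivative\<close> is a choice term. On a nondegenerate interval the
  within-filter is proper even at the end points, which makes one-sided derivatives unique.\<close>

lemma at_within_interval_not_bot:
  fixes S :: "real set"
  assumes "is_interval S" "a \<in> S" "b \<in> S" "a \<noteq> b" "t \<in> S"
  shows "at t within S \<noteq> bot"
  using connected_imp_perfect[of S t] assms trivial_limit_within[of t S]
  by (auto simp: is_interval_connected)

lemma at_within_Ici_not_bot: "t \<ge> 0 \<Longrightarrow> at t within {0..} \<noteq> (bot :: real filter)"
  by (rule at_within_interval_not_bot[of _ 0 1]) (auto simp: is_interval_ci)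

lemma at_within_Icc_not_bot: "c > 0 \<Longrightarrow> t \<in> {0..c} \<Longrightarrow> at t within {0..c} \<noteq> (bot :: real filter)"
  by (rule at_within_interval_not_bot[of _ 0 c]) (auto simp: is_interval_cc)

text \<open>\<open>C_on\<close> with the derivatives given as explicit functions \<open>D l\<close>
  in place of iterated choice terms, so that sums, differences and primitives are treated without
  computing \<open>nderiv\<close>. \<open>C_on_chain\<close> and \<open>chain_C_on\<close> translate
  between the two forms.\<close>

definition deriv_chain :: "real set \<Rightarrow> nat \<Rightarrow> (nat \<Rightarrow> real \<Rightarrow> real) \<Rightarrow> bool" where
  "deriv_chain S n D \<longleftrightarrow>
     (\<forall>l<n. \<forall>t\<in>S. (D l has_vector_derivative D (Suc l) t) (at t within S)) \<and> continuous_on S (D n)"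

lemma nderiv_chain:
  assumes D: "deriv_chain S n D" and S: "\<And>t. t \<in> S \<Longrightarrow> at t within S \<noteq> bot"
    and f: "\<And>t. t \<in> S \<Longrightarrow> f t = D 0 t" and "l \<le> n" "t \<in> S"
  shows "nderiv S l f t = D l t"
  using assms(4,5)
proof (induction l arbitrary: t)
  case 0
  then show ?case by (simp add: nderiv_0 f)
next
  case (Suc l)
  have "(D l has_vector_derivative D (Suc l) t) (at t within S)"
    using D Suc.prems by (auto simp: deriv_chain_def)
  then have "(nderiv S l f has_vector_derivative D (Suc l) t) (at t within S)"
    by (rule has_vector_derivative_transform[rotated 2]) (use Suc in auto)
  then show ?case
    unfolding nderiv_Suc using vector_derivative_within S Suc.prems(2) by blast
qed

lemma C_on_chain:
  assumes D: "deriv_chain S n D" and S: "\<And>t. t \<in> S \<Longrightarrow> at t within S \<noteq> bot"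
    and f: "\<And>t. t \<in> S \<Longrightarrow> f t = D 0 t"
  shows "C_on n S f"
  unfolding C_on_def
proof (intro conjI allI impI)
  fix l assume l: "l < n"
  show "nderiv S l f differentiable_on S"
    unfolding differentiable_on_def
  proof
    fix t assume t: "t \<in> S"
    have "(D l has_vector_derivative D (Suc l) t) (at t within S)"
      using D l t by (auto simp: deriv_chain_def)
    then have "(nderiv S l f has_vector_derivative D (Suc l) t) (at t within S)"
      by (rule has_vector_derivative_transform[rotated 2]) (use nderiv_chain[OF D S f] l t in auto)
    then show "nderiv S l f differentiable (at t within S)"
      by (rule differentiableI_vector)
  qed
next
  have "continuous_on S (D n)" using D by (simp add: deriv_chain_def)
  then show "continuous_on S (nderiv S n f)"
    by (rule continuous_on_eq) (use nderiv_chain[OF D S f] in auto)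
qed

lemma chain_C_on:
  assumes "C_on n S f"
  shows "deriv_chain S n (\<lambda>l. nderiv S l f)"
  unfolding deriv_chain_def
proof (intro conjI allI impI ballI)
  fix l t assume "l < n" "t \<in> S"
  then have "nderiv S l f differentiable (at t within S)"
    using assms by (auto simp: C_on_def differentiable_on_def)
  then show "(nderiv S l f has_vector_derivative nderiv S (Suc l) f t) (at t within S)"
    by (simp add: nderiv_Suc vector_derivative_works)
qed (use assms in \<open>simp add: C_on_def\<close>)

lemma deriv_chain_continuous:
  assumes "deriv_chain S n D" "l \<le> n"
  shows "continuous_on S (D l)"
proof (cases "l = n")
  case False
  then have "(D l has_vector_derivative D (Suc l) t) (at t within S)" if "t \<in> S" for t
    using assms that by (auto simp: deriv_chain_def)
  then show ?thesis
    unfolding continuous_on_eq_continuous_within using has_vector_derivative_continuous by blast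
qed (use assms in \<open>auto simp: deriv_chain_def\<close>)

lemma deriv_chain_sum:
  assumes "finite A" and "\<And>a. a \<in> A \<Longrightarrow> deriv_chain S n (D a)"
  shows "deriv_chain S n (\<lambda>l t. \<Sum>a\<in>A. c a * D a l t)"
  unfolding deriv_chain_def
proof (intro conjI allI impI ballI)
  fix l t assume "l < n" "t \<in> S"
  then show "((\<lambda>t. \<Sum>a\<in>A. c a * D a l t) has_vector_derivative (\<Sum>a\<in>A. c a * D a (Suc l) t)) (at t within S)"
    using assms by (intro has_vector_derivative_sum has_vector_derivative_mult_right) (auto simp: deriv_chain_def)
next
  show "continuous_on S (\<lambda>t. \<Sum>a\<in>A. c a * D a n t)"
    using assms by (intro continuous_intros) (auto simp: deriv_chain_def)
qed

section \<open>Continuation of data and differentiation of convolutions\<close>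

lemma at_within_Icc_eq_Ici:
  fixes t c :: real
  assumes "t < c" shows "at t within {0..c} = at t within {0..}"
  by (rule at_within_nhd[of _ "{..<c}"]) (use assms in auto)

lemma integral_has_vector_derivative_Ici:
  fixes f :: "real \<Rightarrow> real"
  assumes "continuous_on {0..} f" "t \<ge> 0"
  shows "((\<lambda>t. integral {0..t} f) has_vector_derivative f t) (at t within {0..})"
proof -
  have "((\<lambda>t. integral {0..t} f) has_vector_derivative f t) (at t within {0..t+1})"
    by (rule integral_has_vector_derivative) (use assms in \<open>auto intro: continuous_on_subset\<close>)
  then show ?thesis by (simp add: at_within_Icc_eq_Ici)
qed

text \<open>The \<open>b\<close>-th derivative is continued by a short ramp to zero and then integrated from \<open>0\<close>. The
  lower derivatives of the extension grow polynomially, which the exponential weight of the Laplace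
  transform tolerates, so nothing has to be said about their size at \<open>c\<close>.\<close>

lemma data_extension:
  assumes c: "c > 0" and T: "C_on b {0..c} T" and T0: "\<And>l. l < b \<Longrightarrow> nderiv {0..c} l T 0 = 0"
    and \<delta>: "\<delta> > 0" and \<beta>: "\<beta> > 0" "\<beta> < \<eta>"
  obtains D where "deriv_chain {0..} b D" "\<And>l. l < b \<Longrightarrow> D l 0 = 0"
    "\<And>l. l \<le> b \<Longrightarrow> exp_order \<beta> (D l)"
    "\<And>l t. l \<le> b \<Longrightarrow> t \<in> {0..c} \<Longrightarrow> D l t = nderiv {0..c} l T t"
    "integral {0..} (\<lambda>t. exp (- 2 * \<eta> * t) * (D b t)\<^sup>2) \<le>
       integral {0..c} (\<lambda>t. (nderiv {0..c} b T t)\<^sup>2) + \<delta> * (nderiv {0..c} b T c)\<^sup>2"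
proof -
  let ?T = "\<lambda>l. nderiv {0..c} l T"
  let ?S = "{0..c}"
  have chT: "deriv_chain ?S b ?T" by (rule chain_C_on[OF T])
  \<comment> \<open>\<open>min t c\<close> freezes the b-th derivative at its value at c. The second
    factor is 1 up to c, falls linearly to 0 on [c, c + \<delta>] and stays 0.\<close>
  define f where "f = (\<lambda>t. ?T b (min t c) * max 0 (1 - max 0 (t - c) / \<delta>))"
  \<comment> \<open>\<open>D l\<close> is the (b - l)-fold primitive of \<open>f\<close> from 0,
    which for l < b gives the compatibility conditions at 0 at once.\<close>
  define D where "D = (\<lambda>l. ((\<lambda>g t. integral {0..t} g) ^^ (b - l)) f)"
  have Db: "D b = f" by (simp add: D_def)
  have Dl: "D l = (\<lambda>t. integral {0..t} (D (Suc l)))" if "l < b" for l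
  proof -
    have "b - l = Suc (b - Suc l)" using that by simp
    then show ?thesis by (simp add: D_def)
  qed
  have fc: "continuous_on {0..} f"
    unfolding f_def
    by (intro continuous_intros continuous_on_compose2[OF deriv_chain_continuous[OF chT order_refl]])
      (use c \<delta> in auto)
  have f1: "f t = ?T b t" if "t \<in> ?S" for t using that by (auto simp: f_def min_def)
  have f2: "(f t)\<^sup>2 \<le> (?T b c)\<^sup>2" if "t \<ge> c" for t
  proof -
    have "\<bar>f t\<bar> \<le> \<bar>?T b c\<bar> * 1"
      unfolding f_def using that \<delta> by (auto simp: abs_mult min_def intro!: mult_left_le)
    then show ?thesis by (simp add: abs_le_square_iff)
  qed
  have f3: "f t = 0" if "t \<ge> c + \<delta>" for t
  proof -
    have "(t - c) / \<delta> \<ge> 1" using that \<delta> by (simp add: field_simps)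
    then show ?thesis using that \<delta> by (simp add: f_def max_def)
  qed
  have fo: "exp_order \<beta> f"
  proof -
    have "bounded (f ` {0..c+\<delta>})"
      by (intro compact_imp_bounded compact_continuous_image continuous_on_subset[OF fc]) auto
    from this[unfolded bounded_iff] obtain M where "\<forall>x\<in>f ` {0..c+\<delta>}. norm x \<le> M" ..
    then have M: "\<bar>f t\<bar> \<le> M" if "t \<in> {0..c+\<delta>}" for t using that by simp
    have M0: "0 \<le> M" using M[of 0] c \<delta> by auto
    show ?thesis
    proof (rule exp_orderI[OF fc, of M])
      fix t :: real assume t: "t \<ge> 0"
      have "M \<le> M * exp (\<beta> * t)" using t \<beta> M0 by (intro mult_le_cancel_left1[THEN iffD2]) auto
      moreover have "\<bar>f t\<bar> \<le> M" using M[of t] f3[of t] t M0 by (cases "t \<le> c + \<delta>") auto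
      ultimately show "\<bar>f t\<bar> \<le> M * exp (\<beta> * t)" by linarith
    qed
  qed
  have ord: "exp_order \<beta> (D l)" if "l \<le> b" for l
    using that
  proof (induction l rule: inc_induct)
    case base then show ?case using fo Db by simp
  next
    case (step l) then show ?case using exp_order_integral[OF _ \<beta>(1)] Dl by simp
  qed
  have ch: "deriv_chain {0..} b D"
    unfolding deriv_chain_def
  proof (intro conjI allI impI ballI)
    fix l t assume "l < b" "t \<in> {0::real..}"
    then show "(D l has_vector_derivative D (Suc l) t) (at t within {0..})"
      unfolding Dl[OF \<open>l < b\<close>]
      by (intro integral_has_vector_derivative_Ici exp_order_continuous[OF ord]) auto
  qed (simp add: Db fc)
  have D0: "D l 0 = 0" if "l < b" for l using Dl[OF that] by simp
  \<comment> \<open>Downwards in l: on [0, c] both sides are primitives of the same function, and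
    both vanish at 0, the right one because T is compatible.\<close>
  have agree: "D l t = ?T l t" if "l \<le> b" "t \<in> ?S" for l t
    using that
  proof (induction l arbitrary: t rule: inc_induct)
    case base then show ?case using f1 Db by simp
  next
    case (step l)
    have t: "0 \<le> t" "t \<le> c" and l: "l < b" using step by auto
    have "(?T (Suc l) has_integral ?T l t - ?T l 0) {0..t}"
    proof (rule fundamental_theorem_of_calculus[OF t(1)])
      fix x assume "x \<in> {0..t}"
      then have x: "x \<in> ?S" using t by simp
      have "(?T l has_vector_derivative ?T (Suc l) x) (at x within ?S)"
        using chT l x unfolding deriv_chain_def by blast
      then show "(?T l has_vector_derivative ?T (Suc l) x) (at x within {0..t})"
        by (rule has_vector_derivative_within_subset) (use t in simp)
    qed
    then have "integral {0..t} (?T (Suc l)) = ?T l t" using T0[OF l] by (simp add: integral_unique)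
    moreover have "integral {0..t} (?T (Suc l)) = integral {0..t} (D (Suc l))"
      by (rule integral_cong, rule step.IH[symmetric]) (use t in simp)
    ultimately show ?case unfolding Dl[OF l] by simp
  qed
  define h where "h = (\<lambda>t. exp (- 2 * \<eta> * t) * (f t)\<^sup>2)"
  have hc: "continuous_on {0..} h" unfolding h_def by (intro continuous_intros fc)
  have hi: "h integrable_on {a..b}" if "a \<ge> 0" for a b
    by (intro integrable_continuous_real continuous_on_subset[OF hc]) (use that in auto)
  have hle: "h t \<le> (f t)\<^sup>2" if "t \<ge> 0" for t
    using that \<beta> by (auto simp: h_def intro!: mult_left_le_one_le)
  have "((\<lambda>t. if t \<in> {0..} then h t else 0) has_integral integral {0..c+\<delta>} h) {0..c+\<delta>}"
    by (rule has_integral_eq[OF _ integrable_integral[OF hi]]) auto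
  then have "((\<lambda>t. if t \<in> {0..} then h t else 0) has_integral integral {0..c+\<delta>} h) {0..}"
    by (rule has_integral_on_superset) (auto simp: h_def f3)
  then have "(h has_integral integral {0..c+\<delta>} h) {0..}" by (rule has_integral_eq[rotated]) auto
  then have "integral {0..} h = integral {0..c+\<delta>} h" by (rule integral_unique)
  also have "\<dots> = integral {0..c} h + integral {c..c+\<delta>} h"
    by (rule Henstock_Kurzweil_Integration.integral_combine[symmetric]) (use c \<delta> hi in auto)
  \<comment> \<open>The weight is at most 1 throughout. On the ramp |f| is bounded by its value at
    c, so this piece costs at most \<delta> times the square of that value.\<close>
  also have "\<dots> \<le> integral {0..c} (\<lambda>t. (?T b t)\<^sup>2) + integral {c..c+\<delta>} (\<lambda>t. (?T b c)\<^sup>2)"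
  proof (intro add_mono integral_le hi)
    show "(\<lambda>t. (?T b t)\<^sup>2) integrable_on {0..c}"
      by (intro integrable_continuous_real continuous_intros deriv_chain_continuous[OF chT order_refl])
    show "h t \<le> (?T b t)\<^sup>2" if "t \<in> {0..c}" for t using hle[of t] f1[OF that] that by simp
    show "h t \<le> (?T b c)\<^sup>2" if "t \<in> {c..c+\<delta>}" for t using hle[of t] f2[of t] that c by auto
  qed (use c in auto)
  finally have "integral {0..} h \<le> integral {0..c} (\<lambda>t. (?T b t)\<^sup>2) + \<delta> * (?T b c)\<^sup>2" using \<delta> by simp
  then show ?thesis using that[of D] ch D0 ord agree by (simp add: h_def Db)
qed

text \<open>Treat the upper limit y and the argument x of the kernel as independent variables. The
  partial derivative in x is Leibniz' rule, the one in y the fundamental theorem of calculus; joint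
  differentiability at (t, t) then permits the chain rule along the diagonal.\<close>

lemma convolution_has_vector_derivative:
  fixes F G G' :: "real \<Rightarrow> real"
  assumes F: "continuous_on {0..} F"
    and G: "\<And>x. (G has_real_derivative G' x) (at x)" and G': "continuous_on UNIV G'"
    and t: "t \<ge> 0"
  shows "((\<lambda>t. integral {0..t} (\<lambda>s. F s * G (t - s))) has_vector_derivative
      F t * G 0 + integral {0..t} (\<lambda>s. F s * G' (t - s))) (at t within {0..})"
proof -
  \<comment> \<open>The interval reaches beyond t, so that at t the derivative within it is the
    derivative within the half-line.\<close>
  let ?Y = "{0..t+1}"
  have Gc: "continuous_on UNIV G" using G DERIV_isCont by (blast intro: continuous_at_imp_continuous_on)
  define f where "f = (\<lambda>x y. integral {0..y} (\<lambda>s. F s * G (x - s)))"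
  have "((\<lambda>(x, y). f x y) has_derivative
      (\<lambda>(tx, ty). tx *\<^sub>R integral {0..t} (\<lambda>s. F s * G' (t - s)) + blinfun_apply (blinfun_scaleR_left (F t * G (t - t))) ty))
      (at (t, t) within UNIV \<times> ?Y)"
  proof (rule has_derivative_partialsI[where fy="\<lambda>x y. blinfun_scaleR_left (F y * G (x - y))"])
    have "((\<lambda>x. integral (cbox 0 t) (\<lambda>s. F s * G (x - s))) has_vector_derivative
        integral (cbox 0 t) (\<lambda>s. F s * G' (t - s))) (at t within UNIV)"
    proof (rule leibniz_rule_vector_derivative[where fx="\<lambda>x s. F s * G' (x - s)"])
      fix x s :: real
      have "((\<lambda>x. G (x - s)) has_real_derivative G' (x - s)) (at x)"
        by (rule DERIV_cong[OF DERIV_chain2[OF G]]) (auto intro!: derivative_eq_intros)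
      then show "((\<lambda>x. F s * G (x - s)) has_vector_derivative F s * G' (x - s)) (at x within UNIV)"
        by (intro has_vector_derivative_mult_right) (simp add: has_real_derivative_iff_has_vector_derivative)
      show "(\<lambda>s. F s * G (x - s)) integrable_on cbox 0 t"
        unfolding cbox_interval
        by (intro integrable_continuous_real continuous_intros continuous_on_subset[OF F] continuous_on_compose2[OF Gc]) auto
      show "continuous_on (UNIV \<times> cbox 0 t) (\<lambda>(x, s). F s * G' (x - s))"
        unfolding split_beta
        by (intro continuous_intros continuous_on_compose2[OF F] continuous_on_compose2[OF G']) auto
    qed auto
    then show "((\<lambda>x. f x t) has_derivative (\<lambda>tx. tx *\<^sub>R integral {0..t} (\<lambda>s. F s * G' (t - s)))) (at t within UNIV)"
      by (simp add: f_def has_vector_derivative_def cbox_interval)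
    show "((\<lambda>y. f x y) has_derivative blinfun_apply (blinfun_scaleR_left (F y * G (x - y)))) (at y within ?Y)"
      if "y \<in> ?Y" for x y
    proof -
      have "((\<lambda>y. f x y) has_vector_derivative F y * G (x - y)) (at y within ?Y)"
        unfolding f_def
        by (rule integral_has_vector_derivative)
          (use that in \<open>auto intro!: continuous_intros continuous_on_subset[OF F] continuous_on_compose2[OF Gc]\<close>)
      then show ?thesis by (simp add: has_vector_derivative_def)
    qed
    have "continuous_on (UNIV \<times> ?Y) (\<lambda>(x, y). blinfun_scaleR_left (F y * G (x - y)) :: real \<Rightarrow>\<^sub>L real)"
      unfolding split_beta
      by (intro bounded_linear.continuous_on[OF bounded_linear_blinfun_scaleR_left] continuous_intros
          continuous_on_compose2[OF F] continuous_on_compose2[OF Gc]) auto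
    then show "continuous (at (t, t) within UNIV \<times> ?Y) (\<lambda>(x, y). blinfun_scaleR_left (F y * G (x - y)) :: real \<Rightarrow>\<^sub>L real)"
      using t by (auto simp: continuous_on_eq_continuous_within)
  qed (use t in auto)
  then have "((\<lambda>(x, y). f x y) has_derivative
      (\<lambda>(tx, ty). tx *\<^sub>R integral {0..t} (\<lambda>s. F s * G' (t - s)) + ty *\<^sub>R (F t * G 0)))
      (at (t, t) within (\<lambda>x. (x, x)) ` ?Y)"
    by (rule has_derivative_subset[THEN has_derivative_eq_rhs]) (auto simp: fun_eq_iff)
  from has_derivative_in_compose[OF has_derivative_Pair[OF has_derivative_ident has_derivative_ident] this]
  have "((\<lambda>x. f x x) has_derivative
      (\<lambda>h. h *\<^sub>R integral {0..t} (\<lambda>s. F s * G' (t - s)) + h *\<^sub>R (F t * G 0))) (at t within ?Y)"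
    by simp
  then have "((\<lambda>x. f x x) has_vector_derivative F t * G 0 + integral {0..t} (\<lambda>s. F s * G' (t - s))) (at t within ?Y)"
    unfolding has_vector_derivative_def by (rule has_derivative_eq_rhs) (auto simp: algebra_simps)
  then show ?thesis using t by (simp add: f_def at_within_Icc_eq_Ici)
qed

section \<open>The semi-discrete operator\<close>

text \<open>The exponential generating function of a sequence. The factorials turn differentiation
  in t into the shift of the sequence, so a differential equation in time becomes a recursion for
  the coefficients.\<close>

definition egf :: "(nat \<Rightarrow> real) \<Rightarrow> real \<Rightarrow> real" where
  "egf a t = (\<Sum>m. a m / fact m * t ^ m)"

lemma egf_summable:
  assumes "\<And>m. \<bar>a m\<bar> \<le> C * R ^ m"
  shows "summable (\<lambda>m. a m / fact m * t ^ m)"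
    and "\<bar>egf a t\<bar> \<le> C * exp (R * \<bar>t\<bar>)"
proof -
  have s: "(\<lambda>m. C * ((R * \<bar>t\<bar>) ^ m / fact m)) sums (C * exp (R * \<bar>t\<bar>))"
    using exp_converges[of "R * \<bar>t\<bar>"] by (intro sums_mult) (simp add: divide_inverse mult.commute)
  have le: "norm (a m / fact m * t ^ m) \<le> C * ((R * \<bar>t\<bar>) ^ m / fact m)" for m
  proof -
    have "norm (a m / fact m * t ^ m) = \<bar>a m\<bar> * (\<bar>t\<bar> ^ m / fact m)"
      by (simp add: abs_mult power_abs)
    also have "\<dots> \<le> (C * R ^ m) * (\<bar>t\<bar> ^ m / fact m)" by (intro mult_right_mono assms) auto
    finally show ?thesis by (simp add: power_mult_distrib)
  qed
  have 1: "summable (\<lambda>m. norm (a m / fact m * t ^ m))"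
    by (rule summable_comparison_test_ev[OF _ sums_summable[OF s]]) (use le in auto)
  then show "summable (\<lambda>m. a m / fact m * t ^ m)" by (rule summable_norm_cancel)
  have "\<bar>egf a t\<bar> \<le> (\<Sum>m. norm (a m / fact m * t ^ m))"
    unfolding egf_def using summable_norm[OF 1] by simp
  also have "\<dots> \<le> C * exp (R * \<bar>t\<bar>)"
    unfolding sums_unique[OF s] by (rule suminf_le[OF le 1 sums_summable[OF s]])
  finally show "\<bar>egf a t\<bar> \<le> C * exp (R * \<bar>t\<bar>)" .
qed

lemma egf_has_derivative:
  assumes "\<And>m. \<bar>a m\<bar> \<le> C * R ^ m"
  shows "(egf a has_real_derivative egf (\<lambda>m. a (Suc m)) t) (at t)"
proof -
  have "((\<lambda>x. \<Sum>m. a m / fact m * x ^ m) has_real_derivative (\<Sum>m. diffs (\<lambda>m. a m / fact m) m * t ^ m)) (at t)"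
    by (rule termdiffs_strong_converges_everywhere) (rule egf_summable(1)[OF assms])
  moreover have "diffs (\<lambda>m. a m / fact m) = (\<lambda>m. a (Suc m) / fact m)"
    by (auto simp: diffs_def fun_eq_iff field_simps simp del: of_nat_Suc)
  ultimately show ?thesis by (simp add: egf_def[abs_def])
qed

lemma egf_0: "egf a 0 = a 0"
  using powser_zero[of "\<lambda>m. a m / fact m"] by (simp add: egf_def)

lemma egf_linear:
  assumes "\<And>l m. l \<in> I \<Longrightarrow> \<bar>a l m\<bar> \<le> C l * R l ^ m"
  shows "egf (\<lambda>m. \<Sum>l\<in>I. c l * a l m) t = (\<Sum>l\<in>I. c l * egf (a l) t)"
proof -
  have "egf (\<lambda>m. \<Sum>l\<in>I. c l * a l m) t = (\<Sum>m. \<Sum>l\<in>I. c l * (a l m / fact m * t ^ m))"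
    by (simp add: egf_def sum_distrib_right sum_divide_distrib mult.assoc)
  also have "\<dots> = (\<Sum>l\<in>I. \<Sum>m. c l * (a l m / fact m * t ^ m))"
    by (rule suminf_sum) (intro summable_mult egf_summable(1)[OF assms])
  also have "\<dots> = (\<Sum>l\<in>I. c l * egf (a l) t)"
    unfolding egf_def by (intro sum.cong refl suminf_mult egf_summable(1)[OF assms])
  finally show ?thesis .
qed

text \<open>Minkowski's integral inequality, by duality: with x the vector of integrals, |x|^2 is
  the integral of the inner products of x with f(s), hence at most |x| times the integral of
  \<open>n\<close>; then divide by |x|.\<close>

lemma L2_set_integral_le:
  fixes f :: "'p \<Rightarrow> real \<Rightarrow> real"
  assumes P: "finite P" and f: "\<And>p. p \<in> P \<Longrightarrow> f p integrable_on S" and n: "n integrable_on S"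
    and le: "\<And>s. s \<in> S \<Longrightarrow> L2_set (\<lambda>p. f p s) P \<le> n s"
  shows "L2_set (\<lambda>p. integral S (f p)) P \<le> integral S n"
proof -
  define x where "x = (\<lambda>p. integral S (f p))"
  have "(L2_set x P)\<^sup>2 = (\<Sum>p\<in>P. x p * integral S (f p))"
    by (simp add: L2_set_def x_def sum_nonneg power2_eq_square)
  also have "\<dots> = integral S (\<lambda>s. \<Sum>p\<in>P. x p * f p s)"
    using f P by (simp add: Henstock_Kurzweil_Integration.integral_sum integrable_on_mult_right)
  also have "\<dots> \<le> integral S (\<lambda>s. L2_set x P * n s)"
  proof (rule integral_le)
    show "(\<lambda>s. \<Sum>p\<in>P. x p * f p s) integrable_on S"
      using f P by (intro integrable_sum integrable_on_mult_right)
    show "(\<lambda>s. L2_set x P * n s) integrable_on S" using n by (rule integrable_on_mult_right)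
    fix s assume s: "s \<in> S"
    have "(\<Sum>p\<in>P. x p * f p s) \<le> (\<Sum>p\<in>P. \<bar>x p\<bar> * \<bar>f p s\<bar>)"
      by (intro sum_mono) (metis abs_ge_self abs_mult)
    also have "\<dots> \<le> L2_set x P * L2_set (\<lambda>p. f p s) P" by (rule L2_set_mult_ineq)
    also have "\<dots> \<le> L2_set x P * n s" by (intro mult_left_mono le s) simp
    finally show "(\<Sum>p\<in>P. x p * f p s) \<le> L2_set x P * n s" .
  qed
  finally have *: "(L2_set x P)\<^sup>2 \<le> L2_set x P * integral S n" by simp
  have "0 \<le> integral S n"
    by (rule integral_nonneg[OF n]) (use le L2_set_nonneg order_trans in blast)
  then have "L2_set x P \<le> integral S n"
    using * by (cases "L2_set x P = 0") (auto simp: power2_eq_square zero_less_mult_iff less_le)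
  then show ?thesis by (simp add: x_def)
qed

lemma L2_set_sum_le:
  "L2_set (\<lambda>p. \<Sum>a\<in>A. f a p) P \<le> (\<Sum>a\<in>A. L2_set (f a) P)"
proof (induction A rule: infinite_finite_induct)
  case (insert a A)
  then show ?case using L2_set_triangle_ineq[of "f a" "\<lambda>p. \<Sum>a\<in>A. f a p" P] by simp
qed (auto simp: L2_set_def)

section \<open>The grid operator as a finite stencil\<close>

definition grid_op :: "nat \<Rightarrow> (nat \<Rightarrow> nat \<Rightarrow> real) \<Rightarrow> real mat \<Rightarrow> (nat \<Rightarrow> nat \<Rightarrow> real) \<Rightarrow> nat \<Rightarrow> nat \<Rightarrow> real" where
  "grid_op N A B v i j = 1 / (mesh N)\<^sup>2 * kron_apply N A (1\<^sub>m N) v i j +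
     1 / (mesh N)\<^sup>2 * kron_apply N id_x B v i j"

lemma finite_stencil:
  assumes "finite_difference_operator A" shows "finite {l. A i l \<noteq> 0}"
proof -
  obtain w where "\<And>i l. A i l \<noteq> 0 \<longrightarrow> i \<le> l + w \<and> l \<le> i + w"
    using assms unfolding finite_difference_operator_def by blast
  then have "{l. A i l \<noteq> 0} \<subseteq> {..i + w}" by auto
  then show ?thesis using finite_subset by blast
qed

definition grid_coeff :: "nat \<Rightarrow> (nat \<Rightarrow> nat \<Rightarrow> real) \<Rightarrow> real mat \<Rightarrow> nat \<Rightarrow> nat \<Rightarrow> nat \<times> nat \<Rightarrow> real" where
  "grid_coeff N A B i j = (\<lambda>(l, q). 1 / (mesh N)\<^sup>2 *
     ((if q = j then A i l else 0) + (if l = i then B $$ (j, q) else 0)))"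

text \<open>The column i is inserted because the operator in y acts there even if
  \<open>A i i = 0\<close>.\<close>

definition grid_stencil :: "nat \<Rightarrow> (nat \<Rightarrow> nat \<Rightarrow> real) \<Rightarrow> nat \<Rightarrow> (nat \<times> nat) set" where
  "grid_stencil N A i = insert i {l. A i l \<noteq> 0} \<times> {..<N}"

lemma finite_grid_stencil: "finite_difference_operator A \<Longrightarrow> finite (grid_stencil N A i)"
  by (simp add: grid_stencil_def finite_stencil)

lemma kron_apply_id_right:
  assumes "j < N"
  shows "kron_apply N A (1\<^sub>m N) v i j = (\<Sum>l | A i l \<noteq> 0. A i l * v l j)"
proof -
  have "(\<Sum>q<N. A i l * 1\<^sub>m N $$ (j, q) * v l q) = A i l * v l j" for l
  proof -
    have "(\<Sum>q<N. A i l * 1\<^sub>m N $$ (j, q) * v l q) = (\<Sum>q<N. if q = j then A i l * v l j else 0)"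
      using assms by (intro sum.cong) auto
    then show ?thesis using assms by simp
  qed
  then show ?thesis by (simp add: kron_apply_def)
qed

lemma kron_apply_id_left: "kron_apply N id_x B v i j = (\<Sum>q<N. B $$ (j, q) * v i q)"
proof -
  have "{l. id_x i l \<noteq> 0} = {i}" by (auto simp: id_x_def)
  then show ?thesis by (simp add: kron_apply_def id_x_def)
qed

text \<open>Written as a finite linear combination of grid values, the operator commutes with power
  series, convolutions and Laplace transforms.\<close>

lemma grid_op_eq:
  assumes A: "finite_difference_operator A" and j: "j < N"
  shows "grid_op N A B v i j = (\<Sum>p\<in>grid_stencil N A i. grid_coeff N A B i j p * v (fst p) (snd p))"
proof -
  let ?I = "insert i {l. A i l \<noteq> 0}"
  have fI: "finite ?I" using finite_stencil[OF A] by simp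
  have "(\<Sum>p\<in>grid_stencil N A i. grid_coeff N A B i j p * v (fst p) (snd p)) =
      (\<Sum>l\<in>?I. \<Sum>q<N. 1 / (mesh N)\<^sup>2 * ((if q = j then A i l * v l q else 0) + (if l = i then B $$ (j, q) * v l q else 0)))"
    unfolding grid_stencil_def grid_coeff_def sum.cartesian_product
    by (intro sum.cong) (auto simp: algebra_simps)
  also have "\<dots> = 1 / (mesh N)\<^sup>2 * ((\<Sum>l\<in>?I. \<Sum>q<N. if q = j then A i l * v l q else 0) +
      (\<Sum>l\<in>?I. \<Sum>q<N. if l = i then B $$ (j, q) * v l q else 0))"
    by (simp only: sum_distrib_left sum.distrib distrib_left)
  also have "(\<Sum>l\<in>?I. \<Sum>q<N. if q = j then A i l * v l q else 0) = (\<Sum>l\<in>?I. A i l * v l j)"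
    using j by simp
  also have "(\<Sum>l\<in>?I. A i l * v l j) = (\<Sum>l | A i l \<noteq> 0. A i l * v l j)"
    by (rule sum.mono_neutral_right[OF fI]) auto
  also have "(\<Sum>l\<in>?I. \<Sum>q<N. if l = i then B $$ (j, q) * v l q else 0) = (\<Sum>l\<in>?I. if l = i then \<Sum>q<N. B $$ (j, q) * v l q else 0)"
    by (intro sum.cong) auto
  also have "\<dots> = (\<Sum>q<N. B $$ (j, q) * v i q)" using fI by simp
  finally show ?thesis
    by (simp add: grid_op_def kron_apply_id_right[OF j] kron_apply_id_left distrib_left)
qed

text \<open>A stencil of bounded width maps grid functions with geometric decay in \<open>i\<close> to such functions. This
  gives square summability for bounded times without operator theory in a sequence space. The constants
  grow too fast in time for the Laplace transform, for which the growth is taken from stability.\<close>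

definition decays :: "nat \<Rightarrow> real \<Rightarrow> (nat \<Rightarrow> nat \<Rightarrow> real) \<Rightarrow> bool" where
  "decays N C v \<longleftrightarrow> (\<forall>i. \<forall>j<N. \<bar>v i j\<bar> \<le> C * (1 / 2) ^ i)"

lemma grid_op_decays:
  assumes A: "finite_difference_operator A"
  obtains R where "R \<ge> 1" "\<And>C v. C \<ge> 0 \<Longrightarrow> decays N C v \<Longrightarrow> decays N (R * C) (grid_op N A B v)"
proof -
  obtain w M where w: "\<And>i l. \<bar>A i l\<bar> \<le> M" "\<And>i l. A i l \<noteq> 0 \<longrightarrow> i \<le> l + w \<and> l \<le> i + w"
    using A unfolding finite_difference_operator_def by blast
  have M0: "M \<ge> 0" using w(1)[of 0 0] by linarith
  define b where "b = (\<Sum>j<N. \<Sum>q<N. \<bar>B $$ (j, q)\<bar>)"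
  have b0: "b \<ge> 0" by (auto simp: b_def intro!: sum_nonneg)
  define h2 where "h2 = 1 / (mesh N)\<^sup>2"
  have h2: "h2 \<ge> 0" by (simp add: h2_def)
  \<comment> \<open>Growth factor of one application: a row has at most 2 w + 1 entries of size at
    most M, each reaching at most w columns back, which costs 2^w in the decay; b covers the
    y-direction. The summand 1 provides R >= 1.\<close>
  define R where "R = 1 + h2 * (real (2 * w + 1) * (M * 2 ^ w)) + h2 * b"
  have R1: "R \<ge> 1" using M0 b0 h2 by (simp add: R_def)
  moreover have "decays N (R * C) (grid_op N A B v)" if C: "C \<ge> 0" and v: "decays N C v" for C v
    unfolding decays_def
  proof (intro allI impI)
    fix i j assume j: "j < N"
    let ?I = "{l. A i l \<noteq> 0}"
    have sub: "?I \<subseteq> {i - w..i + w}" using w(2) by force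
    have "card ?I \<le> card {i - w..i + w}" by (rule card_mono[OF _ sub]) simp
    also have "\<dots> \<le> 2 * w + 1" by auto
    finally have card: "card ?I \<le> 2 * w + 1" .
    have "\<bar>\<Sum>l\<in>?I. A i l * v l j\<bar> \<le> (\<Sum>l\<in>?I. M * 2 ^ w * (C * (1 / 2) ^ i))"
    proof (rule order_trans[OF sum_abs], rule sum_mono)
      fix l assume l: "l \<in> ?I"
      have "(1 / 2 :: real) ^ (l + w) \<le> (1 / 2) ^ i" using w(2) l by (intro power_decreasing) auto
      then have "(1 / 2 :: real) ^ l \<le> 2 ^ w * (1 / 2) ^ i" by (simp add: power_add field_simps power_one_over)
      then have "C * (1 / 2) ^ l \<le> C * (2 ^ w * (1 / 2) ^ i)" using C by (intro mult_left_mono)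
      moreover have "\<bar>v l j\<bar> \<le> C * (1 / 2) ^ l" using v j by (simp add: decays_def)
      ultimately have "\<bar>v l j\<bar> \<le> C * (2 ^ w * (1 / 2) ^ i)" by linarith
      then have "\<bar>A i l\<bar> * \<bar>v l j\<bar> \<le> M * (C * (2 ^ w * (1 / 2) ^ i))"
        using w(1) M0 by (intro mult_mono) auto
      then show "\<bar>A i l * v l j\<bar> \<le> M * 2 ^ w * (C * (1 / 2) ^ i)" by (simp add: abs_mult mult_ac)
    qed
    also have "\<dots> = real (card ?I) * (M * 2 ^ w * (C * (1 / 2) ^ i))" by simp
    also have "\<dots> \<le> real (2 * w + 1) * (M * 2 ^ w * (C * (1 / 2) ^ i))"
      using card M0 C by (intro mult_right_mono of_nat_mono) auto
    finally have 1: "\<bar>\<Sum>l\<in>?I. A i l * v l j\<bar> \<le> real (2 * w + 1) * (M * 2 ^ w) * (C * (1 / 2) ^ i)"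
      by (simp add: mult_ac)
    have "\<bar>\<Sum>q<N. B $$ (j, q) * v i q\<bar> \<le> (\<Sum>q<N. \<bar>B $$ (j, q)\<bar> * (C * (1 / 2) ^ i))"
      by (rule order_trans[OF sum_abs], rule sum_mono)
        (use v in \<open>auto simp: decays_def abs_mult intro!: mult_left_mono\<close>)
    also have "\<dots> = (\<Sum>q<N. \<bar>B $$ (j, q)\<bar>) * (C * (1 / 2) ^ i)" by (simp add: sum_distrib_right)
    also have "\<dots> \<le> b * (C * (1 / 2) ^ i)"
      unfolding b_def using j C
      by (intro mult_right_mono member_le_sum[of j "{..<N}" "\<lambda>j. \<Sum>q<N. \<bar>B $$ (j, q)\<bar>"]) (auto intro: sum_nonneg)
    finally have 2: "\<bar>\<Sum>q<N. B $$ (j, q) * v i q\<bar> \<le> b * (C * (1 / 2) ^ i)" .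
    have "\<bar>grid_op N A B v i j\<bar> \<le> h2 * \<bar>\<Sum>l\<in>?I. A i l * v l j\<bar> + h2 * \<bar>\<Sum>q<N. B $$ (j, q) * v i q\<bar>"
      unfolding grid_op_def kron_apply_id_right[OF j] kron_apply_id_left h2_def[symmetric]
      by (rule order_trans[OF abs_triangle_ineq]) (simp add: abs_mult h2)
    also have "\<dots> \<le> h2 * (real (2 * w + 1) * (M * 2 ^ w) * (C * (1 / 2) ^ i)) + h2 * (b * (C * (1 / 2) ^ i))"
      by (intro add_mono mult_left_mono 1 2 h2)
    also have "\<dots> = (R - 1) * (C * (1 / 2) ^ i)" by (simp add: R_def algebra_simps)
    also have "\<dots> \<le> R * (C * (1 / 2) ^ i)" using C by (intro mult_right_mono) auto
    finally show "\<bar>grid_op N A B v i j\<bar> \<le> R * C * (1 / 2) ^ i" by (simp add: mult.assoc)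
  qed
  ultimately show ?thesis by (rule that)
qed

lemma decays_norm2D:
  assumes "decays N C v"
  shows "summable (\<lambda>i. \<Sum>j<N. \<bar>v i j\<bar>\<^sup>2)"
    and "norm2D N v \<le> sqrt ((mesh N)\<^sup>2 * (real N * C\<^sup>2 * (4 / 3)))"
    and "(\<Sum>j<N. \<bar>v i j\<bar>\<^sup>2) \<le> real N * C\<^sup>2 * (1 / 4) ^ i"
proof -
  have le: "(\<Sum>j<N. \<bar>v i j\<bar>\<^sup>2) \<le> real N * C\<^sup>2 * (1 / 4) ^ i" for i
  proof -
    have "\<bar>v i j\<bar>\<^sup>2 \<le> C\<^sup>2 * (1 / 4) ^ i" if "j < N" for j
    proof -
      have "\<bar>v i j\<bar>\<^sup>2 \<le> (C * (1 / 2) ^ i)\<^sup>2" using assms that by (intro power_mono) (auto simp: decays_def)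
      also have "\<dots> = C\<^sup>2 * (1 / 4) ^ i"
        by (simp add: power2_eq_square mult_ac flip: power_mult_distrib)
      finally show ?thesis .
    qed
    then have "(\<Sum>j<N. \<bar>v i j\<bar>\<^sup>2) \<le> (\<Sum>j<N. C\<^sup>2 * (1 / 4) ^ i)" by (intro sum_mono) auto
    then show ?thesis by (simp add: mult.assoc)
  qed
  then show "(\<Sum>j<N. \<bar>v i j\<bar>\<^sup>2) \<le> real N * C\<^sup>2 * (1 / 4) ^ i" .
  have s: "(\<lambda>i. real N * C\<^sup>2 * (1 / 4) ^ i) sums (real N * C\<^sup>2 * (1 / (1 - 1 / 4)))"
    by (intro sums_mult geometric_sums) auto
  show sm: "summable (\<lambda>i. \<Sum>j<N. \<bar>v i j\<bar>\<^sup>2)"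
    by (rule summable_comparison_test'[OF sums_summable[OF s]]) (use le in \<open>auto simp: sum_nonneg\<close>)
  have "(\<Sum>i. \<Sum>j<N. \<bar>v i j\<bar>\<^sup>2) \<le> real N * C\<^sup>2 * (1 / (1 - 1 / 4))"
    unfolding sums_unique[OF s] by (rule suminf_le[OF le sm sums_summable[OF s]])
  then show "norm2D N v \<le> sqrt ((mesh N)\<^sup>2 * (real N * C\<^sup>2 * (4 / 3)))"
    unfolding norm2D_def by (intro real_sqrt_le_mono mult_left_mono) auto
qed

lemma decays_cong:
  assumes "\<And>i j. j < N \<Longrightarrow> u i j = v i j" shows "decays N C u \<longleftrightarrow> decays N C v"
  using assms by (simp add: decays_def)

lemma l2_bounded_on_decays:
  assumes "\<And>t. t \<in> S \<Longrightarrow> decays N C (u t)" shows "l2_bounded_on N S u"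
  unfolding l2_bounded_on_def using decays_norm2D[OF assms] by blast

section \<open>Solutions given by explicit time derivatives\<close>

definition chain2 :: "('a \<Rightarrow> 'b) \<Rightarrow> ('a \<Rightarrow> 'b) \<Rightarrow> ('a \<Rightarrow> 'b) \<Rightarrow> nat \<Rightarrow> 'a \<Rightarrow> 'b" where
  "chain2 f f1 f2 l = (if l = 0 then f else if l = 1 then f1 else f2)"

lemma chain2_simps [simp]: "chain2 f f1 f2 0 = f" "chain2 f f1 f2 (Suc 0) = f1" "chain2 f f1 f2 (Suc (Suc l)) = f2"
  "chain2 f f1 f2 2 = f2"
  by (simp_all add: chain2_def)

lemma deriv_chain2:
  assumes "\<And>t. t \<in> S \<Longrightarrow> (f has_vector_derivative f1 t) (at t within S)"
    "\<And>t. t \<in> S \<Longrightarrow> (f1 has_vector_derivative f2 t) (at t within S)" "continuous_on S f2"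
  shows "deriv_chain S 2 (chain2 f f1 f2)"
  unfolding deriv_chain_def using assms by (auto simp: less_Suc_eq numeral_2_eq_2)

text \<open>Explicit derivatives \<open>u1\<close>, \<open>u2\<close> and decay with constants
  uniform on the time interval supply the smoothness and the square summability in the definition of
  a solution. The propagator and Duhamel's formula are recognized as solutions in this way.\<close>

lemma semidiscrete_solutionI:
  assumes te: "te > 0"
    and ch: "\<And>i j. j < N \<Longrightarrow> deriv_chain {0..te} 2 (chain2 (\<lambda>t. u t i j) (\<lambda>t. u1 t i j) (\<lambda>t. u2 t i j))"
    and u: "\<And>t. t \<in> {0..te} \<Longrightarrow> decays N C (u t)" and u1: "\<And>t. t \<in> {0..te} \<Longrightarrow> decays N C1 (u1 t)"
    and eq: "\<And>t i j. t \<in> {0..te} \<Longrightarrow> j < N \<Longrightarrow> u2 t i j = grid_op N A B (u t) i j + F t i j"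
  shows "semidiscrete_solution N A B te F u"
    and "\<And>t i j. t \<in> {0..te} \<Longrightarrow> j < N \<Longrightarrow> time_deriv {0..te} 1 u t i j = u1 t i j"
proof -
  note S = at_within_Icc_not_bot[OF te]
  have d: "nderiv {0..te} l (\<lambda>t. u t i j) t = chain2 (\<lambda>t. u t i j) (\<lambda>t. u1 t i j) (\<lambda>t. u2 t i j) l t"
    if "l \<le> 2" "t \<in> {0..te}" "j < N" for l t i j
    by (rule nderiv_chain[OF ch[OF that(3)] S]) (use that in auto)
  show td: "time_deriv {0..te} 1 u t i j = u1 t i j" if "t \<in> {0..te}" "j < N" for t i j
    using d[of 1 t j i] that by (simp add: time_deriv_def)
  have "decays N C1 (time_deriv {0..te} 1 u t)" if "t \<in> {0..te}" for t
    using u1[OF that] td[OF that] by (simp cong: decays_cong)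
  moreover have "time_deriv {0..te} 2 u t i j = grid_op N A B (u t) i j + F t i j" if "t \<in> {0..te}" "j < N" for t i j
    using d[of 2 t j i] that eq by (simp add: time_deriv_def)
  moreover have "C_on 2 {0..te} (\<lambda>t. u t i j)" if "j < N" for i j
    by (rule C_on_chain[OF ch[OF that] S]) auto
  ultimately show "semidiscrete_solution N A B te F u"
    unfolding semidiscrete_solution_def
    using l2_bounded_on_decays[of "{0..te}" N C u, OF u] l2_bounded_on_decays[of "{0..te}" N C1 "time_deriv {0..te} 1 u"]
    by (auto simp: grid_op_def)
qed

section \<open>Propagator and uniqueness\<close>

text \<open>Taylor coefficients at time 0 of the solution of w'' = L w with w(0) = 0 and w'(0) = v:
  zero for even index, L^m v for index 2 m + 1.\<close>

fun taylor :: "((nat \<Rightarrow> nat \<Rightarrow> real) \<Rightarrow> nat \<Rightarrow> nat \<Rightarrow> real) \<Rightarrow> (nat \<Rightarrow> nat \<Rightarrow> real) \<Rightarrow> nat \<Rightarrow> nat \<Rightarrow> nat \<Rightarrow> real" where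
  "taylor L v 0 = (\<lambda>i j. 0)"
| "taylor L v (Suc 0) = v"
| "taylor L v (Suc (Suc m)) = L (taylor L v m)"

text \<open>Formally the n-th time derivative of sinh(t sqrt L) / sqrt L applied to v.\<close>

definition propagator :: "((nat \<Rightarrow> nat \<Rightarrow> real) \<Rightarrow> nat \<Rightarrow> nat \<Rightarrow> real) \<Rightarrow> (nat \<Rightarrow> nat \<Rightarrow> real) \<Rightarrow> nat \<Rightarrow> real \<Rightarrow> nat \<Rightarrow> nat \<Rightarrow> real" where
  "propagator L v n t i j = egf (\<lambda>m. taylor L v (m + n) i j) t"

text \<open>Only every second step applies L, so R^m with R >= 1 is a generous bound; the plain
  power of m is the form that the estimates for \<open>egf\<close> take as input.\<close>

lemma taylor_decays:
  assumes R: "R \<ge> 1" "\<And>C v. C \<ge> 0 \<Longrightarrow> decays N C v \<Longrightarrow> decays N (R * C) (L v)"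
    and v: "decays N C v" "C \<ge> 0"
  shows "decays N (C * R ^ m) (taylor L v m)"
proof (induction m rule: induct_nat_012)
  case 0
  show ?case using v(2) by (simp add: decays_def)
next
  case 1
  have "C \<le> C * R" using R v by (simp add: mult_le_cancel_left1)
  then have "C * (1 / 2) ^ i \<le> C * R * (1 / 2) ^ i" for i by (intro mult_right_mono) auto
  then show ?case using v(1) unfolding decays_def by (auto intro: order_trans)
next
  case (ge2 m)
  have "decays N (R * (C * R ^ m)) (L (taylor L v m))" using R v ge2 by (intro R(2)) auto
  moreover have "R * (C * R ^ m) \<le> C * R ^ Suc (Suc m)"
  proof -
    have "R ^ Suc m \<le> R ^ Suc (Suc m)" using R(1) by (intro power_increasing) auto
    then have "C * R ^ Suc m \<le> C * R ^ Suc (Suc m)" by (rule mult_left_mono[OF _ v(2)])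
    then show ?thesis by (simp add: mult_ac)
  qed
  then have "R * (C * R ^ m) * (1 / 2) ^ i \<le> C * R ^ Suc (Suc m) * (1 / 2) ^ i" for i by (intro mult_right_mono) auto
  ultimately show ?case unfolding decays_def by (fastforce intro: order_trans)
qed

lemma propagator_facts:
  assumes R: "R \<ge> 1" "\<And>C v. C \<ge> 0 \<Longrightarrow> decays N C v \<Longrightarrow> decays N (R * C) (L v)"
    and v: "decays N C v" "C \<ge> 0"
  shows "decays N (C * R ^ n * exp (R * \<bar>t\<bar>)) (propagator L v n t)"
    and "j < N \<Longrightarrow> ((\<lambda>t. propagator L v n t i j) has_real_derivative propagator L v (Suc n) t i j) (at t)"
    and "propagator L v 0 0 i j = 0" "propagator L v (Suc 0) 0 i j = v i j"
proof -
  have b: "\<bar>taylor L v (m + n) i j\<bar> \<le> (C * R ^ n * (1 / 2) ^ i) * R ^ m" if "j < N" for m i j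
    using taylor_decays[OF R v, where m="m + n"] that by (simp add: decays_def power_add mult_ac)
  show "decays N (C * R ^ n * exp (R * \<bar>t\<bar>)) (propagator L v n t)"
    unfolding decays_def propagator_def using egf_summable(2)[OF b] by (simp add: mult_ac)
  show "((\<lambda>t. propagator L v n t i j) has_real_derivative propagator L v (Suc n) t i j) (at t)" if "j < N"
    using egf_has_derivative[OF b[OF that]] by (simp add: propagator_def[abs_def])
  show "propagator L v 0 0 i j = 0" "propagator L v (Suc 0) 0 i j = v i j"
    by (simp_all add: propagator_def egf_0)
qed

lemma propagator_grid_op:
  assumes A: "finite_difference_operator A"
    and R: "R \<ge> 1" "\<And>C v. C \<ge> 0 \<Longrightarrow> decays N C v \<Longrightarrow> decays N (R * C) (grid_op N A B v)"
    and v: "decays N C v" "C \<ge> 0" and j: "j < N"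
  shows "propagator (grid_op N A B) v (Suc (Suc n)) t i j = grid_op N A B (propagator (grid_op N A B) v n t) i j"
proof -
  let ?L = "grid_op N A B"
  have b: "\<bar>taylor ?L v (m + n) l q\<bar> \<le> (C * R ^ n * (1 / 2) ^ l) * R ^ m" if "q < N" for m l q
    using taylor_decays[OF R v, where m="m + n"] that by (simp add: decays_def power_add mult_ac)
  have "propagator ?L v (Suc (Suc n)) t i j =
      egf (\<lambda>m. \<Sum>p\<in>grid_stencil N A i. grid_coeff N A B i j p * taylor ?L v (m + n) (fst p) (snd p)) t"
    unfolding propagator_def by (simp add: grid_op_eq[OF A j])
  also have "\<dots> = (\<Sum>p\<in>grid_stencil N A i. grid_coeff N A B i j p * egf (\<lambda>m. taylor ?L v (m + n) (fst p) (snd p)) t)"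
    by (rule egf_linear, rule b) (auto simp: grid_stencil_def)
  finally show ?thesis by (simp add: grid_op_eq[OF A j] propagator_def)
qed

section \<open>Truncated norms and uniqueness of solutions\<close>

lemma norm2D_zero:
  assumes "summable (\<lambda>i. \<Sum>j<N. \<bar>v i j\<bar>\<^sup>2)" "norm2D N v \<le> 0" "mesh N > 0" "j < N"
  shows "v i j = 0"
proof -
  let ?f = "\<lambda>i. \<Sum>j<N. \<bar>v i j\<bar>\<^sup>2"
  have n: "0 \<le> ?f i" for i by (rule sum_nonneg) simp
  have "suminf ?f \<ge> 0" by (rule suminf_nonneg[OF assms(1) n])
  moreover have "(mesh N)\<^sup>2 * suminf ?f \<le> 0" using assms(2) by (simp add: norm2D_def)
  ultimately have "suminf ?f = 0" using assms(3) by (simp add: mult_le_0_iff)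
  then have "?f i = 0" using suminf_eq_zero_iff[OF assms(1) n] by blast
  then have "\<forall>j\<in>{..<N}. \<bar>v i j\<bar>\<^sup>2 = 0" by (subst (asm) sum_nonneg_eq_0_iff) auto
  then show ?thesis using assms(4) by auto
qed

text \<open>The l2 norm over the first n columns, without mesh weight. Bounds uniform in n stand in
  for bounds of the infinite sum and keep Minkowski's inequality within finite sums.\<close>

definition block_norm :: "nat \<Rightarrow> nat \<Rightarrow> (nat \<Rightarrow> nat \<Rightarrow> real) \<Rightarrow> real" where
  "block_norm N n v = L2_set (\<lambda>p. v (fst p) (snd p)) ({..<n} \<times> {..<N})"

lemma block_norm_eq: "block_norm N n v = sqrt (\<Sum>i<n. \<Sum>j<N. (v i j)\<^sup>2)"
  by (simp add: block_norm_def L2_set_def sum.cartesian_product split_beta)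

lemma block_norm_sum: "block_norm N n (\<lambda>i j. \<Sum>a\<in>I. v a i j) \<le> (\<Sum>a\<in>I. block_norm N n (v a))"
  unfolding block_norm_def by (rule L2_set_sum_le)

lemma block_norm_mult: "block_norm N n (\<lambda>i j. c * v i j) = \<bar>c\<bar> * block_norm N n v"
  by (simp add: block_norm_eq power_mult_distrib real_sqrt_mult flip: sum_distrib_left)

lemma norm2D_partial_sum:
  assumes "summable (\<lambda>i. \<Sum>j<N. \<bar>v i j\<bar>\<^sup>2)" "mesh N > 0"
  shows "block_norm N n v \<le> norm2D N v / mesh N"
proof -
  have "(\<Sum>i<n. \<Sum>j<N. \<bar>v i j\<bar>\<^sup>2) \<le> (\<Sum>i. \<Sum>j<N. \<bar>v i j\<bar>\<^sup>2)"
    by (rule sum_le_suminf[OF assms(1)]) (auto intro: sum_nonneg)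
  then have "block_norm N n v \<le> sqrt (\<Sum>i. \<Sum>j<N. \<bar>v i j\<bar>\<^sup>2)"
    unfolding block_norm_eq by (intro real_sqrt_le_mono) simp
  also have "\<dots> = norm2D N v / mesh N"
    using assms(2) by (simp add: norm2D_def real_sqrt_mult)
  finally show ?thesis .
qed

lemma grid_op_linear:
  assumes A: "finite_difference_operator A" and j: "j < N"
  shows "grid_op N A B (\<lambda>i j. u i j - v i j) i j = grid_op N A B u i j - grid_op N A B v i j"
  by (simp add: grid_op_eq[OF A j] right_diff_distrib sum_subtractf)

lemma deriv_chain_diff:
  assumes "deriv_chain S n D" "deriv_chain S n E"
  shows "deriv_chain S n (\<lambda>l t. D l t - E l t)"
  using assms unfolding deriv_chain_def by (auto intro!: has_vector_derivative_diff continuous_intros)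

lemma l2_bounded_on_diff:
  assumes u: "l2_bounded_on N S u" and v: "l2_bounded_on N S v"
  shows "l2_bounded_on N S (\<lambda>t i j. u t i j - v t i j)"
proof -
  obtain C where C: "\<And>t. t \<in> S \<Longrightarrow> summable (\<lambda>i. \<Sum>j<N. \<bar>u t i j\<bar>\<^sup>2)" "\<And>t. t \<in> S \<Longrightarrow> norm2D N (u t) \<le> C"
    using u by (auto simp: l2_bounded_on_def)
  obtain D where D: "\<And>t. t \<in> S \<Longrightarrow> summable (\<lambda>i. \<Sum>j<N. \<bar>v t i j\<bar>\<^sup>2)" "\<And>t. t \<in> S \<Longrightarrow> norm2D N (v t) \<le> D"
    using v by (auto simp: l2_bounded_on_def)
  have "summable (\<lambda>i. \<Sum>j<N. \<bar>u t i j - v t i j\<bar>\<^sup>2)" "norm2D N (\<lambda>i j. u t i j - v t i j) \<le> sqrt (2 * C\<^sup>2 + 2 * D\<^sup>2)"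
    if t: "t \<in> S" for t
  proof -
    let ?s = "\<lambda>i. 2 * (\<Sum>j<N. \<bar>u t i j\<bar>\<^sup>2) + 2 * (\<Sum>j<N. \<bar>v t i j\<bar>\<^sup>2)"
    have le: "(\<Sum>j<N. \<bar>u t i j - v t i j\<bar>\<^sup>2) \<le> ?s i" for i
    proof -
      have "\<bar>a - b\<bar>\<^sup>2 \<le> 2 * \<bar>a\<bar>\<^sup>2 + 2 * \<bar>b\<bar>\<^sup>2" for a b :: real
        using sum_squares_bound[of a "- b"] by (simp add: power2_diff)
      then have "(\<Sum>j<N. \<bar>u t i j - v t i j\<bar>\<^sup>2) \<le> (\<Sum>j<N. 2 * \<bar>u t i j\<bar>\<^sup>2 + 2 * \<bar>v t i j\<bar>\<^sup>2)" by (intro sum_mono)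
      then show ?thesis by (simp add: sum.distrib sum_distrib_left)
    qed
    have ss: "summable ?s" by (intro summable_add summable_mult C D t)
    show s: "summable (\<lambda>i. \<Sum>j<N. \<bar>u t i j - v t i j\<bar>\<^sup>2)"
      by (rule summable_comparison_test'[OF ss]) (use le in \<open>auto simp: sum_nonneg\<close>)
    have "(\<Sum>i. \<Sum>j<N. \<bar>u t i j - v t i j\<bar>\<^sup>2) \<le> suminf ?s" by (rule suminf_le[OF le s ss])
    also have "\<dots> = 2 * (\<Sum>i. \<Sum>j<N. \<bar>u t i j\<bar>\<^sup>2) + 2 * (\<Sum>i. \<Sum>j<N. \<bar>v t i j\<bar>\<^sup>2)"
      using C(1)[OF t] D(1)[OF t] by (simp add: suminf_add[symmetric] suminf_mult summable_mult)
    finally have 1: "(mesh N)\<^sup>2 * (\<Sum>i. \<Sum>j<N. \<bar>u t i j - v t i j\<bar>\<^sup>2) \<le>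
        2 * ((mesh N)\<^sup>2 * (\<Sum>i. \<Sum>j<N. \<bar>u t i j\<bar>\<^sup>2)) + 2 * ((mesh N)\<^sup>2 * (\<Sum>i. \<Sum>j<N. \<bar>v t i j\<bar>\<^sup>2))"
      by (metis (no_types, lifting) distrib_left mult.left_commute mult_left_mono zero_le_power2)
    have sq: "(mesh N)\<^sup>2 * (\<Sum>i. \<Sum>j<N. \<bar>w i j\<bar>\<^sup>2) = (norm2D N w)\<^sup>2" "0 \<le> norm2D N w"
      if "summable (\<lambda>i. \<Sum>j<N. \<bar>w i j\<bar>\<^sup>2)" for w
      using suminf_nonneg[OF that] by (simp_all add: norm2D_def sum_nonneg)
    have "(norm2D N (u t))\<^sup>2 \<le> C\<^sup>2" "(norm2D N (v t))\<^sup>2 \<le> D\<^sup>2"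
      using C D t sq(2) by (auto intro!: power_mono)
    then have "(mesh N)\<^sup>2 * (\<Sum>i. \<Sum>j<N. \<bar>u t i j - v t i j\<bar>\<^sup>2) \<le> 2 * C\<^sup>2 + 2 * D\<^sup>2"
      using 1 sq(1) C(1)[OF t] D(1)[OF t] by simp
    then show "norm2D N (\<lambda>i j. u t i j - v t i j) \<le> sqrt (2 * C\<^sup>2 + 2 * D\<^sup>2)"
      unfolding norm2D_def by (rule real_sqrt_le_mono)
  qed
  then show ?thesis unfolding l2_bounded_on_def by blast
qed

lemma l2_bounded_on_cong:
  assumes "\<And>t i j. t \<in> S \<Longrightarrow> j < N \<Longrightarrow> u t i j = v t i j" "l2_bounded_on N S u"
  shows "l2_bounded_on N S v"
proof -
  have "(\<Sum>j<N. \<bar>u t i j\<bar>\<^sup>2) = (\<Sum>j<N. \<bar>v t i j\<bar>\<^sup>2)" if "t \<in> S" for t i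
    using assms(1) that by (intro sum.cong) auto
  then show ?thesis using assms(2) by (simp add: l2_bounded_on_def norm2D_def)
qed

lemma semidiscrete_solution_diff:
  assumes te: "te > 0" and A: "finite_difference_operator A"
    and u: "semidiscrete_solution N A B te F u" and v: "semidiscrete_solution N A B te F v"
  shows "semidiscrete_solution N A B te (\<lambda>t i j. 0) (\<lambda>t i j. u t i j - v t i j)"
    and "\<And>t i j l. t \<in> {0..te} \<Longrightarrow> j < N \<Longrightarrow> l \<le> 2 \<Longrightarrow>
      time_deriv {0..te} l (\<lambda>t i j. u t i j - v t i j) t i j = time_deriv {0..te} l u t i j - time_deriv {0..te} l v t i j"
proof -
  note S = at_within_Icc_not_bot[OF te]
  let ?S = "{0..te}"
  have ch: "deriv_chain ?S 2 (\<lambda>l t. nderiv ?S l (\<lambda>t. u t i j) t - nderiv ?S l (\<lambda>t. v t i j) t)" if "j < N" for i j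
    using u v that unfolding semidiscrete_solution_def by (intro deriv_chain_diff chain_C_on) auto
  show d: "time_deriv ?S l (\<lambda>t i j. u t i j - v t i j) t i j = time_deriv ?S l u t i j - time_deriv ?S l v t i j"
    if "t \<in> ?S" "j < N" "l \<le> 2" for t i j l
    unfolding time_deriv_def by (rule nderiv_chain[OF ch[OF that(2)] S]) (use that in \<open>auto simp: nderiv_0\<close>)
  have "C_on 2 ?S (\<lambda>t. u t i j - v t i j)" if "j < N" for i j
    by (rule C_on_chain[OF ch[OF that] S]) (auto simp: nderiv_0)
  moreover have "l2_bounded_on N ?S (\<lambda>t i j. u t i j - v t i j)"
    using u v by (auto simp: semidiscrete_solution_def intro: l2_bounded_on_diff)
  moreover have "l2_bounded_on N ?S (time_deriv ?S 1 (\<lambda>t i j. u t i j - v t i j))"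
    by (rule l2_bounded_on_cong[OF d[symmetric] l2_bounded_on_diff]) (use u v in \<open>auto simp: semidiscrete_solution_def\<close>)
  moreover have "time_deriv ?S 2 (\<lambda>t i j. u t i j - v t i j) t i j = grid_op N A B (\<lambda>i j. u t i j - v t i j) i j"
    if t: "t \<in> ?S" and j: "j < N" for t i j
  proof -
    have "time_deriv ?S 2 u t i j = grid_op N A B (u t) i j + F t i j"
      "time_deriv ?S 2 v t i j = grid_op N A B (v t) i j + F t i j"
      using u v t j by (auto simp: semidiscrete_solution_def grid_op_def)
    then show ?thesis unfolding grid_op_linear[OF A j] using d[OF t j, of 2] by simp
  qed
  ultimately show "semidiscrete_solution N A B te (\<lambda>t i j. 0) (\<lambda>t i j. u t i j - v t i j)"
    unfolding semidiscrete_solution_def by (auto simp: grid_op_def)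
qed

text \<open>Stability at one mesh with its constant made explicit. The length \<open>te\<close>
  still ranges over all positive values, which is what yields growth bounds for all times.\<close>

definition stable_at :: "real \<Rightarrow> nat \<Rightarrow> (nat \<Rightarrow> nat \<Rightarrow> real) \<Rightarrow> real mat \<Rightarrow> real \<Rightarrow> bool" where
  "stable_at \<alpha> N A B C \<longleftrightarrow> (\<forall>te>0. \<forall>u. semidiscrete_solution N A B te (\<lambda>t i j. 0) u \<longrightarrow>
        (\<forall>t\<in>{0..te}. norm2D N (u t) \<le>
           C * exp (\<alpha> * t) * (norm2D N (u 0) + norm2D N (time_deriv {0..te} 1 u 0))))"

lemma norm2D_eq_0: "(\<And>i j. j < N \<Longrightarrow> v i j = 0) \<Longrightarrow> norm2D N v = 0"
  by (simp add: norm2D_def)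

text \<open>The difference solves the homogeneous problem with vanishing initial data, so the
  stability estimate bounds its norm by 0.\<close>

lemma semidiscrete_solution_unique:
  assumes te: "te > 0" and A: "finite_difference_operator A" and st: "stable_at \<alpha> N A B C" and N: "mesh N > 0"
    and u: "semidiscrete_solution N A B te F u" and v: "semidiscrete_solution N A B te F v"
    and 0: "\<And>i j. j < N \<Longrightarrow> u 0 i j = v 0 i j"
      "\<And>i j. j < N \<Longrightarrow> time_deriv {0..te} 1 u 0 i j = time_deriv {0..te} 1 v 0 i j"
    and t: "t \<in> {0..te}" and j: "j < N"
  shows "u t i j = v t i j"
proof -
  let ?d = "\<lambda>t i j. u t i j - v t i j"
  note D = semidiscrete_solution_diff[OF te A u v]
  have "norm2D N (?d 0) = 0" by (rule norm2D_eq_0) (simp add: 0)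
  moreover have "norm2D N (time_deriv {0..te} 1 ?d 0) = 0"
    by (rule norm2D_eq_0) (use D(2)[of 0] te 0 in auto)
  moreover have "norm2D N (?d t) \<le> C * exp (\<alpha> * t) * (norm2D N (?d 0) + norm2D N (time_deriv {0..te} 1 ?d 0))"
    using st te D(1) t unfolding stable_at_def by blast
  ultimately have "norm2D N (?d t) \<le> 0" by simp
  moreover have "summable (\<lambda>i. \<Sum>j<N. \<bar>?d t i j\<bar>\<^sup>2)"
    using D(1) t unfolding semidiscrete_solution_def l2_bounded_on_def by blast
  ultimately have "?d t i j = 0" by (intro norm2D_zero[OF _ _ N j, of "?d t"])
  then show ?thesis by simp
qed

section \<open>Duhamel's formula\<close>

definition unit_grid :: "nat \<Rightarrow> nat \<Rightarrow> nat \<Rightarrow> nat \<Rightarrow> real" where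
  "unit_grid l q i j = (if i = l \<and> j = q then 1 else 0)"

lemma unit_grid_decays: "decays N (2 ^ l) (unit_grid l q)"
  by (auto simp: decays_def unit_grid_def power_one_over)

lemma decays_sum:
  assumes "\<And>a. a \<in> I \<Longrightarrow> decays N (C a) (v a)"
  shows "decays N (\<Sum>a\<in>I. C a) (\<lambda>i j. \<Sum>a\<in>I. v a i j)"
  unfolding decays_def
proof (intro allI impI)
  fix i j assume j: "j < N"
  have "\<bar>\<Sum>a\<in>I. v a i j\<bar> \<le> (\<Sum>a\<in>I. C a * (1 / 2) ^ i)"
    by (rule order_trans[OF sum_abs], rule sum_mono) (use assms j in \<open>auto simp: decays_def\<close>)
  then show "\<bar>\<Sum>a\<in>I. v a i j\<bar> \<le> (\<Sum>a\<in>I. C a) * (1 / 2) ^ i" by (simp add: sum_distrib_right)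
qed

lemma exp_order_primitive:
  assumes f': "exp_order \<beta> f'" and \<beta>: "\<beta> > 0" and f0: "f 0 = 0"
    and d: "\<And>t. t \<ge> 0 \<Longrightarrow> (f has_vector_derivative f' t) (at t within {0..})"
  shows "exp_order \<beta> f"
proof -
  have "integral {0..t} f' = f t" if t: "t \<ge> 0" for t
  proof -
    have "(f' has_integral f t - f 0) {0..t}"
      by (rule fundamental_theorem_of_calculus[OF t], rule has_vector_derivative_within_subset[OF d]) auto
    then show ?thesis using f0 by (simp add: integral_unique)
  qed
  moreover have "exp_order \<beta> (\<lambda>t. integral {0..t} f')" by (rule exp_order_integral[OF f' \<beta>])
  moreover have "continuous_on {0..} f"
    unfolding continuous_on_eq_continuous_within by (auto intro!: has_vector_derivative_continuous[OF d])
  ultimately show ?thesis by (simp add: exp_order_def)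
qed

lemma integral_exp_diff_le:
  fixes c :: real
  assumes "c > 0" "t \<ge> 0"
  shows "integral {0..t} (\<lambda>s. exp (c * (t - s))) \<le> exp (c * t) / c"
proof -
  have "((\<lambda>s. exp (c * (t - s))) has_integral - exp (c * (t - t)) / c - (- exp (c * (t - 0)) / c)) {0..t}"
    using assms by (intro fundamental_theorem_of_calculus)
      (auto intro!: derivative_eq_intros simp flip: has_real_derivative_iff_has_vector_derivative)
  then show ?thesis using assms by (simp add: integral_unique)
qed

section \<open>Impulse responses and their superposition on one stable mesh\<close>

locale stable_grid =
  fixes N :: nat and A :: "nat \<Rightarrow> nat \<Rightarrow> real" and B :: "real mat" and \<alpha> C :: real
  assumes A: "finite_difference_operator A" and st: "stable_at \<alpha> N A B C" and mesh: "mesh N > 0"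
begin

text \<open>A column of the Green's function in time: the response to a unit initial velocity at the
  grid point (l, q), together with its n-th time derivative.\<close>

definition G :: "nat \<Rightarrow> nat \<Rightarrow> nat \<Rightarrow> real \<Rightarrow> nat \<Rightarrow> nat \<Rightarrow> real" where
  "G l q = propagator (grid_op N A B) (unit_grid l q)"

lemma G_decays: "\<exists>K\<ge>0. \<forall>t. \<bar>t\<bar> \<le> te \<longrightarrow> decays N K (G l q n t)"
proof -
  obtain R where R: "R \<ge> 1" "\<And>C v. C \<ge> 0 \<Longrightarrow> decays N C v \<Longrightarrow> decays N (R * C) (grid_op N A B v)"
    using grid_op_decays[OF A, of N B] by metis
  let ?K = "2 ^ l * R ^ n * exp (R * te)"
  have "decays N ?K (G l q n t)" if t: "\<bar>t\<bar> \<le> te" for t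
  proof -
    have "decays N (2 ^ l * R ^ n * exp (R * \<bar>t\<bar>)) (G l q n t)"
      unfolding G_def by (rule propagator_facts(1)[OF R unit_grid_decays]) auto
    moreover have "2 ^ l * R ^ n * exp (R * \<bar>t\<bar>) * (1 / 2) ^ i \<le> ?K * (1 / 2) ^ i" for i
      using R(1) t by (intro mult_right_mono mult_left_mono) auto
    ultimately show ?thesis unfolding decays_def by (meson order_trans)
  qed
  moreover have "?K \<ge> 0" using R(1) by simp
  ultimately show ?thesis by blast
qed

lemma G_deriv: "j < N \<Longrightarrow> ((\<lambda>t. G l q n t i j) has_real_derivative G l q (Suc n) t i j) (at t)"
  unfolding G_def using propagator_facts(2)[OF _ _ unit_grid_decays] grid_op_decays[OF A, of N B]
  by (metis zero_le_numeral zero_le_power)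

lemma G_init: "G l q 0 0 i j = 0" "G l q (Suc 0) 0 i j = unit_grid l q i j"
  by (simp_all add: G_def propagator_def egf_0)

lemma G_grid_op: "j < N \<Longrightarrow> G l q (Suc (Suc n)) t i j = grid_op N A B (G l q n t) i j"
  unfolding G_def using propagator_grid_op[OF A _ _ unit_grid_decays] grid_op_decays[OF A, of N B]
  by (metis zero_le_numeral zero_le_power)

lemma G_continuous: "j < N \<Longrightarrow> continuous_on S (\<lambda>t. G l q n t i j)"
  using G_deriv DERIV_isCont by (blast intro: continuous_at_imp_continuous_on)

lemma G_solution:
  assumes te: "te > 0"
  shows "semidiscrete_solution N A B te (\<lambda>t i j. 0) (G l q 0)"
    and "\<And>t i j. t \<in> {0..te} \<Longrightarrow> j < N \<Longrightarrow> time_deriv {0..te} 1 (G l q 0) t i j = G l q 1 t i j"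
proof -
  obtain K0 where K0: "\<forall>t. \<bar>t\<bar> \<le> te \<longrightarrow> decays N K0 (G l q 0 t)" using G_decays by blast
  obtain K1 where K1: "\<forall>t. \<bar>t\<bar> \<le> te \<longrightarrow> decays N K1 (G l q 1 t)" using G_decays by blast
  have ch: "deriv_chain {0..te} 2 (chain2 (\<lambda>t. G l q 0 t i j) (\<lambda>t. G l q 1 t i j) (\<lambda>t. G l q 2 t i j))"
    if j: "j < N" for i j
    by (rule deriv_chain2)
      (use G_deriv[OF j] G_continuous[OF j] in \<open>auto simp: has_real_derivative_iff_has_vector_derivative
        numeral_2_eq_2 intro: has_vector_derivative_at_within\<close>)
  have e: "G l q 2 t i j = grid_op N A B (G l q 0 t) i j + 0" if "j < N" for t i j
    using G_grid_op[OF that, of l q 0] by (simp add: numeral_2_eq_2)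
  show "semidiscrete_solution N A B te (\<lambda>t i j. 0) (G l q 0)"
    by (rule semidiscrete_solutionI(1)[where C=K0 and ?C1.0=K1, OF te ch _ _ e]) (use K0 K1 in auto)
  show "time_deriv {0..te} 1 (G l q 0) t i j = G l q 1 t i j" if "t \<in> {0..te}" "j < N" for t i j
    by (rule semidiscrete_solutionI(2)[where C=K0 and ?C1.0=K1, OF te ch _ _ e]) (use K0 K1 that in auto)
qed

text \<open>The power series alone gives a rate that deteriorates with the mesh. Stability, whose
  constants serve time intervals of every length, is applied on an interval around each t and
  replaces that rate by \<alpha>.\<close>

lemma G_growth:
  assumes \<beta>: "\<alpha> \<le> \<beta>"
  shows "\<exists>K\<ge>0. \<forall>t\<ge>0. \<forall>n. block_norm N n (G l q 0 t) \<le> K * exp (\<beta> * t)"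
proof -
  define K where "K = \<bar>C\<bar> * norm2D N (unit_grid l q) / mesh N"
  have n0: "norm2D N (unit_grid l q) \<ge> 0"
    unfolding norm2D_def using decays_norm2D(1)[OF unit_grid_decays]
    by (intro real_sqrt_ge_zero mult_nonneg_nonneg suminf_nonneg) (auto intro: sum_nonneg)
  have "block_norm N n (G l q 0 t) \<le> K * exp (\<beta> * t)" if t: "t \<ge> 0" for t n
  proof -
    \<comment> \<open>Any end time beyond t serves; the extra 1 keeps the interval nondegenerate for
      t = 0.\<close>
    define te where "te = t + 1"
    have te: "te > 0" "t \<in> {0..te}" using t by (auto simp: te_def)
    note S = G_solution[OF te(1), where l=l and q=q]
    have "norm2D N (G l q 0 0) = 0" by (rule norm2D_eq_0) (simp add: G_init)
    moreover have "norm2D N (time_deriv {0..te} 1 (G l q 0) 0) = norm2D N (unit_grid l q)"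
    proof -
      have "(\<Sum>j<N. \<bar>time_deriv {0..te} 1 (G l q 0) 0 i j\<bar>\<^sup>2) = (\<Sum>j<N. \<bar>unit_grid l q i j\<bar>\<^sup>2)" for i
        by (rule sum.cong) (use S(2)[of 0] te t in \<open>auto simp: G_init\<close>)
      then show ?thesis by (simp add: norm2D_def)
    qed
    ultimately have "norm2D N (G l q 0 t) \<le> C * exp (\<alpha> * t) * norm2D N (unit_grid l q)"
      using st te S(1) unfolding stable_at_def by fastforce
    also have "\<dots> \<le> \<bar>C\<bar> * exp (\<beta> * t) * norm2D N (unit_grid l q)"
      using t \<beta> n0 by (intro mult_right_mono mult_mono) (auto intro: mult_right_mono)
    finally have b: "norm2D N (G l q 0 t) \<le> \<bar>C\<bar> * exp (\<beta> * t) * norm2D N (unit_grid l q)" .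
    have "summable (\<lambda>i. \<Sum>j<N. \<bar>G l q 0 t i j\<bar>\<^sup>2)"
      using S(1) te(2) unfolding semidiscrete_solution_def l2_bounded_on_def by blast
    then have "block_norm N n (G l q 0 t) \<le> norm2D N (G l q 0 t) / mesh N"
      by (rule norm2D_partial_sum[OF _ mesh])
    also have "\<dots> \<le> \<bar>C\<bar> * exp (\<beta> * t) * norm2D N (unit_grid l q) / mesh N"
      using b mesh by (intro divide_right_mono) auto
    finally show ?thesis by (simp add: K_def mult_ac)
  qed
  moreover have "K \<ge> 0" using n0 mesh by (simp add: K_def)
  ultimately show ?thesis by blast
qed

text \<open>The forcing lives on the columns up to k, so it is a finite superposition of impulses
  and the solution is a finite sum of scalar convolutions with the responses \<open>G\<close>. The
  index n differentiates the kernel only.\<close>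

definition duhamel :: "nat \<Rightarrow> (nat \<Rightarrow> nat \<Rightarrow> real \<Rightarrow> real) \<Rightarrow> nat \<Rightarrow> real \<Rightarrow> nat \<Rightarrow> nat \<Rightarrow> real" where
  "duhamel k F n t i j =
     (\<Sum>(l, q)\<in>{..k} \<times> {..<N}. integral {0..t} (\<lambda>s. F l q s * G l q n (t - s) i j))"

context
  fixes k :: nat and F :: "nat \<Rightarrow> nat \<Rightarrow> real \<Rightarrow> real"
  assumes F: "\<And>l q. l \<le> k \<Longrightarrow> q < N \<Longrightarrow> continuous_on {0..} (F l q)"
begin

lemma duhamel_integrable:
  assumes "l \<le> k" "q < N" "j < N"
  shows "(\<lambda>s. F l q s * G l q n (t - s) i j) integrable_on {0..t}"
  by (intro integrable_continuous_real continuous_intros continuous_on_subset[OF F]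
      continuous_on_compose2[OF G_continuous[of j UNIV]]) (use assms in auto)

text \<open>Differentiating the upper limit leaves the kernel at time 0. It vanishes for n = 0 and
  is the unit impulse for n = 1, so the second derivative reproduces the forcing.\<close>

lemma duhamel_deriv:
  assumes j: "j < N" and t: "t \<ge> 0"
  shows "((\<lambda>t. duhamel k F n t i j) has_vector_derivative
     (\<Sum>(l, q)\<in>{..k} \<times> {..<N}. F l q t * G l q n 0 i j) + duhamel k F (Suc n) t i j) (at t within {0..})"
proof -
  have "((\<lambda>t. \<Sum>p\<in>{..k} \<times> {..<N}. integral {0..t} (\<lambda>s. F (fst p) (snd p) s * G (fst p) (snd p) n (t - s) i j)) has_vector_derivative
     (\<Sum>p\<in>{..k} \<times> {..<N}. F (fst p) (snd p) t * G (fst p) (snd p) n 0 i j +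
       integral {0..t} (\<lambda>s. F (fst p) (snd p) s * G (fst p) (snd p) (Suc n) (t - s) i j))) (at t within {0..})"
    by (rule has_vector_derivative_sum, rule convolution_has_vector_derivative[OF F G_deriv[OF j] G_continuous[OF j] t]) auto
  then show ?thesis by (simp add: duhamel_def split_beta sum.distrib)
qed

lemma duhamel_deriv0:
  assumes "j < N" "t \<ge> 0"
  shows "((\<lambda>t. duhamel k F 0 t i j) has_vector_derivative duhamel k F 1 t i j) (at t within {0..})"
  using duhamel_deriv[OF assms, of 0 i] by (simp add: G_init split_beta)

lemma forcing_sum:
  assumes "j < N"
  shows "(\<Sum>(l, q)\<in>{..k} \<times> {..<N}. F l q t * G l q 1 0 i j) = column_forcing k (\<lambda>l. F l j t) i"
proof -
  have "(\<Sum>(l, q)\<in>{..k} \<times> {..<N}. F l q t * G l q 1 0 i j) = (\<Sum>l\<le>k. \<Sum>q<N. F l q t * unit_grid l q i j)"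
    by (simp add: sum.cartesian_product G_init)
  also have "\<dots> = (\<Sum>l\<le>k. \<Sum>q<N. if q = j then if l = i then F i j t else 0 else 0)"
    by (intro sum.cong) (auto simp: unit_grid_def)
  also have "\<dots> = column_forcing k (\<lambda>l. F l j t) i" using assms by (simp add: column_forcing_def)
  finally show ?thesis .
qed

lemma duhamel_grid_op:
  assumes j: "j < N"
  shows "duhamel k F (Suc (Suc n)) t i j = grid_op N A B (duhamel k F n t) i j"
proof -
  let ?I = "{..k} \<times> {..<N}" and ?S = "grid_stencil N A i" and ?c = "grid_coeff N A B i j"
  have int: "integral {0..t} (\<lambda>s. F l q s * G l q (Suc (Suc n)) (t - s) i j) =
       (\<Sum>p\<in>?S. ?c p * integral {0..t} (\<lambda>s. F l q s * G l q n (t - s) (fst p) (snd p)))"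
    if l: "l \<le> k" "q < N" for l q
  proof -
    have "integral {0..t} (\<lambda>s. F l q s * G l q (Suc (Suc n)) (t - s) i j) =
       integral {0..t} (\<lambda>s. \<Sum>p\<in>?S. ?c p * (F l q s * G l q n (t - s) (fst p) (snd p)))"
      by (simp add: G_grid_op[OF j] grid_op_eq[OF A j] sum_distrib_left mult_ac)
    also have "\<dots> = (\<Sum>p\<in>?S. integral {0..t} (\<lambda>s. ?c p * (F l q s * G l q n (t - s) (fst p) (snd p))))"
      using l by (intro Henstock_Kurzweil_Integration.integral_sum finite_grid_stencil A integrable_on_mult_right duhamel_integrable)
        (auto simp: grid_stencil_def)
    finally show ?thesis by simp
  qed
  have "duhamel k F (Suc (Suc n)) t i j =
     (\<Sum>(l, q)\<in>?I. \<Sum>p\<in>?S. ?c p * integral {0..t} (\<lambda>s. F l q s * G l q n (t - s) (fst p) (snd p)))"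
    unfolding duhamel_def split_beta by (intro sum.cong refl int) auto
  also have "\<dots> = (\<Sum>p\<in>?S. ?c p * duhamel k F n t (fst p) (snd p))"
    unfolding duhamel_def sum_distrib_left split_beta by (rule sum.swap)
  finally show ?thesis by (simp add: grid_op_eq[OF A j])
qed

text \<open>On bounded times the geometric decay of the kernels is uniform and survives the
  integration; this supplies the square summability that a solution must have.\<close>

lemma duhamel_decays: "\<exists>K. \<forall>t\<in>{0..te}. decays N K (duhamel k F n t)"
proof -
  have "\<exists>K. \<forall>t\<in>{0..te}. decays N K (\<lambda>i j. integral {0..t} (\<lambda>s. F l q s * G l q n (t - s) i j))"
    if lq: "l \<le> k" "q < N" for l q
  proof (cases "te \<ge> 0")
    case True
    have "bounded (F l q ` {0..te})"
      by (intro compact_imp_bounded compact_continuous_image continuous_on_subset[OF F]) (use lq in auto)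
    from this[unfolded bounded_iff] obtain M where "\<forall>x\<in>F l q ` {0..te}. norm x \<le> M" ..
    then have M: "\<bar>F l q s\<bar> \<le> M" if "s \<in> {0..te}" for s using that by simp
    have M0: "M \<ge> 0" using M[of 0] True by auto
    obtain K where K: "K \<ge> 0" "\<And>t. \<bar>t\<bar> \<le> te \<Longrightarrow> decays N K (G l q n t)" using G_decays by blast
    have "decays N (te * (M * K)) (\<lambda>i j. integral {0..t} (\<lambda>s. F l q s * G l q n (t - s) i j))" if t: "t \<in> {0..te}" for t
      unfolding decays_def
    proof (intro allI impI)
      fix i j assume j: "j < N"
      have "norm (integral {0..t} (\<lambda>s. F l q s * G l q n (t - s) i j)) \<le> integral {0..t} (\<lambda>s. M * (K * (1 / 2) ^ i))"
      proof (rule integral_norm_bound_integral[OF duhamel_integrable[OF lq j]])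
        fix s assume s: "s \<in> {0..t}"
        have "\<bar>F l q s\<bar> * \<bar>G l q n (t - s) i j\<bar> \<le> M * (K * (1 / 2) ^ i)"
          using M[of s] K(2)[of "t - s"] M0 s t j by (intro mult_mono) (auto simp: decays_def)
        then show "norm (F l q s * G l q n (t - s) i j) \<le> M * (K * (1 / 2) ^ i)" by (simp add: abs_mult)
      qed auto
      also have "\<dots> = t * (M * (K * (1 / 2) ^ i))" using t by simp
      also have "\<dots> \<le> te * (M * (K * (1 / 2) ^ i))" using t M0 K(1) by (intro mult_right_mono) auto
      finally show "\<bar>integral {0..t} (\<lambda>s. F l q s * G l q n (t - s) i j)\<bar> \<le> te * (M * K) * (1 / 2) ^ i"
        by (simp add: mult_ac)
    qed
    then show ?thesis by blast
  qed auto
  then have "\<forall>p\<in>{..k} \<times> {..<N}. \<exists>K. \<forall>t\<in>{0..te}. decays N K (\<lambda>i j. integral {0..t} (\<lambda>s. F (fst p) (snd p) s * G (fst p) (snd p) n (t - s) i j))"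
    by auto
  then obtain K where K: "\<forall>p\<in>{..k} \<times> {..<N}. \<forall>t\<in>{0..te}. decays N (K p) (\<lambda>i j. integral {0..t} (\<lambda>s. F (fst p) (snd p) s * G (fst p) (snd p) n (t - s) i j))"
    by (rule bchoice[THEN exE])
  have "decays N (\<Sum>p\<in>{..k} \<times> {..<N}. K p) (duhamel k F n t)" if t: "t \<in> {0..te}" for t
    unfolding duhamel_def split_beta by (rule decays_sum) (use K t in auto)
  then show ?thesis by blast
qed

text \<open>The second time derivative, expressed through the equation so that its growth is
  controlled by that of the solution and of the forcing.\<close>

definition duhamel2 :: "real \<Rightarrow> nat \<Rightarrow> nat \<Rightarrow> real" where
  "duhamel2 t i j = grid_op N A B (duhamel k F 0 t) i j + column_forcing k (\<lambda>l. F l j t) i"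

lemma duhamel_deriv1:
  assumes "j < N" "t \<ge> 0"
  shows "((\<lambda>t. duhamel k F 1 t i j) has_vector_derivative duhamel2 t i j) (at t within {0..})"
  using duhamel_deriv[OF assms, of 1 i] forcing_sum[OF assms(1)] duhamel_grid_op[OF assms(1), of 0]
  by (simp add: duhamel2_def add.commute)

lemma duhamel_0: "duhamel k F n 0 i j = 0"
  by (simp add: duhamel_def split_beta)

lemma duhamel_continuous: "j < N \<Longrightarrow> continuous_on {0..} (\<lambda>t. duhamel k F n t i j)"
  unfolding continuous_on_eq_continuous_within using has_vector_derivative_continuous[OF duhamel_deriv] by auto

lemma column_forcing_continuous:
  assumes "j < N" shows "continuous_on {0..} (\<lambda>t. column_forcing k (\<lambda>l. F l j t) i)"
  using F[of i j] assms by (cases "i \<le> k") (auto simp: column_forcing_def)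

lemma duhamel2_continuous:
  assumes j: "j < N" shows "continuous_on {0..} (\<lambda>t. duhamel2 t i j)"
  unfolding duhamel2_def grid_op_eq[OF A j]
  by (intro continuous_intros duhamel_continuous column_forcing_continuous j) (auto simp: grid_stencil_def)

lemma duhamel_solution:
  assumes te: "te > 0"
  shows "semidiscrete_solution N A B te (\<lambda>t i j. column_forcing k (\<lambda>l. F l j t) i) (duhamel k F 0)"
    and "\<And>t i j. t \<in> {0..te} \<Longrightarrow> j < N \<Longrightarrow> time_deriv {0..te} 1 (duhamel k F 0) t i j = duhamel k F 1 t i j"
proof -
  obtain K0 where K0: "\<forall>t\<in>{0..te}. decays N K0 (duhamel k F 0 t)" using duhamel_decays by blast
  obtain K1 where K1: "\<forall>t\<in>{0..te}. decays N K1 (duhamel k F 1 t)" using duhamel_decays by blast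
  have ch: "deriv_chain {0..te} 2 (chain2 (\<lambda>t. duhamel k F 0 t i j) (\<lambda>t. duhamel k F 1 t i j) (\<lambda>t. duhamel2 t i j))"
    if j: "j < N" for i j
    by (rule deriv_chain2; (rule has_vector_derivative_within_subset[OF duhamel_deriv0[OF j]]
          has_vector_derivative_within_subset[OF duhamel_deriv1[OF j]] continuous_on_subset[OF duhamel2_continuous[OF j]])?) auto
  have e: "duhamel2 t i j = grid_op N A B (duhamel k F 0 t) i j + column_forcing k (\<lambda>l. F l j t) i" for t i j
    by (simp add: duhamel2_def)
  show "semidiscrete_solution N A B te (\<lambda>t i j. column_forcing k (\<lambda>l. F l j t) i) (duhamel k F 0)"
    by (rule semidiscrete_solutionI(1)[where C=K0 and ?C1.0=K1, OF te ch _ _ e]) (use K0 K1 in auto)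
  show "time_deriv {0..te} 1 (duhamel k F 0) t i j = duhamel k F 1 t i j" if "t \<in> {0..te}" "j < N" for t i j
    by (rule semidiscrete_solutionI(2)[where C=K0 and ?C1.0=K1, OF te ch _ _ e]) (use K0 K1 that in auto)
qed

text \<open>The data grow strictly slower than the bound for the responses: the convolution of
  exp(\<gamma> t) with exp(\<beta> t) is then at most exp(\<beta> t) / (\<beta> - \<gamma>).
  Minkowski's integral inequality makes this uniform in the number of columns.\<close>

lemma duhamel_growth:
  assumes F': "\<And>l q. l \<le> k \<Longrightarrow> q < N \<Longrightarrow> exp_order \<gamma> (F l q)" and \<beta>: "\<gamma> < \<beta>" "\<alpha> \<le> \<beta>"
  shows "\<exists>K\<ge>0. \<forall>t\<ge>0. \<forall>n. block_norm N n (duhamel k F 0 t) \<le> K * exp (\<beta> * t)"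
proof -
  have single: "\<exists>K\<ge>0. \<forall>t\<ge>0. \<forall>n. block_norm N n (\<lambda>i j. integral {0..t} (\<lambda>s. F l q s * G l q 0 (t - s) i j)) \<le> K * exp (\<beta> * t)"
    if lq: "l \<le> k" "q < N" for l q
  proof -
    obtain M where M: "M \<ge> 0" "\<And>t. t \<ge> 0 \<Longrightarrow> \<bar>F l q t\<bar> \<le> M * exp (\<gamma> * t)" using F'[OF lq] by (rule exp_orderE) blast
    obtain K where K: "K \<ge> 0" "\<And>t n. t \<ge> 0 \<Longrightarrow> block_norm N n (G l q 0 t) \<le> K * exp (\<beta> * t)"
      using G_growth[OF \<beta>(2)] by blast
    have "block_norm N n (\<lambda>i j. integral {0..t} (\<lambda>s. F l q s * G l q 0 (t - s) i j))
        \<le> M * K / (\<beta> - \<gamma>) * exp (\<beta> * t)" if t: "t \<ge> 0" for t n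
    proof -
      let ?n = "\<lambda>s. M * K * exp (\<gamma> * t) * exp ((\<beta> - \<gamma>) * (t - s))"
      have "block_norm N n (\<lambda>i j. integral {0..t} (\<lambda>s. F l q s * G l q 0 (t - s) i j)) \<le> integral {0..t} ?n"
        unfolding block_norm_def
      proof (rule L2_set_integral_le)
        show "?n integrable_on {0..t}" by (intro integrable_continuous_real continuous_intros)
        fix s assume s: "s \<in> {0..t}"
        have "block_norm N n (\<lambda>i j. F l q s * G l q 0 (t - s) i j) \<le> (M * exp (\<gamma> * s)) * (K * exp (\<beta> * (t - s)))"
          unfolding block_norm_mult using M K s by (intro mult_mono) (auto simp: block_norm_def)
        also have "\<dots> = ?n s" by (simp add: algebra_simps mult_exp_exp)
        finally show "L2_set (\<lambda>p. F l q s * G l q 0 (t - s) (fst p) (snd p)) ({..<n} \<times> {..<N}) \<le> ?n s"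
          by (simp add: block_norm_def)
      qed (use lq in \<open>auto intro: duhamel_integrable\<close>)
      also have "integral {0..t} ?n = M * K * exp (\<gamma> * t) * integral {0..t} (\<lambda>s. exp ((\<beta> - \<gamma>) * (t - s)))" by simp
      also have "integral {0..t} (\<lambda>s. exp ((\<beta> - \<gamma>) * (t - s))) \<le> exp ((\<beta> - \<gamma>) * t) / (\<beta> - \<gamma>)"
        by (rule integral_exp_diff_le) (use \<beta> t in auto)
      finally have "block_norm N n (\<lambda>i j. integral {0..t} (\<lambda>s. F l q s * G l q 0 (t - s) i j))
          \<le> M * K * exp (\<gamma> * t) * (exp ((\<beta> - \<gamma>) * t) / (\<beta> - \<gamma>))"
        using M K by (simp add: mult_left_mono)
      also have "\<dots> = M * K / (\<beta> - \<gamma>) * exp (\<beta> * t)" by (simp add: mult_exp_exp algebra_simps)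
      finally show ?thesis .
    qed
    moreover have "M * K / (\<beta> - \<gamma>) \<ge> 0" using M K \<beta> by simp
    ultimately show ?thesis by blast
  qed
  define W where "W = (\<lambda>a t i j. integral {0..t} (\<lambda>s. F (fst a) (snd a) s * G (fst a) (snd a) 0 (t - s) i j))"
  have "\<forall>a\<in>{..k} \<times> {..<N}. \<exists>K. K \<ge> 0 \<and> (\<forall>t\<ge>0. \<forall>n. block_norm N n (W a t) \<le> K * exp (\<beta> * t))"
    using single by (auto simp: W_def)
  from bchoice[OF this] obtain K
    where K: "\<forall>a\<in>{..k} \<times> {..<N}. K a \<ge> 0 \<and> (\<forall>t\<ge>0. \<forall>n. block_norm N n (W a t) \<le> K a * exp (\<beta> * t))" ..
  have "block_norm N n (duhamel k F 0 t) \<le> (\<Sum>a\<in>{..k} \<times> {..<N}. K a) * exp (\<beta> * t)" if "t \<ge> 0" for t n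
  proof -
    have "duhamel k F 0 t = (\<lambda>i j. \<Sum>a\<in>{..k} \<times> {..<N}. W a t i j)"
      by (simp add: duhamel_def W_def split_beta fun_eq_iff)
    then have "block_norm N n (duhamel k F 0 t) \<le> (\<Sum>a\<in>{..k} \<times> {..<N}. block_norm N n (W a t))"
      by (simp add: block_norm_sum)
    also have "\<dots> \<le> (\<Sum>a\<in>{..k} \<times> {..<N}. K a * exp (\<beta> * t))" by (rule sum_mono) (use K that in blast)
    finally show ?thesis by (simp add: sum_distrib_right)
  qed
  moreover have "(\<Sum>a\<in>{..k} \<times> {..<N}. K a) \<ge> 0" using K by (intro sum_nonneg) blast
  ultimately show ?thesis by blast
qed

text \<open>Stability controls the solution itself. The second derivative is then controlled by the
  equation, a finite stencil plus forcing, and the first derivative as the primitive of the second,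
  since it starts at 0.\<close>

lemma duhamel_exp_order:
  assumes F': "\<And>l q. l \<le> k \<Longrightarrow> q < N \<Longrightarrow> exp_order \<gamma> (F l q)" and \<beta>: "\<gamma> < \<beta>" "\<alpha> \<le> \<beta>" "\<beta> > 0" and j: "j < N"
  shows "exp_order \<beta> (\<lambda>t. duhamel k F 0 t i j)" "exp_order \<beta> (\<lambda>t. duhamel k F 1 t i j)" "exp_order \<beta> (\<lambda>t. duhamel2 t i j)"
proof -
  obtain K where K: "\<And>t n. t \<ge> 0 \<Longrightarrow> block_norm N n (duhamel k F 0 t) \<le> K * exp (\<beta> * t)"
    using duhamel_growth[OF F' \<beta>(1,2)] by blast
  have o: "exp_order \<beta> (\<lambda>t. duhamel k F 0 t i j)" if j: "j < N" for i j
  proof (rule exp_orderI[OF duhamel_continuous[OF j]])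
    fix t :: real assume t: "t \<ge> 0"
    have "L2_set (\<lambda>p. \<bar>duhamel k F 0 t (fst p) (snd p)\<bar>) ({..<Suc i} \<times> {..<N}) = block_norm N (Suc i) (duhamel k F 0 t)"
      by (simp add: block_norm_def L2_set_def)
    then have "\<bar>duhamel k F 0 t i j\<bar> \<le> block_norm N (Suc i) (duhamel k F 0 t)"
      using member_le_L2_set[of "{..<Suc i} \<times> {..<N}" "(i, j)" "\<lambda>p. \<bar>duhamel k F 0 t (fst p) (snd p)\<bar>"] j by simp
    also have "\<dots> \<le> K * exp (\<beta> * t)" by (rule K[OF t])
    finally show "\<bar>duhamel k F 0 t i j\<bar> \<le> K * exp (\<beta> * t)" .
  qed
  then show "exp_order \<beta> (\<lambda>t. duhamel k F 0 t i j)" using j .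
  have "exp_order \<beta> (\<lambda>t. column_forcing k (\<lambda>l. F l j t) i)"
    using exp_order_mono[OF F'[of i j]] \<beta> j by (cases "i \<le> k") (auto simp: column_forcing_def exp_order_0)
  then show o2: "exp_order \<beta> (\<lambda>t. duhamel2 t i j)"
    unfolding duhamel2_def grid_op_eq[OF A j]
    by (intro exp_order_add exp_order_sum exp_order_mult o) (auto simp: grid_stencil_def)
  show "exp_order \<beta> (\<lambda>t. duhamel k F 1 t i j)"
    by (rule exp_order_primitive[OF o2 \<beta>(3) duhamel_0 duhamel_deriv1[OF j]])
qed

text \<open>Both initial values vanish, so two time derivatives become s^2. Each row of the equation
  is a finite sum, through which the transform passes.\<close>

lemma laplace_duhamel:
  assumes F': "\<And>l q. l \<le> k \<Longrightarrow> q < N \<Longrightarrow> exp_order \<gamma> (F l q)" and \<beta>: "\<gamma> < \<beta>" "\<alpha> \<le> \<beta>" "\<beta> > 0" and j: "j < N"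
    and s: "\<beta> < Re s"
  shows "s\<^sup>2 * laplace (\<lambda>t. duhamel k F 0 t i j) s =
     of_real (1 / (mesh N)\<^sup>2) * apply_x A (\<lambda>l. laplace (\<lambda>t. duhamel k F 0 t l j) s) i +
     of_real (1 / (mesh N)\<^sup>2) * (\<Sum>q<N. of_real (B $$ (j, q)) * laplace (\<lambda>t. duhamel k F 0 t i q) s) +
     column_forcing k (\<lambda>l. laplace (F l j) s) i"
proof -
  note o = duhamel_exp_order[OF F' \<beta>]
  have oF: "exp_order \<beta> (\<lambda>t. column_forcing k (\<lambda>l. F l j t) i)"
    using exp_order_mono[OF F'[of i j]] \<beta> j by (cases "i \<le> k") (auto simp: column_forcing_def exp_order_0)
  have "laplace (\<lambda>t. duhamel k F 1 t i j) s = s * laplace (\<lambda>t. duhamel k F 0 t i j) s"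
    by (rule laplace_deriv[OF o(1)[OF _ _ j] o(2)[OF _ _ j] s duhamel_deriv0[OF j] duhamel_0])
  moreover have "laplace (\<lambda>t. duhamel2 t i j) s = s * laplace (\<lambda>t. duhamel k F 1 t i j) s"
    by (rule laplace_deriv[OF o(2)[OF _ _ j] o(3)[OF _ _ j] s duhamel_deriv1[OF j] duhamel_0])
  ultimately have "s\<^sup>2 * laplace (\<lambda>t. duhamel k F 0 t i j) s = laplace (\<lambda>t. duhamel2 t i j) s"
    by (simp add: power2_eq_square mult.assoc)
  also have "\<dots> = laplace (\<lambda>t. (1 / (mesh N)\<^sup>2) * (\<Sum>l | A i l \<noteq> 0. A i l * duhamel k F 0 t l j) +
      (1 / (mesh N)\<^sup>2) * (\<Sum>q<N. B $$ (j, q) * duhamel k F 0 t i q) + column_forcing k (\<lambda>l. F l j t) i) s"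
    by (simp add: duhamel2_def grid_op_def kron_apply_id_right[OF j] kron_apply_id_left)
  also have "\<dots> = laplace (\<lambda>t. (1 / (mesh N)\<^sup>2) * (\<Sum>l | A i l \<noteq> 0. A i l * duhamel k F 0 t l j)) s +
      laplace (\<lambda>t. (1 / (mesh N)\<^sup>2) * (\<Sum>q<N. B $$ (j, q) * duhamel k F 0 t i q)) s +
      laplace (\<lambda>t. column_forcing k (\<lambda>l. F l j t) i) s"
    using j by (subst laplace_add[OF _ _ s] laplace_add[OF _ _ s] | intro exp_order_add exp_order_mult exp_order_sum o oF | simp)+
  also have "laplace (\<lambda>t. (1 / (mesh N)\<^sup>2) * (\<Sum>l | A i l \<noteq> 0. A i l * duhamel k F 0 t l j)) s =
      of_real (1 / (mesh N)\<^sup>2) * apply_x A (\<lambda>l. laplace (\<lambda>t. duhamel k F 0 t l j) s) i"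
    unfolding laplace_mult apply_x_def
    by (subst laplace_sum[OF _ s], rule exp_order_mult[OF o(1)]) (auto simp: laplace_mult j)
  also have "laplace (\<lambda>t. (1 / (mesh N)\<^sup>2) * (\<Sum>q<N. B $$ (j, q) * duhamel k F 0 t i q)) s =
      of_real (1 / (mesh N)\<^sup>2) * (\<Sum>q<N. of_real (B $$ (j, q)) * laplace (\<lambda>t. duhamel k F 0 t i q) s)"
    unfolding laplace_mult
    by (subst laplace_sum[OF _ s], rule exp_order_mult[OF o(1)]) (auto simp: laplace_mult)
  also have "laplace (\<lambda>t. column_forcing k (\<lambda>l. F l j t) i) s = column_forcing k (\<lambda>l. laplace (F l j) s) i"
    by (cases "i \<le> k") (auto simp: column_forcing_def laplace_0)
  finally show ?thesis .
qed

text \<open>The scalar estimate admits square-summable solutions only. Minkowski's integral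
  inequality moves the l2 norm in x under the time integral, where exp(-Re s t) damps the growth
  bound; the result is the same for every number of columns.\<close>

lemma laplace_duhamel_summable:
  assumes F': "\<And>l q. l \<le> k \<Longrightarrow> q < N \<Longrightarrow> exp_order \<gamma> (F l q)" and \<beta>: "\<gamma> < \<beta>" "\<alpha> \<le> \<beta>" "\<beta> > 0"
    and s: "\<beta> < Re s" and j: "j < N"
  shows "summable (\<lambda>i. (cmod (laplace (\<lambda>t. duhamel k F 0 t i j) s))\<^sup>2)"
proof -
  let ?\<eta> = "Re s"
  obtain K where K: "K \<ge> 0" "\<And>t n. t \<ge> 0 \<Longrightarrow> block_norm N n (duhamel k F 0 t) \<le> K * exp (\<beta> * t)"
    using duhamel_growth[OF F' \<beta>(1,2)] by blast
  let ?f = "\<lambda>i t. exp (- ?\<eta> * t) * \<bar>duhamel k F 0 t i j\<bar>"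
  let ?n = "\<lambda>t. K * exp (- (?\<eta> - \<beta>) * t)"
  have o: "exp_order \<beta> (\<lambda>t. duhamel k F 0 t i j)" for i
    by (rule duhamel_exp_order(1)[OF F' \<beta> j])
  note ai = laplace_absolutely_integrable[OF o s]
  have fi: "?f i integrable_on {0..}" for i
  proof -
    have "(\<lambda>t. norm (exp (- s * of_real t) * complex_of_real (duhamel k F 0 t i j))) integrable_on {0..}"
      using ai[of i] by (simp add: absolutely_integrable_on_def)
    then show ?thesis by (simp add: norm_mult)
  qed
  have ni: "?n integrable_on {0..}" using integrable_on_exp_minus_to_infinity[of "?\<eta> - \<beta>" 0] s
    by (intro integrable_on_mult_right) auto
  have le: "cmod (laplace (\<lambda>t. duhamel k F 0 t i j) s) \<le> integral {0..} (?f i)" for i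
    unfolding laplace_def
    by (rule integral_norm_bound_integral[OF _ fi]) (use laplace_integrable[OF o s] in \<open>auto simp: norm_mult\<close>)
  have "L2_set (\<lambda>i. integral {0..} (?f i)) {..<n} \<le> integral {0..} ?n" for n
  proof (rule L2_set_integral_le[OF _ fi ni])
    fix t :: real assume "t \<in> {0..}"
    then have t: "t \<ge> 0" by simp
    have "(\<Sum>i<n. (duhamel k F 0 t i j)\<^sup>2) \<le> (\<Sum>i<n. \<Sum>j<N. (duhamel k F 0 t i j)\<^sup>2)"
      by (intro sum_mono member_le_sum) (use j in auto)
    then have "L2_set (\<lambda>i. duhamel k F 0 t i j) {..<n} \<le> block_norm N n (duhamel k F 0 t)"
      unfolding L2_set_def block_norm_eq by (rule real_sqrt_le_mono)
    also have "\<dots> \<le> K * exp (\<beta> * t)" by (rule K(2)[OF t])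
    finally have "exp (- ?\<eta> * t) * L2_set (\<lambda>i. duhamel k F 0 t i j) {..<n} \<le> exp (- ?\<eta> * t) * (K * exp (\<beta> * t))"
      by (intro mult_left_mono) auto
    also have "\<dots> = ?n t" by (simp add: mult_exp_exp algebra_simps)
    finally show "L2_set (\<lambda>i. ?f i t) {..<n} \<le> ?n t"
      by (simp add: L2_set_def power_mult_distrib real_sqrt_mult flip: sum_distrib_left)
  qed auto
  then have b: "(\<Sum>i<n. (integral {0..} (?f i))\<^sup>2) \<le> (integral {0..} ?n)\<^sup>2" for n
    unfolding L2_set_def by (rule sqrt_le_D)
  show ?thesis
  proof (rule bounded_imp_summable)
    fix n
    have "(\<Sum>i\<le>n. (cmod (laplace (\<lambda>t. duhamel k F 0 t i j) s))\<^sup>2) \<le> (\<Sum>i\<le>n. (integral {0..} (?f i))\<^sup>2)"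
      by (intro sum_mono power_mono le) auto
    then show "(\<Sum>i\<le>n. (cmod (laplace (\<lambda>t. duhamel k F 0 t i j) s))\<^sup>2) \<le> (integral {0..} ?n)\<^sup>2"
      using b[of "Suc n"] by (simp only: lessThan_Suc_atMost)
  qed auto
qed

end

end

section \<open>Spectral norms and diagonalization\<close>

lemma mult_mat_vec_index:
  assumes "M \<in> carrier_mat N N" "i < N"
  shows "vec_index (M *\<^sub>v Matrix.vec N x) i = (\<Sum>j<N. M $$ (i, j) * x j)"
  using assms by (auto simp: scalar_prod_def lessThan_atLeast0 intro!: sum.cong)

lemma eucl_norm_vec: "eucl_norm (Matrix.vec N x) = L2_set x {..<N}"
  by (auto simp: eucl_norm_def scalar_prod_def L2_set_def power2_eq_square lessThan_atLeast0 intro!: sum.cong)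

lemma eucl_norm_mult_mat_vec:
  assumes M: "M \<in> carrier_mat N N"
  shows "eucl_norm (M *\<^sub>v Matrix.vec N x) = L2_set (\<lambda>i. \<Sum>j<N. M $$ (i, j) * x j) {..<N}"
proof -
  have "M *\<^sub>v Matrix.vec N x = Matrix.vec N (\<lambda>i. \<Sum>j<N. M $$ (i, j) * x j)"
  proof (rule eq_vecI)
    fix i assume "i < dim_vec (Matrix.vec N (\<lambda>i. \<Sum>j<N. M $$ (i, j) * x j))"
    then have i: "i < N" by simp
    show "vec_index (M *\<^sub>v Matrix.vec N x) i = vec_index (Matrix.vec N (\<lambda>i. \<Sum>j<N. M $$ (i, j) * x j)) i"
      unfolding mult_mat_vec_index[OF M i] using i by simp
  qed (use M in auto)
  then show ?thesis by (simp add: eucl_norm_vec)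
qed

text \<open>Boundedness makes the supremum in \<open>spectral_norm\<close> a genuine upper bound.
  Cauchy-Schwarz in each row gives the crude bound by the sum of the row norms.\<close>

lemma spectral_norm_bdd:
  fixes M :: "real mat"
  assumes M: "M \<in> carrier_mat N N"
  shows "bdd_above ((\<lambda>v. eucl_norm (M *\<^sub>v v)) ` {v \<in> carrier_vec (dim_col M). eucl_norm v \<le> 1})"
proof (rule bdd_aboveI2)
  fix v assume v: "v \<in> {v \<in> carrier_vec (dim_col M). eucl_norm v \<le> 1}"
  define x where "x = vec_index v"
  have vx: "v = Matrix.vec N x" using v M by (auto simp: x_def)
  have "eucl_norm v \<le> 1" using v by simp
  then have n: "L2_set x {..<N} \<le> 1" unfolding vx eucl_norm_vec .
  have "eucl_norm (M *\<^sub>v v) \<le> (\<Sum>i<N. \<bar>\<Sum>j<N. M $$ (i, j) * x j\<bar>)"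
    unfolding vx eucl_norm_mult_mat_vec[OF M] by (rule L2_set_le_sum_abs)
  also have "\<dots> \<le> (\<Sum>i<N. L2_set (\<lambda>j. M $$ (i, j)) {..<N})"
  proof (rule sum_mono)
    fix i
    have "\<bar>\<Sum>j<N. M $$ (i, j) * x j\<bar> \<le> (\<Sum>j<N. \<bar>M $$ (i, j)\<bar> * \<bar>x j\<bar>)"
      by (rule order_trans[OF sum_abs]) (simp add: abs_mult)
    also have "\<dots> \<le> L2_set (\<lambda>j. M $$ (i, j)) {..<N} * L2_set x {..<N}" by (rule L2_set_mult_ineq)
    also have "\<dots> \<le> L2_set (\<lambda>j. M $$ (i, j)) {..<N} * 1" by (rule mult_left_mono[OF n]) simp
    finally show "\<bar>\<Sum>j<N. M $$ (i, j) * x j\<bar> \<le> L2_set (\<lambda>j. M $$ (i, j)) {..<N}" by simp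
  qed
  finally show "eucl_norm (M *\<^sub>v v) \<le> (\<Sum>i<N. L2_set (\<lambda>j. M $$ (i, j)) {..<N})" .
qed

lemma spectral_norm_ge:
  fixes M :: "real mat"
  assumes M: "M \<in> carrier_mat N N" and x: "L2_set x {..<N} \<le> 1"
  shows "L2_set (\<lambda>i. \<Sum>j<N. M $$ (i, j) * x j) {..<N} \<le> spectral_norm M"
  unfolding spectral_norm_def eucl_norm_mult_mat_vec[OF M, symmetric]
  by (rule cSUP_upper[OF _ spectral_norm_bdd[OF M]]) (use M x in \<open>auto simp: eucl_norm_vec\<close>)

text \<open>Scale x to length 1; the zero vector is treated apart. The squared form is the one that
  can be integrated in time and summed over columns.\<close>

lemma spectral_norm_sum_le:
  assumes M: "M \<in> carrier_mat N N"
  shows "(\<Sum>i<N. (\<Sum>j<N. M $$ (i, j) * x j)\<^sup>2) \<le> (spectral_norm M)\<^sup>2 * (\<Sum>j<N. (x j)\<^sup>2)"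
proof (cases "(\<Sum>j<N. (x j)\<^sup>2) = 0")
  case True
  then have "\<forall>j\<in>{..<N}. (x j)\<^sup>2 = 0" by (subst (asm) sum_nonneg_eq_0_iff) auto
  then show ?thesis by simp
next
  case False
  define c where "c = L2_set x {..<N}"
  have S0: "(\<Sum>j<N. (x j)\<^sup>2) > 0" using False sum_nonneg[of "{..<N}" "\<lambda>j. (x j)\<^sup>2"] by auto
  then have c0: "c > 0" and cc: "c\<^sup>2 = (\<Sum>j<N. (x j)\<^sup>2)" by (auto simp: c_def L2_set_def)
  have "L2_set (\<lambda>j. x j / c) {..<N} = 1"
    using c0 cc S0 by (simp add: L2_set_def power_divide flip: sum_divide_distrib)
  then have "L2_set (\<lambda>i. \<Sum>j<N. M $$ (i, j) * (x j / c)) {..<N} \<le> spectral_norm M"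
    by (intro spectral_norm_ge[OF M]) simp
  then have "(L2_set (\<lambda>i. \<Sum>j<N. M $$ (i, j) * (x j / c)) {..<N})\<^sup>2 \<le> (spectral_norm M)\<^sup>2"
    by (intro power_mono) auto
  also have "(L2_set (\<lambda>i. \<Sum>j<N. M $$ (i, j) * (x j / c)) {..<N})\<^sup>2 = (\<Sum>i<N. (\<Sum>j<N. M $$ (i, j) * x j)\<^sup>2) / c\<^sup>2"
    by (simp add: L2_set_def sum_nonneg power_divide flip: sum_divide_distrib)
  finally show ?thesis using S0 unfolding cc by (simp add: pos_divide_le_eq)
qed

section \<open>Inverse matrices and left eigenvectors\<close>

lemma mat_inv_properties:
  fixes M :: "real mat"
  assumes M: "M \<in> carrier_mat N N" and inv: "invertible_mat M"
  shows "mat_inv M \<in> carrier_mat N N" "M * mat_inv M = 1\<^sub>m N" "mat_inv M * M = 1\<^sub>m N"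
proof -
  obtain X where X: "M * X = 1\<^sub>m (dim_row M)" "X * M = 1\<^sub>m (dim_row X)"
    using inv by (auto simp: invertible_mat_def inverts_mat_def)
  have "dim_col X = N" using arg_cong[OF X(1), of dim_col] M by simp
  moreover have "dim_row X = N" using arg_cong[OF X(2), of dim_col] M by simp
  ultimately have Xc: "X \<in> carrier_mat N N" by auto
  have "M \<in> Units (ring_mat TYPE(real) N ())"
    unfolding Units_def ring_mat_def using X Xc M by auto
  then obtain Y where "mat_inverse M = Some Y" using mat_inverse(1)[OF M, where b="()"] by (cases "mat_inverse M") auto
  then show "mat_inv M \<in> carrier_mat N N" "M * mat_inv M = 1\<^sub>m N" "mat_inv M * M = 1\<^sub>m N"
    using mat_inverse(2)[OF M] by (auto simp: mat_inv_def)
qed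

lemma mat_mult_index:
  assumes "X \<in> carrier_mat N N" "Y \<in> carrier_mat N N" "i < N" "j < N"
  shows "(X * Y) $$ (i, j) = (\<Sum>q<N. X $$ (i, q) * Y $$ (q, j))"
  using assms by (auto simp: scalar_prod_def lessThan_atLeast0 intro!: sum.cong)

text \<open>Row r of \<Phi>^-1 is a left eigenvector of Qy / h^2 with eigenvalue
  -\<open>lam r\<close>: multiply the diagonalization by \<Phi>^-1 from the left.\<close>

lemma diagonalization_index:
  fixes \<Phi> Qy :: "real mat"
  assumes d: "normalized_diagonalization N P Qy \<Phi> lam" and Q: "Qy \<in> carrier_mat N N" and r: "r < N" and q: "q < N"
  shows "(\<Sum>j<N. mat_inv \<Phi> $$ (r, j) * (1 / (mesh N)\<^sup>2 * Qy $$ (j, q))) = - lam r * mat_inv \<Phi> $$ (r, q)"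
proof -
  let ?\<Psi> = "mat_inv \<Phi>" and ?D = "mat_diag N lam"
  have \<Phi>: "\<Phi> \<in> carrier_mat N N" "invertible_mat \<Phi>"
    and eq: "(1 / (mesh N)\<^sup>2) \<cdot>\<^sub>m Qy = - (\<Phi> * ?D * ?\<Psi>)"
    using d by (auto simp: normalized_diagonalization_def)
  note I = mat_inv_properties[OF \<Phi>]
  have D: "?D \<in> carrier_mat N N" by simp
  have "?\<Psi> * ((1 / (mesh N)\<^sup>2) \<cdot>\<^sub>m Qy) = - (?\<Psi> * (\<Phi> * ?D * ?\<Psi>))"
    unfolding eq using I \<Phi> D by simp
  also have "?\<Psi> * (\<Phi> * ?D * ?\<Psi>) = (?\<Psi> * \<Phi>) * (?D * ?\<Psi>)"
    by (simp only: assoc_mult_mat[OF \<Phi>(1) D I(1)]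
        assoc_mult_mat[OF I(1) \<Phi>(1) mult_carrier_mat[OF D I(1)], symmetric])
  also have "\<dots> = ?D * ?\<Psi>"
    by (simp only: I(3) left_mult_one_mat[OF mult_carrier_mat[OF D I(1)]])
  finally have "(?\<Psi> * ((1 / (mesh N)\<^sup>2) \<cdot>\<^sub>m Qy)) $$ (r, q) = (- (?D * ?\<Psi>)) $$ (r, q)" by simp
  moreover have "(?\<Psi> * ((1 / (mesh N)\<^sup>2) \<cdot>\<^sub>m Qy)) $$ (r, q) = (\<Sum>j<N. ?\<Psi> $$ (r, j) * (1 / (mesh N)\<^sup>2 * Qy $$ (j, q)))"
    using Q I(1) q r by (subst mat_mult_index[of _ N]) (auto intro!: sum.cong)
  moreover have "(- (?D * ?\<Psi>)) $$ (r, q) = - lam r * ?\<Psi> $$ (r, q)"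
    using I(1) q r by (simp add: mat_diag_mult_left[OF I(1)])
  ultimately show ?thesis by simp
qed

section \<open>Transforms of compatible data\<close>

lemma laplace_chain:
  assumes D: "deriv_chain {0..} b D" and D0: "\<And>l. l < b \<Longrightarrow> D l 0 = 0"
    and o: "\<And>l. l \<le> b \<Longrightarrow> exp_order \<beta> (D l)" and s: "\<beta> < Re s"
  shows "l \<le> b \<Longrightarrow> laplace (D l) s = s ^ l * laplace (D 0) s"
proof (induction l)
  case (Suc l)
  have "laplace (D (Suc l)) s = s * laplace (D l) s"
    by (rule laplace_deriv[OF o o s _ D0]) (use D Suc.prems in \<open>auto simp: deriv_chain_def\<close>)
  then show ?case using Suc by simp
qed simp

text \<open>The b-fold derivative rule combined with |s| >= Re s. It serves to absorb the
  undifferentiated data term of the scalar estimate.\<close>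

lemma laplace_chain_bound:
  assumes "deriv_chain {0..} b D" "\<And>l. l < b \<Longrightarrow> D l 0 = 0"
    "\<And>l. l \<le> b \<Longrightarrow> exp_order \<beta> (D l)" "\<beta> < Re s" and \<eta>: "Re s > 0"
  shows "(cmod (laplace (D 0) s))\<^sup>2 \<le> (1 / Re s) ^ (2 * b) * (cmod (laplace (D b) s))\<^sup>2"
proof -
  have "Re s ^ b \<le> cmod s ^ b" using complex_Re_le_cmod \<eta> by (intro power_mono) auto
  then have "Re s ^ b * cmod (laplace (D 0) s) \<le> cmod s ^ b * cmod (laplace (D 0) s)" by (rule mult_right_mono) simp
  also have "\<dots> = cmod (laplace (D b) s)"
    by (subst laplace_chain[OF assms(1-4) order_refl]) (auto simp: norm_mult norm_power)
  finally have "(Re s ^ b * cmod (laplace (D 0) s))\<^sup>2 \<le> (cmod (laplace (D b) s))\<^sup>2"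
    using \<eta> by (intro power_mono) auto
  then show ?thesis using \<eta> by (simp add: power_mult_distrib power_one_over field_simps flip: power_mult)
qed

text \<open>Connects an explicit chain of derivatives with \<open>laplace_data\<close> and
  \<open>nderiv\<close>, the forms in which the scalar hypothesis refers to its data.\<close>

lemma laplace_data_chain:
  assumes D: "deriv_chain {0..} b D" and D0: "\<And>l. l < b \<Longrightarrow> D l 0 = 0"
    and o: "\<And>l. l \<le> b \<Longrightarrow> exp_order \<beta> (D l)" and s: "\<beta> < Re s"
  shows "laplace_data b s (D 0)"
    and "laplace (nderiv {0..} b (D 0)) s = laplace (D b) s"
proof -
  have n: "nderiv {0..} l (D 0) t = D l t" if "l \<le> b" "t \<ge> 0" for l t
    by (rule nderiv_chain[OF D at_within_Ici_not_bot]) (use that in auto)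
  show "laplace_data b s (D 0)"
    unfolding laplace_data_def
  proof (intro conjI allI impI)
    show "C_on b {0..} (D 0)" by (rule C_on_chain[OF D at_within_Ici_not_bot]) auto
    fix l assume l: "l \<le> b"
    have "(\<lambda>t. exp (- s * of_real t) * of_real (D l t)) absolutely_integrable_on {0..}"
      by (rule laplace_absolutely_integrable[OF o[OF l] s])
    then show "(\<lambda>t. exp (- s * of_real t) * of_real (nderiv {0..} l (D 0) t)) absolutely_integrable_on {0..}"
      by (subst set_integrable_cong[OF refl]) (auto simp: n l)
  qed (use n D0 in auto)
  show "laplace (nderiv {0..} b (D 0)) s = laplace (D b) s" by (rule laplace_cong) (simp add: n)
qed

section \<open>The error estimate\<close>

lemma cmod_sum_square_le:
  fixes x :: "'a \<Rightarrow> complex" and a :: "'a \<Rightarrow> real"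
  shows "(cmod (\<Sum>j\<in>J. of_real (a j) * x j))\<^sup>2 \<le> (\<Sum>j\<in>J. (a j)\<^sup>2) * (\<Sum>j\<in>J. (cmod (x j))\<^sup>2)"
proof -
  have "cmod (\<Sum>j\<in>J. of_real (a j) * x j) \<le> (\<Sum>j\<in>J. \<bar>a j\<bar> * \<bar>cmod (x j)\<bar>)"
    by (rule order_trans[OF norm_sum]) (simp add: norm_mult)
  also have "\<dots> \<le> L2_set a J * L2_set (\<lambda>j. cmod (x j)) J" by (rule L2_set_mult_ineq)
  finally have "(cmod (\<Sum>j\<in>J. of_real (a j) * x j))\<^sup>2 \<le> (L2_set a J * L2_set (\<lambda>j. cmod (x j)) J)\<^sup>2"
    by (intro power_mono) auto
  then show ?thesis by (simp add: L2_set_def power_mult_distrib sum_nonneg)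
qed

locale error_grid = stable_grid N A B \<alpha> C
  for N A B \<alpha> C +
  fixes P \<Phi> :: "real mat" and lam :: "nat \<Rightarrow> real" and \<eta> g m p K :: real and b k :: nat
  assumes B: "B \<in> carrier_mat N N" and diag: "normalized_diagonalization N P B \<Phi> lam"
    and \<eta>: "\<eta> > 0" "\<alpha> < \<eta>" and K: "K \<ge> 0"
    and scalar: "\<And>s r. Re s = \<eta> \<Longrightarrow> r < N \<Longrightarrow> scalar_estimate K \<eta> g m p b k N A (lam r) s"
begin

abbreviation \<Psi> :: "nat \<Rightarrow> nat \<Rightarrow> real" where
  "\<Psi> r j \<equiv> mat_inv \<Phi> $$ (r, j)"

abbreviation h :: real where
  "h \<equiv> mesh N"

text \<open>A growth rate strictly between that of the propagator and the abscissa of the Laplace transform.\<close>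

definition \<beta> :: real where
  "\<beta> = (max \<alpha> 0 + \<eta>) / 2"

text \<open>Three rates are separated: the continued data have rate \<beta> / 2, strictly below the
  rate \<beta> of the solution as the growth bound for Duhamel's formula requires, and \<beta> lies
  below the abscissa \<eta>.\<close>

lemma \<beta>: "\<beta> > 0" "\<alpha> \<le> \<beta>" "\<beta> < \<eta>" "\<beta> / 2 < \<beta>" "\<beta> / 2 > 0" "\<beta> / 2 < \<eta>"
  using \<eta> by (auto simp: \<beta>_def max_def)

text \<open>The bracket collects the two data terms: 1 for the b-th derivative and (1 / \<eta>)^(2
  b) for the undifferentiated data.\<close>

definition estimate_const :: real where
  "estimate_const = K * h powr (2 * g) / \<eta> powr m * (1 + (1 / \<eta>) ^ (2 * b))"

lemma estimate_const_nonneg: "estimate_const \<ge> 0"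
  using K \<eta> by (simp add: estimate_const_def)

lemma \<Phi>: "\<Phi> \<in> carrier_mat N N" "mat_inv \<Phi> \<in> carrier_mat N N" "\<Phi> * mat_inv \<Phi> = 1\<^sub>m N"
  using diag mat_inv_properties[of \<Phi> N] by (auto simp: normalized_diagonalization_def)

context
  fixes D :: "nat \<Rightarrow> nat \<Rightarrow> nat \<Rightarrow> real \<Rightarrow> real"
begin

definition force :: "nat \<Rightarrow> nat \<Rightarrow> real \<Rightarrow> real" where
  "force i j t = h powr p * D i j 0 t"

definition Z :: "real \<Rightarrow> nat \<Rightarrow> nat \<Rightarrow> real" where
  "Z = duhamel k force 0"

text \<open>The quantity \<epsilon>^(r) of the theorem before the Laplace transform: for fixed r a
  grid function in x with index i.\<close>

definition W :: "nat \<Rightarrow> nat \<Rightarrow> real \<Rightarrow> real" where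
  "W r i t = (\<Sum>j<N. \<Psi> r j * Z t i j)"

definition \<tau> :: "nat \<Rightarrow> nat \<Rightarrow> nat \<Rightarrow> real \<Rightarrow> real" where
  "\<tau> r i l t = (\<Sum>j<N. \<Psi> r j * D i j l t)"

context
  assumes D: "\<And>i j. i \<le> k \<Longrightarrow> j < N \<Longrightarrow> deriv_chain {0..} b (D i j)"
    and D0: "\<And>i j l. i \<le> k \<Longrightarrow> j < N \<Longrightarrow> l < b \<Longrightarrow> D i j l 0 = 0"
    and Do: "\<And>i j l. i \<le> k \<Longrightarrow> j < N \<Longrightarrow> l \<le> b \<Longrightarrow> exp_order (\<beta> / 2) (D i j l)"
begin

lemma force_order: "i \<le> k \<Longrightarrow> j < N \<Longrightarrow> exp_order (\<beta> / 2) (force i j)"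
  unfolding force_def by (intro exp_order_mult Do) auto

lemma force_continuous: "i \<le> k \<Longrightarrow> j < N \<Longrightarrow> continuous_on {0..} (force i j)"
  by (rule exp_order_continuous[OF force_order])

lemma Z_order: "j < N \<Longrightarrow> exp_order \<beta> (\<lambda>t. Z t i j)"
  unfolding Z_def by (rule duhamel_exp_order(1)[OF force_continuous force_order \<beta>(4,2,1)])

lemma W_order: "exp_order \<beta> (W r i)"
  unfolding W_def by (intro exp_order_sum exp_order_mult Z_order) auto

lemma W_0: "W r i 0 = 0"
  by (simp add: W_def Z_def duhamel_def split_beta)

lemma \<tau>_facts:
  assumes "i \<le> k"
  shows "deriv_chain {0..} b (\<tau> r i)" "\<And>l. l < b \<Longrightarrow> \<tau> r i l 0 = 0" "\<And>l. l \<le> b \<Longrightarrow> exp_order (\<beta> / 2) (\<tau> r i l)"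
proof -
  show "deriv_chain {0..} b (\<tau> r i)"
    using deriv_chain_sum[of "{..<N}" "{0..}" b "D i" "\<Psi> r"] D assms by (simp add: \<tau>_def[abs_def])
  show "\<tau> r i l 0 = 0" if "l < b" for l using D0 assms that by (simp add: \<tau>_def)
  show "exp_order (\<beta> / 2) (\<tau> r i l)" if "l \<le> b" for l
    unfolding \<tau>_def using Do assms that by (intro exp_order_sum exp_order_mult) auto
qed

text \<open>Combine the N equations of column i with the r-th row of \<Phi>^-1; by the left
  eigenvector relation the operator in y becomes -\<open>lam r\<close>. Multiplication by h^2 then
  gives the scalar difference equation and turns h^p into h^(p + 2).\<close>

lemma scalar_equation:
  assumes s: "Re s = \<eta>" and r: "r < N"
  shows "((s * of_real h)\<^sup>2 + of_real (h\<^sup>2 * lam r)) * laplace (W r i) s =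
     apply_x A (\<lambda>i. laplace (W r i) s) i +
     of_real (h powr (p + 2)) * column_forcing k (\<lambda>l. laplace (\<tau> r l 0) s) i"
proof -
  have s\<beta>: "\<beta> < Re s" and s2: "\<beta> / 2 < Re s" using s \<beta> by simp_all
  let ?z = "\<lambda>i j. laplace (\<lambda>t. Z t i j) s"
  have e: "laplace (W r i) s = (\<Sum>j<N. of_real (\<Psi> r j) * ?z i j)" for i
    unfolding W_def by (subst laplace_sum[OF _ s\<beta>]) (auto intro!: exp_order_mult Z_order simp: laplace_mult)
  have eqz: "s\<^sup>2 * ?z i j = of_real (1 / h\<^sup>2) * apply_x A (\<lambda>l. ?z l j) i +
     of_real (1 / h\<^sup>2) * (\<Sum>q<N. of_real (B $$ (j, q)) * ?z i q) + column_forcing k (\<lambda>l. laplace (force l j) s) i"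
    if "j < N" for j
    unfolding Z_def by (rule laplace_duhamel[OF force_continuous force_order \<beta>(4,2,1) that s\<beta>])
  have 1: "(\<Sum>j<N. of_real (\<Psi> r j) * (of_real (1 / h\<^sup>2) * apply_x A (\<lambda>l. ?z l j) i)) =
      of_real (1 / h\<^sup>2) * apply_x A (\<lambda>i. laplace (W r i) s) i"
    unfolding apply_x_def e sum_distrib_left by (subst sum.swap) (simp add: mult_ac)
  have 2: "(\<Sum>j<N. of_real (\<Psi> r j) * (of_real (1 / h\<^sup>2) * (\<Sum>q<N. of_real (B $$ (j, q)) * ?z i q))) =
      - of_real (lam r) * laplace (W r i) s"
  proof -
    have "(\<Sum>j<N. of_real (\<Psi> r j) * (of_real (1 / h\<^sup>2) * (\<Sum>q<N. of_real (B $$ (j, q)) * ?z i q))) =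
        (\<Sum>j<N. \<Sum>q<N. of_real (\<Psi> r j * (1 / h\<^sup>2 * B $$ (j, q))) * ?z i q)"
      unfolding sum_distrib_left by (simp add: mult_ac)
    also have "\<dots> = (\<Sum>q<N. of_real (\<Sum>j<N. \<Psi> r j * (1 / h\<^sup>2 * B $$ (j, q))) * ?z i q)"
      by (subst sum.swap) (simp only: of_real_sum sum_distrib_right)
    also have "\<dots> = (\<Sum>q<N. of_real (- lam r * \<Psi> r q) * ?z i q)"
      by (intro sum.cong refl) (simp only: diagonalization_index[OF diag B r] lessThan_iff)
    also have "\<dots> = - of_real (lam r) * laplace (W r i) s"
      unfolding e sum_distrib_left by (simp add: mult_ac)
    finally show ?thesis .
  qed
  have 3: "(\<Sum>j<N. of_real (\<Psi> r j) * column_forcing k (\<lambda>l. laplace (force l j) s) i) =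
      of_real (h powr p) * column_forcing k (\<lambda>l. laplace (\<tau> r l 0) s) i"
  proof (cases "i \<le> k")
    case True
    have "laplace (\<tau> r i 0) s = (\<Sum>j<N. of_real (\<Psi> r j) * laplace (D i j 0) s)"
      unfolding \<tau>_def
      by (subst laplace_sum[OF exp_order_mult[OF Do[OF True]] s2]) (auto simp: laplace_mult)
    moreover have "laplace (force i j) s = of_real (h powr p) * laplace (D i j 0) s" for j
      unfolding force_def by (rule laplace_mult)
    ultimately show ?thesis using True by (simp add: column_forcing_def sum_distrib_left mult_ac)
  qed (simp add: column_forcing_def)
  have "s\<^sup>2 * laplace (W r i) s = (\<Sum>j<N. of_real (\<Psi> r j) * (s\<^sup>2 * ?z i j))"
    unfolding e sum_distrib_left by (simp add: mult_ac)
  also have "\<dots> = (\<Sum>j<N. of_real (\<Psi> r j) * (of_real (1 / h\<^sup>2) * apply_x A (\<lambda>l. ?z l j) i +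
     of_real (1 / h\<^sup>2) * (\<Sum>q<N. of_real (B $$ (j, q)) * ?z i q) + column_forcing k (\<lambda>l. laplace (force l j) s) i))"
    by (intro sum.cong refl) (simp only: eqz lessThan_iff)
  also have "\<dots> = of_real (1 / h\<^sup>2) * apply_x A (\<lambda>i. laplace (W r i) s) i - of_real (lam r) * laplace (W r i) s +
      of_real (h powr p) * column_forcing k (\<lambda>l. laplace (\<tau> r l 0) s) i"
    by (simp only: distrib_left sum.distrib 1 2 3 mult_minus_left add_uminus_conv_diff)
  finally have "of_real (h\<^sup>2) * (s\<^sup>2 * laplace (W r i) s) = of_real (h\<^sup>2) * (of_real (1 / h\<^sup>2) * apply_x A (\<lambda>i. laplace (W r i) s) i - of_real (lam r) * laplace (W r i) s +
      of_real (h powr p) * column_forcing k (\<lambda>l. laplace (\<tau> r l 0) s) i)" by simp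
  moreover have "of_real (h\<^sup>2) * (of_real (1 / h\<^sup>2) * x) = x" for x :: complex
    using mesh by simp
  moreover have "complex_of_real (h powr (p + 2)) = of_real (h\<^sup>2) * of_real (h powr p)"
    using mesh by (simp add: powr_add powr_numeral)
  ultimately show ?thesis by (simp add: algebra_simps power_mult_distrib)
qed

lemma transformed_summable:
  assumes s: "Re s = \<eta>"
  shows "summable (\<lambda>i. (cmod (laplace (W r i) s))\<^sup>2)"
proof -
  have s\<beta>: "\<beta> < Re s" using s \<beta> by simp
  have e: "laplace (W r i) s = (\<Sum>j<N. of_real (\<Psi> r j) * laplace (\<lambda>t. Z t i j) s)" for i
    unfolding W_def by (subst laplace_sum[OF _ s\<beta>]) (auto intro!: exp_order_mult Z_order simp: laplace_mult)
  have "summable (\<lambda>i. (cmod (laplace (\<lambda>t. Z t i j) s))\<^sup>2)" if "j < N" for j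
    unfolding Z_def by (rule laplace_duhamel_summable[OF force_continuous force_order \<beta>(4,2,1) s\<beta> that])
  then have "summable (\<lambda>i. (\<Sum>j<N. (\<Psi> r j)\<^sup>2) * (\<Sum>j<N. (cmod (laplace (\<lambda>t. Z t i j) s))\<^sup>2))"
    by (intro summable_mult summable_sum) auto
  then show ?thesis
    by (rule summable_comparison_test') (simp add: e cmod_sum_square_le)
qed

text \<open>The scalar hypothesis bounds the infinite sum, of which a partial sum is kept. The
  square of \<open>norm1Dx\<close> contains the mesh weight h, whence the division by h.\<close>

lemma scalar_bound:
  assumes s: "Re s = \<eta>" and r: "r < N"
  shows "(\<Sum>i<n. (cmod (laplace (W r i) s))\<^sup>2) \<le> (estimate_const / h) * (\<Sum>i\<le>k. (cmod (laplace (\<tau> r i b) s))\<^sup>2)"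
proof -
  have s\<beta>: "\<beta> / 2 < Re s" using s \<beta> by simp
  let ?c = "K * h powr (2 * g) / \<eta> powr m"
  have c: "?c \<ge> 0" using K \<eta> by simp
  have "(norm1Dx N (\<lambda>i. laplace (W r i) s))\<^sup>2 \<le> ?c *
      (\<Sum>i\<le>k. (cmod (laplace (\<tau> r i 0) s))\<^sup>2 + (cmod (laplace (nderiv {0..} b (\<tau> r i 0)) s))\<^sup>2)"
    using scalar[OF s r, unfolded scalar_estimate_def, rule_format, of "\<lambda>i. \<tau> r i 0" "\<lambda>i. laplace (W r i) s"]
      laplace_data_chain(1)[OF \<tau>_facts s\<beta>] transformed_summable[OF s] scalar_equation[OF s r] by blast
  also have "\<dots> \<le> ?c * (\<Sum>i\<le>k. (1 + (1 / \<eta>) ^ (2 * b)) * (cmod (laplace (\<tau> r i b) s))\<^sup>2)"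
  proof (intro mult_left_mono sum_mono c)
    fix i assume "i \<in> {..k}"
    then have i: "i \<le> k" by simp
    show "(cmod (laplace (\<tau> r i 0) s))\<^sup>2 + (cmod (laplace (nderiv {0..} b (\<tau> r i 0)) s))\<^sup>2
        \<le> (1 + (1 / \<eta>) ^ (2 * b)) * (cmod (laplace (\<tau> r i b) s))\<^sup>2"
      using laplace_chain_bound[OF \<tau>_facts[OF i, where r=r] s\<beta>] laplace_data_chain(2)[OF \<tau>_facts[OF i, where r=r] s\<beta>] s \<eta>
      by (simp add: distrib_right)
  qed
  also have "\<dots> = estimate_const * (\<Sum>i\<le>k. (cmod (laplace (\<tau> r i b) s))\<^sup>2)"
    by (simp only: estimate_const_def sum_distrib_left mult.assoc)
  finally have le: "(norm1Dx N (\<lambda>i. laplace (W r i) s))\<^sup>2 \<le> estimate_const * (\<Sum>i\<le>k. (cmod (laplace (\<tau> r i b) s))\<^sup>2)" .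
  have "(norm1Dx N (\<lambda>i. laplace (W r i) s))\<^sup>2 = h * (\<Sum>i. (cmod (laplace (W r i) s))\<^sup>2)"
    using mesh suminf_nonneg[OF transformed_summable[OF s]] by (simp add: norm1Dx_def)
  moreover have "(\<Sum>i<n. (cmod (laplace (W r i) s))\<^sup>2) \<le> (\<Sum>i. (cmod (laplace (W r i) s))\<^sup>2)"
    by (rule sum_le_suminf[OF transformed_summable[OF s]]) auto
  then have "h * (\<Sum>i<n. (cmod (laplace (W r i) s))\<^sup>2) \<le> h * (\<Sum>i. (cmod (laplace (W r i) s))\<^sup>2)"
    using mesh by (intro mult_left_mono) auto
  ultimately have "h * (\<Sum>i<n. (cmod (laplace (W r i) s))\<^sup>2) \<le> estimate_const * (\<Sum>i\<le>k. (cmod (laplace (\<tau> r i b) s))\<^sup>2)"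
    using le by linarith
  then show ?thesis using mesh by (simp add: field_simps)
qed

lemma weighted_bound:
  assumes "r < N"
  shows "(\<Sum>i<n. integral {0..} (\<lambda>t. exp (- 2 * \<eta> * t) * (W r i t)\<^sup>2)) \<le>
     (estimate_const / h) * (\<Sum>i\<le>k. integral {0..} (\<lambda>t. exp (- 2 * \<eta> * t) * (\<tau> r i b t)\<^sup>2))"
proof (rule laplace_energy_le[OF _ _ _ \<beta>(3)])
  show "exp_order \<beta> (\<tau> r i b)" if "i \<in> {..k}" for i
    by (rule exp_order_mono[OF \<tau>_facts(3)[OF _ order_refl] less_imp_le[OF \<beta>(4)]]) (use that in simp)
  show "exp_order \<beta> (W r i)" for i by (rule W_order)
  show "W r i 0 = 0" for i by (rule W_0)
  show "estimate_const / h \<ge> 0" using estimate_const_nonneg mesh by simp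
  show "(\<Sum>i<n. (cmod (laplace (W r i) s))\<^sup>2) \<le> estimate_const / h * (\<Sum>i\<le>k. (cmod (laplace (\<tau> r i b) s))\<^sup>2)"
    if "Re s = \<eta>" for s by (rule scalar_bound[OF that assms])
qed auto

text \<open>On [0, tf] the weight is inserted at the price exp(2 \<eta> tf), then the time integral
  is enlarged to the half-line for Plancherel's theorem. Returning from W to Z costs the squared
  norm of \<Phi>, passing from \<tau> to D that of \<Phi>^-1; the product is the squared condition
  number.\<close>

lemma finite_time_bound:
  assumes tf: "tf > 0"
  shows "integral {0..tf} (\<lambda>t. \<Sum>i<n. \<Sum>j<N. (Z t i j)\<^sup>2) \<le>
     exp (2 * \<eta> * tf) * (cond_number \<Phi>)\<^sup>2 * (estimate_const / h) *
     (\<Sum>i\<le>k. \<Sum>j<N. integral {0..} (\<lambda>t. exp (- 2 * \<eta> * t) * (D i j b t)\<^sup>2))"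
proof -
  let ?w = "\<lambda>t. exp (- 2 * \<eta> * t)" and ?E = "exp (2 * \<eta> * tf)"
  let ?p = "(spectral_norm \<Phi>)\<^sup>2" and ?q = "(spectral_norm (mat_inv \<Phi>))\<^sup>2" and ?c = "estimate_const / h"
  have Zc: "continuous_on {0..tf} (\<lambda>t. Z t i j)" if "j < N" for i j
    by (rule continuous_on_subset[OF exp_order_continuous[OF Z_order[OF that]]]) auto
  have Wi: "(\<lambda>t. ?w t * (W r i t)\<^sup>2) integrable_on {0..}" for r i
    by (rule damped_energy(2)[OF W_order \<beta>(3)])
  have Wf: "(\<lambda>t. ?w t * (W r i t)\<^sup>2) integrable_on {0..tf}" for r i
    by (rule integrable_on_subinterval[OF Wi]) auto
  have Di: "(\<lambda>t. ?w t * (D i j b t)\<^sup>2) integrable_on {0..}" if "i \<le> k" "j < N" for i j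
    by (rule damped_energy(2)[OF Do[OF that order_refl] \<beta>(6)])
  have \<tau>i: "(\<lambda>t. ?w t * (\<tau> r i b t)\<^sup>2) integrable_on {0..}" if "i \<le> k" for r i
    by (rule damped_energy(2)[OF \<tau>_facts(3)[OF that order_refl] \<beta>(6)])
  have c0: "?c \<ge> 0" using estimate_const_nonneg mesh by simp
  then have c1: "0 \<le> ?E * ?p * ?c" by (intro mult_nonneg_nonneg) auto
  \<comment> \<open>In each column Z = \<Phi> W, because \<Phi> \<Phi>^-1 is the identity.\<close>
  have pt: "(\<Sum>j<N. (Z t i j)\<^sup>2) \<le> ?p * (\<Sum>r<N. (W r i t)\<^sup>2)" for t i
  proof -
    have "Z t i j = (\<Sum>r<N. \<Phi> $$ (j, r) * W r i t)" if j: "j < N" for j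
    proof -
      have "(\<Sum>r<N. \<Phi> $$ (j, r) * W r i t) = (\<Sum>q<N. (\<Sum>r<N. \<Phi> $$ (j, r) * \<Psi> r q) * Z t i q)"
        unfolding W_def sum_distrib_left sum_distrib_right by (subst sum.swap) (simp add: mult_ac)
      also have "\<dots> = (\<Sum>q<N. (1\<^sub>m N) $$ (j, q) * Z t i q)"
        by (intro sum.cong refl) (simp add: mat_mult_index[OF \<Phi>(1,2) j, symmetric] \<Phi>(3))
      also have "\<dots> = (\<Sum>q<N. if q = j then Z t i q else 0)" using j by (intro sum.cong) auto
      finally show ?thesis using j by simp
    qed
    then have "(\<Sum>j<N. (Z t i j)\<^sup>2) = (\<Sum>j<N. (\<Sum>r<N. \<Phi> $$ (j, r) * W r i t)\<^sup>2)" by simp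
    also have "\<dots> \<le> ?p * (\<Sum>r<N. (W r i t)\<^sup>2)" by (rule spectral_norm_sum_le[OF \<Phi>(1)])
    finally show ?thesis .
  qed
  have "integral {0..tf} (\<lambda>t. \<Sum>i<n. \<Sum>j<N. (Z t i j)\<^sup>2) \<le>
      integral {0..tf} (\<lambda>t. \<Sum>i<n. \<Sum>r<N. ?E * ?p * (?w t * (W r i t)\<^sup>2))"
  proof (rule integral_le)
    show "(\<lambda>t. \<Sum>i<n. \<Sum>j<N. (Z t i j)\<^sup>2) integrable_on {0..tf}"
      by (intro integrable_continuous_real continuous_intros Zc) auto
    show "(\<lambda>t. \<Sum>i<n. \<Sum>r<N. ?E * ?p * (?w t * (W r i t)\<^sup>2)) integrable_on {0..tf}"
      by (intro integrable_sum integrable_on_mult_right Wf) auto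
    fix t assume t: "t \<in> {0..tf}"
    have Ew: "?E * ?w t \<ge> 1" using t \<eta> by (simp add: mult_exp_exp)
    show "(\<Sum>i<n. \<Sum>j<N. (Z t i j)\<^sup>2) \<le> (\<Sum>i<n. \<Sum>r<N. ?E * ?p * (?w t * (W r i t)\<^sup>2))"
    proof (rule sum_mono)
      fix i
      have "(\<Sum>j<N. (Z t i j)\<^sup>2) \<le> 1 * (?p * (\<Sum>r<N. (W r i t)\<^sup>2))" using pt by simp
      also have "\<dots> \<le> (?E * ?w t) * (?p * (\<Sum>r<N. (W r i t)\<^sup>2))"
        by (rule mult_right_mono[OF Ew]) (simp add: sum_nonneg)
      finally show "(\<Sum>j<N. (Z t i j)\<^sup>2) \<le> (\<Sum>r<N. ?E * ?p * (?w t * (W r i t)\<^sup>2))"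
        by (simp add: sum_distrib_left mult_ac)
    qed
  qed
  also have "\<dots> = (\<Sum>i<n. \<Sum>r<N. ?E * ?p * integral {0..tf} (\<lambda>t. ?w t * (W r i t)\<^sup>2))"
  proof -
    have in1: "(\<lambda>t. ?E * ?p * (?w t * (W r i t)\<^sup>2)) integrable_on {0..tf}" for r i
      by (intro integrable_on_mult_right Wf)
    have "integral {0..tf} (\<lambda>t. \<Sum>i<n. \<Sum>r<N. ?E * ?p * (?w t * (W r i t)\<^sup>2)) =
        (\<Sum>i<n. integral {0..tf} (\<lambda>t. \<Sum>r<N. ?E * ?p * (?w t * (W r i t)\<^sup>2)))"
      by (intro Henstock_Kurzweil_Integration.integral_sum integrable_sum in1 finite_lessThan)
    also have "\<dots> = (\<Sum>i<n. \<Sum>r<N. integral {0..tf} (\<lambda>t. ?E * ?p * (?w t * (W r i t)\<^sup>2)))"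
      by (intro sum.cong refl Henstock_Kurzweil_Integration.integral_sum in1 finite_lessThan)
    finally show ?thesis by (simp only: integral_mult_right)
  qed
  also have "\<dots> \<le> (\<Sum>i<n. \<Sum>r<N. ?E * ?p * integral {0..} (\<lambda>t. ?w t * (W r i t)\<^sup>2))"
    by (intro sum_mono mult_left_mono integral_subset_le Wf Wi) auto
  also have "\<dots> = ?E * ?p * (\<Sum>r<N. \<Sum>i<n. integral {0..} (\<lambda>t. ?w t * (W r i t)\<^sup>2))"
    unfolding sum_distrib_left by (rule sum.swap)
  also have "\<dots> \<le> ?E * ?p * (\<Sum>r<N. ?c * (\<Sum>i\<le>k. integral {0..} (\<lambda>t. ?w t * (\<tau> r i b t)\<^sup>2)))"
    by (intro mult_left_mono sum_mono weighted_bound) auto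
  also have "\<dots> = ?E * ?p * ?c * (\<Sum>i\<le>k. \<Sum>r<N. integral {0..} (\<lambda>t. ?w t * (\<tau> r i b t)\<^sup>2))"
    unfolding sum_distrib_left[symmetric] by (subst sum.swap) simp
  also have "\<dots> \<le> ?E * ?p * ?c * (\<Sum>i\<le>k. ?q * (\<Sum>j<N. integral {0..} (\<lambda>t. ?w t * (D i j b t)\<^sup>2)))"
  proof (intro mult_left_mono sum_mono)
    fix i assume "i \<in> {..k}"
    then have i: "i \<le> k" by simp
    have "(\<Sum>r<N. integral {0..} (\<lambda>t. ?w t * (\<tau> r i b t)\<^sup>2)) = integral {0..} (\<lambda>t. \<Sum>r<N. ?w t * (\<tau> r i b t)\<^sup>2)"
      by (rule Henstock_Kurzweil_Integration.integral_sum[symmetric]) (use \<tau>i[OF i] in auto)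
    also have "\<dots> \<le> integral {0..} (\<lambda>t. \<Sum>j<N. ?q * (?w t * (D i j b t)\<^sup>2))"
    proof (rule integral_le)
      show "(\<lambda>t. \<Sum>r<N. ?w t * (\<tau> r i b t)\<^sup>2) integrable_on {0..}"
        by (intro integrable_sum \<tau>i i) auto
      show "(\<lambda>t. \<Sum>j<N. ?q * (?w t * (D i j b t)\<^sup>2)) integrable_on {0..}"
        by (intro integrable_sum integrable_on_mult_right Di i) auto
      fix t :: real
      have "?w t * (\<Sum>r<N. (\<tau> r i b t)\<^sup>2) \<le> ?w t * (?q * (\<Sum>j<N. (D i j b t)\<^sup>2))"
        unfolding \<tau>_def by (intro mult_left_mono spectral_norm_sum_le[OF \<Phi>(2)]) auto
      then show "(\<Sum>r<N. ?w t * (\<tau> r i b t)\<^sup>2) \<le> (\<Sum>j<N. ?q * (?w t * (D i j b t)\<^sup>2))"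
        by (simp add: sum_distrib_left mult_ac)
    qed
    also have "\<dots> = (\<Sum>j<N. integral {0..} (\<lambda>t. ?q * (?w t * (D i j b t)\<^sup>2)))"
      by (rule Henstock_Kurzweil_Integration.integral_sum) (use Di[OF i] in \<open>auto intro!: integrable_on_mult_right\<close>)
    also have "\<dots> = ?q * (\<Sum>j<N. integral {0..} (\<lambda>t. ?w t * (D i j b t)\<^sup>2))"
      by (simp only: integral_mult_right sum_distrib_left)
    finally show "(\<Sum>r<N. integral {0..} (\<lambda>t. ?w t * (\<tau> r i b t)\<^sup>2)) \<le> ?q * (\<Sum>j<N. integral {0..} (\<lambda>t. ?w t * (D i j b t)\<^sup>2))" .
  qed (rule c1)
  also have "\<dots> = ?E * (cond_number \<Phi>)\<^sup>2 * ?c * (\<Sum>i\<le>k. \<Sum>j<N. integral {0..} (\<lambda>t. ?w t * (D i j b t)\<^sup>2))"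
  proof -
    have "E * p * c * (\<Sum>i\<le>k. q * S i) = E * (p * q) * c * (\<Sum>i\<le>k. S i)" for E p q c :: real and S
      unfolding sum_distrib_left[symmetric] by (simp only: mult_ac)
    then show ?thesis unfolding cond_number_def power_mult_distrib by this
  qed
  finally show ?thesis .
qed

end

end

end

section \<open>Back to the given data on the finite time interval\<close>

lemma semidiscrete_solution_cong:
  assumes "semidiscrete_solution N A B te F u"
    and "\<And>t i j. t \<in> {0..te} \<Longrightarrow> j < N \<Longrightarrow> F t i j = F' t i j"
  shows "semidiscrete_solution N A B te F' u"
  using assms unfolding semidiscrete_solution_def by simp

lemma norm1Dy_square: "mesh N > 0 \<Longrightarrow> (norm1Dy N w)\<^sup>2 = mesh N * (\<Sum>j<N. (w j)\<^sup>2)"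
  by (simp add: norm1Dy_def sum_nonneg)

text \<open>The tail beyond n columns is a geometric remainder in which v enters through C alone.
  With one C for all times of an interval, the limit n to infinity is therefore uniform in
  time.\<close>

lemma norm2D_square_le:
  assumes v: "decays N C v"
  shows "(norm2D N v)\<^sup>2 \<le> (mesh N)\<^sup>2 * (\<Sum>i<n. \<Sum>j<N. (v i j)\<^sup>2) + (mesh N)\<^sup>2 * (real N * C\<^sup>2 * (4 / 3)) * (1 / 4) ^ n"
proof -
  let ?f = "\<lambda>i. \<Sum>j<N. \<bar>v i j\<bar>\<^sup>2"
  have sm: "summable ?f" by (rule decays_norm2D(1)[OF v])
  have s: "(\<lambda>i. real N * C\<^sup>2 * (1 / 4) ^ n * (1 / 4) ^ i) sums (real N * C\<^sup>2 * (1 / 4) ^ n * (1 / (1 - 1 / 4)))"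
    by (intro sums_mult geometric_sums) auto
  have "(\<Sum>i. ?f (i + n)) \<le> real N * C\<^sup>2 * (1 / 4) ^ n * (1 / (1 - 1 / 4))"
    unfolding sums_unique[OF s]
  proof (rule suminf_le[OF _ _ sums_summable[OF s]])
    show "?f (i + n) \<le> real N * C\<^sup>2 * (1 / 4) ^ n * (1 / 4) ^ i" for i
      using decays_norm2D(3)[OF v, of "i + n"] by (simp add: power_add mult_ac)
    show "summable (\<lambda>i. ?f (i + n))" using sm by (rule summable_ignore_initial_segment)
  qed
  then have "suminf ?f \<le> (\<Sum>i<n. ?f i) + real N * C\<^sup>2 * (4 / 3) * (1 / 4) ^ n"
    using suminf_split_initial_segment[OF sm, of n] by (simp add: mult_ac)
  then have "(mesh N)\<^sup>2 * suminf ?f \<le> (mesh N)\<^sup>2 * ((\<Sum>i<n. ?f i) + real N * C\<^sup>2 * (4 / 3) * (1 / 4) ^ n)"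
    by (rule mult_left_mono) simp
  moreover have "(norm2D N v)\<^sup>2 = (mesh N)\<^sup>2 * suminf ?f"
    using suminf_nonneg[OF sm] by (simp add: norm2D_def sum_nonneg)
  ultimately show ?thesis by (simp add: algebra_simps)
qed

context error_grid
begin

text \<open>Simultaneous continuation of all data entries. The arguments of \<open>D\<close> are the
  column, the row and the order of the derivative; \<delta> measures the energy that the
  continuation may add beyond \<open>tf\<close>.\<close>

definition continues :: "real \<Rightarrow> (real \<Rightarrow> nat \<Rightarrow> nat \<Rightarrow> real) \<Rightarrow> real \<Rightarrow> (nat \<Rightarrow> nat \<Rightarrow> nat \<Rightarrow> real \<Rightarrow> real) \<Rightarrow> bool" where
  "continues tf T \<delta> D \<longleftrightarrow> (\<forall>i\<le>k. \<forall>j<N. deriv_chain {0..} b (D i j) \<and> (\<forall>l<b. D i j l 0 = 0) \<and>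
    (\<forall>l\<le>b. exp_order (\<beta> / 2) (D i j l)) \<and> (\<forall>t\<in>{0..tf}. D i j 0 t = T t i j) \<and>
    integral {0..} (\<lambda>t. exp (- 2 * \<eta> * t) * (D i j b t)\<^sup>2) \<le>
      integral {0..tf} (\<lambda>t. (time_deriv {0..tf} b T t i j)\<^sup>2) + \<delta> * (time_deriv {0..tf} b T tf i j)\<^sup>2)"

lemma continuesD:
  assumes "continues tf T \<delta> D" "i \<le> k" "j < N"
  shows "deriv_chain {0..} b (D i j)" "l < b \<Longrightarrow> D i j l 0 = 0" "l \<le> b \<Longrightarrow> exp_order (\<beta> / 2) (D i j l)"
    "t \<in> {0..tf} \<Longrightarrow> D i j 0 t = T t i j"
    "integral {0..} (\<lambda>t. exp (- 2 * \<eta> * t) * (D i j b t)\<^sup>2) \<le>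
      integral {0..tf} (\<lambda>t. (time_deriv {0..tf} b T t i j)\<^sup>2) + \<delta> * (time_deriv {0..tf} b T tf i j)\<^sup>2"
  using assms unfolding continues_def by auto

context
  fixes T \<zeta> :: "real \<Rightarrow> nat \<Rightarrow> nat \<Rightarrow> real" and tf :: real
  assumes tf: "tf > 0"
    and T: "\<And>i j. i \<le> k \<Longrightarrow> j < N \<Longrightarrow> C_on b {0..tf} (\<lambda>t. T t i j)"
    and T0: "\<And>i j l. i \<le> k \<Longrightarrow> j < N \<Longrightarrow> l < b \<Longrightarrow> time_deriv {0..tf} l T 0 i j = 0"
    and \<zeta>: "semidiscrete_solution N A B tf (\<lambda>t i j. h powr p * column_forcing k (\<lambda>l. T t l j) i) \<zeta>"
    and \<zeta>0: "\<And>i j. j < N \<Longrightarrow> \<zeta> 0 i j = 0" "\<And>i j. j < N \<Longrightarrow> time_deriv {0..tf} 1 \<zeta> 0 i j = 0"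
begin

abbreviation Tb :: "real \<Rightarrow> nat \<Rightarrow> nat \<Rightarrow> real" where
  "Tb \<equiv> time_deriv {0..tf} b T"

lemma ex_continues:
  assumes \<delta>: "\<delta> > 0"
  shows "\<exists>D. continues tf T \<delta> D"
proof -
  let ?P = "\<lambda>i j D. deriv_chain {0..} b D \<and> (\<forall>l<b. D l 0 = 0) \<and> (\<forall>l\<le>b. exp_order (\<beta> / 2) (D l)) \<and>
    (\<forall>t\<in>{0..tf}. D 0 t = T t i j) \<and>
    integral {0..} (\<lambda>t. exp (- 2 * \<eta> * t) * (D b t)\<^sup>2) \<le> integral {0..tf} (\<lambda>t. (Tb t i j)\<^sup>2) + \<delta> * (Tb tf i j)\<^sup>2"
  have "\<exists>D. ?P i j D" if ij: "i \<le> k" "j < N" for i j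
  proof (rule data_extension[OF tf T[OF ij] _ \<delta> \<beta>(5,6)])
    show "nderiv {0..tf} l (\<lambda>t. T t i j) 0 = 0" if "l < b" for l
      using T0[OF ij that] by (simp add: time_deriv_def)
  next
    fix D
    assume D: "deriv_chain {0..} b D" "\<And>l. l < b \<Longrightarrow> D l 0 = 0" "\<And>l. l \<le> b \<Longrightarrow> exp_order (\<beta> / 2) (D l)"
      "\<And>l t. l \<le> b \<Longrightarrow> t \<in> {0..tf} \<Longrightarrow> D l t = nderiv {0..tf} l (\<lambda>t. T t i j) t"
      "integral {0..} (\<lambda>t. exp (- 2 * \<eta> * t) * (D b t)\<^sup>2) \<le>
       integral {0..tf} (\<lambda>t. (nderiv {0..tf} b (\<lambda>t. T t i j) t)\<^sup>2) + \<delta> * (nderiv {0..tf} b (\<lambda>t. T t i j) tf)\<^sup>2"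
    have "?P i j D"
      using D(1-3,5) D(4)[of 0] by (simp add: time_deriv_def nderiv_0)
    then show ?thesis by blast
  qed
  then have "\<forall>a. \<exists>D. fst a \<le> k \<longrightarrow> snd a < N \<longrightarrow> ?P (fst a) (snd a) D" by blast
  from choice[OF this] obtain D where D: "\<forall>a. fst a \<le> k \<longrightarrow> snd a < N \<longrightarrow> ?P (fst a) (snd a) (D a)" ..
  have "?P i j (D (i, j))" if "i \<le> k" "j < N" for i j
    using D[rule_format, of "(i, j)"] that by simp
  then have "continues tf T \<delta> (\<lambda>i j. D (i, j))" unfolding continues_def by blast
  then show ?thesis by blast
qed

text \<open>The given solution and Duhamel's solution for the continued data have the same forcing
  on [0, tf] and zero initial data, so stability identifies them there, whichever continuation was
  chosen.\<close>

lemma solution_eq_duhamel: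
  assumes D: "continues tf T \<delta> D"
  shows "t \<in> {0..tf} \<Longrightarrow> j < N \<Longrightarrow> \<zeta> t i j = Z D t i j"
    and "\<exists>C. \<forall>t\<in>{0..tf}. decays N C (Z D t)"
proof -
  have fc: "continuous_on {0..} (force D i j)" if "i \<le> k" "j < N" for i j
    by (rule force_continuous[OF continuesD(1-3)[OF D] that])
  note S = duhamel_solution[where F="force D" and k=k, OF fc tf]
  have f: "column_forcing k (\<lambda>l. force D l j t) i = h powr p * column_forcing k (\<lambda>l. T t l j) i"
    if "t \<in> {0..tf}" "j < N" for t i j
    using continuesD(4)[OF D] that by (auto simp: column_forcing_def force_def)
  have ZS: "semidiscrete_solution N A B tf (\<lambda>t i j. h powr p * column_forcing k (\<lambda>l. T t l j) i) (Z D)"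
    unfolding Z_def by (rule semidiscrete_solution_cong[OF S(1) f])
  show "\<zeta> t i j = Z D t i j" if t: "t \<in> {0..tf}" and j: "j < N"
  proof (rule semidiscrete_solution_unique[OF tf A st mesh \<zeta> ZS _ _ t j])
    show "\<zeta> 0 i j = Z D 0 i j" if "j < N" for i j
      using \<zeta>0(1)[OF that] by (simp add: Z_def duhamel_def split_beta)
    show "time_deriv {0..tf} 1 \<zeta> 0 i j = time_deriv {0..tf} 1 (Z D) 0 i j" if "j < N" for i j
      using \<zeta>0(2)[OF that] S(2)[of 0 j i] tf that unfolding Z_def by (simp add: duhamel_def split_beta)
  qed
  show "\<exists>C. \<forall>t\<in>{0..tf}. decays N C (Z D t)"
    unfolding Z_def by (rule duhamel_decays[OF fc])
qed

text \<open>The definition of a solution provides square summability; geometric decay in x is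
  inherited from Duhamel's formula.\<close>

lemma solution_decays: "\<exists>C. \<forall>t\<in>{0..tf}. decays N C (\<zeta> t)"
proof -
  obtain D where D: "continues tf T 1 D" using ex_continues[of 1] by auto
  then obtain C where C: "\<forall>t\<in>{0..tf}. decays N C (Z D t)" using solution_eq_duhamel(2) by blast
  have "decays N C (\<zeta> t)" if t: "t \<in> {0..tf}" for t
    using C solution_eq_duhamel(1)[OF D t] t by (simp add: decays_def)
  then show ?thesis by blast
qed

text \<open>The left side does not depend on the continuation, so \<delta> may tend to 0, and the
  value of the b-th derivative at the final time disappears from the bound.\<close>

lemma solution_partial_energy:
  "integral {0..tf} (\<lambda>t. \<Sum>i<n. \<Sum>j<N. (\<zeta> t i j)\<^sup>2) \<le>
     exp (2 * \<eta> * tf) * (cond_number \<Phi>)\<^sup>2 * (estimate_const / h) *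
     (\<Sum>i\<le>k. \<Sum>j<N. integral {0..tf} (\<lambda>t. (Tb t i j)\<^sup>2))"
proof -
  let ?L = "integral {0..tf} (\<lambda>t. \<Sum>i<n. \<Sum>j<N. (\<zeta> t i j)\<^sup>2)"
  let ?c = "exp (2 * \<eta> * tf) * (cond_number \<Phi>)\<^sup>2 * (estimate_const / h)"
  let ?I = "\<Sum>i\<le>k. \<Sum>j<N. integral {0..tf} (\<lambda>t. (Tb t i j)\<^sup>2)"
  let ?J = "\<Sum>i\<le>k. \<Sum>j<N. (Tb tf i j)\<^sup>2"
  have c: "?c \<ge> 0" using estimate_const_nonneg mesh by simp
  have le: "?L \<le> ?c * (?I + \<delta> * ?J)" if \<delta>: "\<delta> > 0" for \<delta>
  proof -
    obtain D where D: "continues tf T \<delta> D" using ex_continues[OF \<delta>] ..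
    have "?L = integral {0..tf} (\<lambda>t. \<Sum>i<n. \<Sum>j<N. (Z D t i j)\<^sup>2)"
      by (intro integral_cong sum.cong refl) (simp add: solution_eq_duhamel(1)[OF D])
    also have "\<dots> \<le> ?c * (\<Sum>i\<le>k. \<Sum>j<N. integral {0..} (\<lambda>t. exp (- 2 * \<eta> * t) * (D i j b t)\<^sup>2))"
      by (rule finite_time_bound[OF continuesD(1-3)[OF D] tf])
    also have "\<dots> \<le> ?c * (\<Sum>i\<le>k. \<Sum>j<N. integral {0..tf} (\<lambda>t. (Tb t i j)\<^sup>2) + \<delta> * (Tb tf i j)\<^sup>2)"
      by (intro mult_left_mono[OF _ c] sum_mono continuesD(5)[OF D]) auto
    finally show ?thesis by (simp only: sum.distrib sum_distrib_left)
  qed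
  have "?L \<le> ?c * (?I + 0 * ?J)"
  proof (rule tendsto_lowerbound)
    show "((\<lambda>\<delta>. ?c * (?I + \<delta> * ?J)) \<longlongrightarrow> ?c * (?I + 0 * ?J)) (at_right 0)"
      by (intro tendsto_intros)
    show "\<forall>\<^sub>F \<delta> in at_right 0. ?L \<le> ?c * (?I + \<delta> * ?J)"
      using eventually_at_right_less by (rule eventually_mono) (rule le)
  qed simp
  then show ?thesis by simp
qed

lemma data_integrable:
  assumes "i \<le> k" "j < N" "l \<le> b"
  shows "(\<lambda>t. (time_deriv {0..tf} l T t i j)\<^sup>2) integrable_on {0..tf}"
  unfolding time_deriv_def
  by (intro integrable_continuous_real continuous_intros deriv_chain_continuous[OF chain_C_on[OF T]]) (use assms in auto)

lemma solution_energy: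
  "integral {0..tf} (\<lambda>t. (norm2D N (\<zeta> t))\<^sup>2) \<le>
     estimate_const * exp (2 * \<eta> * tf) *
     integral {0..tf} (\<lambda>t. (cond_number \<Phi>)\<^sup>2 * (\<Sum>i\<le>k. (norm1Dy N (T t i))\<^sup>2 + (norm1Dy N (Tb t i))\<^sup>2))"
proof -
  let ?R = "integral {0..tf} (\<lambda>t. (cond_number \<Phi>)\<^sup>2 * (\<Sum>i\<le>k. (norm1Dy N (T t i))\<^sup>2 + (norm1Dy N (Tb t i))\<^sup>2))"
  let ?I = "\<Sum>i\<le>k. \<Sum>j<N. integral {0..tf} (\<lambda>t. (Tb t i j)\<^sup>2)"
  let ?c = "exp (2 * \<eta> * tf) * (cond_number \<Phi>)\<^sup>2 * (estimate_const / h)"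
  have T_int: "(\<lambda>t. (norm1Dy N (T t i))\<^sup>2) integrable_on {0..tf}"
    and Tb_int: "(\<lambda>t. (norm1Dy N (Tb t i))\<^sup>2) integrable_on {0..tf}" if i: "i \<le> k" for i
  proof -
    have "(\<lambda>t. (T t i j)\<^sup>2) integrable_on {0..tf}" if "j < N" for j
      using data_integrable[OF i that, of 0] by (simp add: time_deriv_def nderiv_0)
    then show "(\<lambda>t. (norm1Dy N (T t i))\<^sup>2) integrable_on {0..tf}"
      unfolding norm1Dy_square[OF mesh] by (intro integrable_on_mult_right integrable_sum) auto
    show "(\<lambda>t. (norm1Dy N (Tb t i))\<^sup>2) integrable_on {0..tf}"
      unfolding norm1Dy_square[OF mesh] by (intro integrable_on_mult_right integrable_sum data_integrable i) auto
  qed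
  have "(cond_number \<Phi>)\<^sup>2 * (h * ?I) = (cond_number \<Phi>)\<^sup>2 * (\<Sum>i\<le>k. integral {0..tf} (\<lambda>t. (norm1Dy N (Tb t i))\<^sup>2))"
  proof -
    have "integral {0..tf} (\<lambda>t. (norm1Dy N (Tb t i))\<^sup>2) = h * (\<Sum>j<N. integral {0..tf} (\<lambda>t. (Tb t i j)\<^sup>2))" if i: "i \<le> k" for i
      unfolding norm1Dy_square[OF mesh] integral_mult_right
      by (subst Henstock_Kurzweil_Integration.integral_sum) (use data_integrable[OF i] in auto)
    then show ?thesis by (simp add: sum_distrib_left)
  qed
  also have "\<dots> = integral {0..tf} (\<lambda>t. (cond_number \<Phi>)\<^sup>2 * (\<Sum>i\<le>k. (norm1Dy N (Tb t i))\<^sup>2))"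
    unfolding integral_mult_right
    by (subst Henstock_Kurzweil_Integration.integral_sum) (use Tb_int in auto)
  \<comment> \<open>The terms with T itself join the bound at this point, as nonnegative
    summands.\<close>
  also have "\<dots> \<le> ?R"
  proof (rule integral_le)
    show "(\<lambda>t. (cond_number \<Phi>)\<^sup>2 * (\<Sum>i\<le>k. (norm1Dy N (Tb t i))\<^sup>2)) integrable_on {0..tf}"
      by (intro integrable_on_mult_right integrable_sum Tb_int) auto
    show "(\<lambda>t. (cond_number \<Phi>)\<^sup>2 * (\<Sum>i\<le>k. (norm1Dy N (T t i))\<^sup>2 + (norm1Dy N (Tb t i))\<^sup>2)) integrable_on {0..tf}"
      by (intro integrable_on_mult_right integrable_sum integrable_add T_int Tb_int) auto
  qed (intro mult_left_mono sum_mono, auto)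
  finally have "(estimate_const * exp (2 * \<eta> * tf)) * ((cond_number \<Phi>)\<^sup>2 * (h * ?I)) \<le> (estimate_const * exp (2 * \<eta> * tf)) * ?R"
    using estimate_const_nonneg by (intro mult_left_mono) auto
  \<comment> \<open>The h^2 of the squared \<open>norm2D\<close> times the 1 / h from
    \<open>norm1Dx\<close> leaves the single h of the squared \<open>norm1Dy\<close>.\<close>
  moreover have "h\<^sup>2 * (?c * ?I) = (estimate_const * exp (2 * \<eta> * tf)) * ((cond_number \<Phi>)\<^sup>2 * (h * ?I))"
    using mesh by (simp add: power2_eq_square)
  ultimately have R: "h\<^sup>2 * (?c * ?I) \<le> estimate_const * exp (2 * \<eta> * tf) * ?R" by simp
  show ?thesis
  proof (cases "(\<lambda>t. (norm2D N (\<zeta> t))\<^sup>2) integrable_on {0..tf}")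
    case False \<comment> \<open>the integral is \<open>0\<close> by convention\<close>
    have "?I \<ge> 0" by (intro sum_nonneg integral_nonneg data_integrable) auto
    then have "0 \<le> h\<^sup>2 * (?c * ?I)" using estimate_const_nonneg mesh by simp
    then show ?thesis using R not_integrable_integral[OF False] by simp
  next
    case True
    obtain C where C: "\<And>t. t \<in> {0..tf} \<Longrightarrow> decays N C (\<zeta> t)" using solution_decays by blast
    let ?d = "h\<^sup>2 * (real N * C\<^sup>2 * (4 / 3))"
    have sq: "(\<lambda>t. \<Sum>i<n. \<Sum>j<N. (\<zeta> t i j)\<^sup>2) integrable_on {0..tf}" for n
    proof -
      have "continuous_on {0..tf} (\<lambda>t. \<zeta> t i j)" if "j < N" for i j
        using deriv_chain_continuous[OF chain_C_on, of 2 "{0..tf}" "\<lambda>t. \<zeta> t i j" 0] \<zeta> that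
        by (simp add: semidiscrete_solution_def nderiv_0)
      then show ?thesis by (intro integrable_continuous_real continuous_intros) auto
    qed
    have le: "integral {0..tf} (\<lambda>t. (norm2D N (\<zeta> t))\<^sup>2) \<le> h\<^sup>2 * (?c * ?I) + tf * ?d * (1 / 4) ^ n" for n
    proof -
      have "integral {0..tf} (\<lambda>t. (norm2D N (\<zeta> t))\<^sup>2) \<le>
          integral {0..tf} (\<lambda>t. h\<^sup>2 * (\<Sum>i<n. \<Sum>j<N. (\<zeta> t i j)\<^sup>2) + ?d * (1 / 4) ^ n)"
        by (rule integral_le[OF True _ norm2D_square_le[OF C]]) (intro integrable_add integrable_on_mult_right sq integrable_const_ivl)
      also have "\<dots> = h\<^sup>2 * integral {0..tf} (\<lambda>t. \<Sum>i<n. \<Sum>j<N. (\<zeta> t i j)\<^sup>2) + tf * (?d * (1 / 4) ^ n)"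
        using tf by (subst Henstock_Kurzweil_Integration.integral_add) (auto intro: sq integrable_on_mult_right)
      also have "\<dots> \<le> h\<^sup>2 * (?c * ?I) + tf * (?d * (1 / 4) ^ n)"
        by (intro add_right_mono mult_left_mono solution_partial_energy) auto
      finally show ?thesis by (simp only: mult.assoc)
    qed
    \<comment> \<open>The remainder was bounded uniformly in t, so n can tend to infinity after the
      integration in time.\<close>
    have "(\<lambda>n. h\<^sup>2 * (?c * ?I) + tf * ?d * (1 / 4) ^ n) \<longlonglongrightarrow> h\<^sup>2 * (?c * ?I) + tf * ?d * 0"
      by (intro tendsto_intros LIMSEQ_realpow_zero) auto
    then have "integral {0..tf} (\<lambda>t. (norm2D N (\<zeta> t))\<^sup>2) \<le> h\<^sup>2 * (?c * ?I) + tf * ?d * 0"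
      by (rule LIMSEQ_le_const) (use le in auto)
    then show ?thesis using R by simp
  qed
qed

end

end

theorem theorem1:
  fixes \<eta> g m p :: real and b k N0 :: nat
    and Qx :: "nat \<Rightarrow> nat \<Rightarrow> nat \<Rightarrow> real"
    and Qy P \<Phi> :: "nat \<Rightarrow> real mat"
    and lam :: "nat \<Rightarrow> nat \<Rightarrow> real"
  assumes "\<eta> > 0" and "N0 \<ge> 2"
    and Qx: "\<forall>N\<ge>N0. finite_difference_operator (Qx N)"
    and Qy: "\<forall>N\<ge>N0. Qy N \<in> carrier_mat N N"
    and P: "\<forall>N\<ge>N0. pos_definite N (P N) \<and> neg_semidefinite N (P N * Qy N)"
    and P_bounds: "\<exists>M. \<forall>N\<ge>N0. spectral_norm (mat_sqrt (P N)) \<le> M \<and>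
                               spectral_norm (mat_inv (mat_sqrt (P N))) \<le> M"
    and diag: "\<forall>N\<ge>N0. normalized_diagonalization N (P N) (Qy N) (\<Phi> N) (lam N)"
    and stable: "\<exists>\<alpha><\<eta>. stable_with_growth \<alpha> N0 Qx Qy"
    and scalar: "\<exists>K. \<forall>N\<ge>N0. \<forall>s. Re s = \<eta> \<longrightarrow>
                   (\<forall>r<N. scalar_estimate K \<eta> g m p b k N (Qx N) (lam N r) s)"
  shows "\<exists>K. \<forall>N\<ge>N0. \<forall>tf>0. \<forall>T \<zeta>.
           (\<forall>i\<le>k. \<forall>j<N. C_on b {0..tf} (\<lambda>t. T t i j) \<and>
                           (\<forall>l<b. time_deriv {0..tf} l T 0 i j = 0)) \<longrightarrow>
           semidiscrete_solution N (Qx N) (Qy N) tf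
             (\<lambda>t i j. mesh N powr p * column_forcing k (\<lambda>l. T t l j) i) \<zeta> \<longrightarrow>
           (\<forall>i. \<forall>j<N. \<zeta> 0 i j = 0 \<and> time_deriv {0..tf} 1 \<zeta> 0 i j = 0) \<longrightarrow>
           integral {0..tf} (\<lambda>t. (norm2D N (\<zeta> t))\<^sup>2) \<le>
             K * exp (2 * \<eta> * tf) * mesh N powr (2 * g) / \<eta> powr m *
             integral {0..tf} (\<lambda>t. (cond_number (\<Phi> N))\<^sup>2 *
               (\<Sum>i\<le>k. (norm1Dy N (T t i))\<^sup>2 + (norm1Dy N (time_deriv {0..tf} b T t i))\<^sup>2))"
proof -
  obtain \<alpha> where \<alpha>: "\<alpha> < \<eta>" and "stable_with_growth \<alpha> N0 Qx Qy" using stable by blast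
  then obtain C where C: "\<And>N. N \<ge> N0 \<Longrightarrow> stable_at \<alpha> N (Qx N) (Qy N) C"
    unfolding stable_with_growth_def stable_at_def by blast
  obtain K where K: "\<And>N s r. N \<ge> N0 \<Longrightarrow> Re s = \<eta> \<Longrightarrow> r < N \<Longrightarrow> scalar_estimate K \<eta> g m p b k N (Qx N) (lam N r) s"
    using scalar by blast
  \<comment> \<open>The hypothesis leaves the sign of K open. Its maximum with 0 preserves the
    estimate and makes the later monotonicity steps valid.\<close>
  have K': "scalar_estimate (max K 0) \<eta> g m p b k N (Qx N) (lam N r) s"
    if N: "N \<ge> N0" "Re s = \<eta>" "r < N" for N s r
    unfolding scalar_estimate_def
  proof (intro allI impI)
    fix \<tau> :: "nat \<Rightarrow> real \<Rightarrow> real" and e :: "nat \<Rightarrow> complex"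
    let ?S = "\<Sum>i\<le>k. (cmod (laplace (\<tau> i) s))\<^sup>2 + (cmod (laplace (nderiv {0..} b (\<tau> i)) s))\<^sup>2"
    assume "\<forall>i\<le>k. laplace_data b s (\<tau> i)" "summable (\<lambda>i. (cmod (e i))\<^sup>2)"
      "\<forall>i. ((s * of_real (mesh N))\<^sup>2 + of_real ((mesh N)\<^sup>2 * lam N r)) * e i =
               apply_x (Qx N) e i +
               of_real (mesh N powr (p + 2)) * column_forcing k (\<lambda>l. laplace (\<tau> l) s) i"
    then have "(norm1Dx N e)\<^sup>2 \<le> K * mesh N powr (2 * g) / \<eta> powr m * ?S"
      using K[OF N] unfolding scalar_estimate_def by blast
    also have "\<dots> \<le> max K 0 * mesh N powr (2 * g) / \<eta> powr m * ?S"
      by (intro mult_right_mono divide_right_mono sum_nonneg) auto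
    finally show "(norm1Dx N e)\<^sup>2 \<le> max K 0 * mesh N powr (2 * g) / \<eta> powr m * ?S" .
  qed
  show ?thesis
  proof (intro exI[of _ "max K 0 * (1 + (1 / \<eta>) ^ (2 * b))"] allI impI)
    fix N :: nat and tf :: real and T \<zeta> :: "real \<Rightarrow> nat \<Rightarrow> nat \<Rightarrow> real"
    assume N: "N \<ge> N0" and tf: "tf > 0"
      and T: "\<forall>i\<le>k. \<forall>j<N. C_on b {0..tf} (\<lambda>t. T t i j) \<and> (\<forall>l<b. time_deriv {0..tf} l T 0 i j = 0)"
      and \<zeta>: "semidiscrete_solution N (Qx N) (Qy N) tf
             (\<lambda>t i j. mesh N powr p * column_forcing k (\<lambda>l. T t l j) i) \<zeta>"
      and \<zeta>0: "\<forall>i. \<forall>j<N. \<zeta> 0 i j = 0 \<and> time_deriv {0..tf} 1 \<zeta> 0 i j = 0"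
    interpret error_grid N "Qx N" "Qy N" \<alpha> C "P N" "\<Phi> N" "lam N" \<eta> g m p "max K 0" b k
    proof
      show "mesh N > 0" using N \<open>N0 \<ge> 2\<close> by (simp add: mesh_def)
    qed (use N Qx Qy C diag \<alpha> K' \<open>\<eta> > 0\<close> in auto)
    have "integral {0..tf} (\<lambda>t. (norm2D N (\<zeta> t))\<^sup>2) \<le> estimate_const * exp (2 * \<eta> * tf) *
        integral {0..tf} (\<lambda>t. (cond_number (\<Phi> N))\<^sup>2 *
          (\<Sum>i\<le>k. (norm1Dy N (T t i))\<^sup>2 + (norm1Dy N (time_deriv {0..tf} b T t i))\<^sup>2))"
      by (rule solution_energy[OF tf _ _ \<zeta>]) (use T \<zeta>0 in auto)
    also have "estimate_const * exp (2 * \<eta> * tf) = max K 0 * (1 + (1 / \<eta>) ^ (2 * b)) * exp (2 * \<eta> * tf) * mesh N powr (2 * g) / \<eta> powr m"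
      by (simp add: estimate_const_def)
    finally show "integral {0..tf} (\<lambda>t. (norm2D N (\<zeta> t))\<^sup>2) \<le>
             max K 0 * (1 + (1 / \<eta>) ^ (2 * b)) * exp (2 * \<eta> * tf) * mesh N powr (2 * g) / \<eta> powr m *
             integral {0..tf} (\<lambda>t. (cond_number (\<Phi> N))\<^sup>2 *
               (\<Sum>i\<le>k. (norm1Dy N (T t i))\<^sup>2 + (norm1Dy N (time_deriv {0..tf} b T t i))\<^sup>2))" .
  qed
qed

end
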